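(* Let $\Omega=\prod_{i=1}^d[-a_i,a_i]\subset\mathbb{R}^d$ with all $a_i>0$, let $T>0$, $Q=[0,T]\times\Omega$, $\Sigma_T=[0,T]\times\partial\Omega$, and fix weights $\kappa,\mu,\nu>0$. Let $u\ge 0$ be a strong solution of the quadratic porous medium equation $\partial_t u=\tfrac12\Delta u^2$ in $Q$ with homogeneous Dirichlet boundary condition $u|_{\Sigma_T}=0$ and initial condition $u(0,\cdot)=u_0$ in $\Omega$. Then there exist constants $\tilde C_1,C,\tilde C_2>0$, independent of $t$ and of $\hat u$, such that for every smooth function $\hat u$ on $Q$ with $\hat u|_{\Sigma_T}=0$, writing $\hat u_0=\hat u(0,\cdot)$, and for every $t\in[0,T]$, $$\|u(t)-\hat u(t)\|_{1}\le \|u_0-\hat u_0\|_1+\int_0^t\Big\|\partial_t\hat u(s)-\tfrac12\Delta \hat u^2(s)\Big\|_1\,ds\le \tilde C_1\,\mathcal{L}_{\mathrm{PINN}\text{-}L^1}(\hat u)$$ and $$\|u(t)-\hat u(t)\|_{1}^2\le C\Big(\|u_0-\hat u_0\|_2^2+\int_0^t\Big\|\partial_t\hat u(s)-\tfrac12\Delta \hat u^2(s)\Big\|_2^2\,ds\Big)\le \tilde C_2\,\mathcal{L}_{\mathrm{PINN}\text{-}L^2}(\hat u).$$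
   Context: $\Delta$ is the Laplacian in the space variables $x\in\Omega$ only, and $\Delta \hat u^2$ means $\Delta(\hat u^2)$. $\|\cdot\|_1$ and $\|\cdot\|_2$ denote the $L^1(\Omega)$ and $L^2(\Omega)$ norms in space, and $u(t)=u(t,\cdot)$. "Smooth on $Q$" means $C^\infty$ up to the boundary of $Q$. Strong solution (standard notion for the Dirichlet problem): $u\in C([0,T];L^1(\Omega))$ with $u(0)=u_0$, $u^2\in L^2(\tau,T;H^1_0(\Omega))$ for every $\tau\in(0,T)$ (this encodes the boundary condition), $\partial_t u$ and $\Delta u^2$ belong to $L^1(\tau,T;L^1(\Omega))$ for every $\tau\in(0,T)$, and $\partial_t u=\frac12\Delta u^2$ a.e. in $Q$. The loss functionals (with values in $[0,\infty]$) are $$\mathcal{L}_{\mathrm{PINN}\text{-}L^1}(v)=\kappa\int_Q\Big|\partial_t v-\tfrac12\Delta v^2\Big|\,dx\,dt+\mu\int_{\Sigma_T}|v|+\nu\int_\Omega|v(0,x)-u_0(x)|\,dx,$$ $$\mathcal{L}_{\mathrm{PINN}\text{-}L^2}(v)=\kappa\int_Q\Big(\partial_t v-\tfrac12\Delta v^2\Big)^2dx\,dt+\mu\int_{\Sigma_T}v^2+\nu\int_\Omega\big(v(0,x)-u_0(x)\big)^2dx,$$ where the integrals over $\Sigma_T$ are with respect to surface measure. *)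

theory Defs
  imports "HOL-Analysis.Analysis"
begin

text \<open>Throughout, \<open>\<Omega>\<close> is the closed box \<open>cbox (- a) a\<close>, with interior \<open>box (- a) a\<close>, and space-time
  is \<open>real \<times> (real^'n)\<close>. Functions of \<open>(t, x)\<close> are curried, so that \<open>u t\<close> is the time slice.\<close>

subsection \<open>Classical derivatives, smoothness, test functions\<close>

definition partial_d :: "'a \<Rightarrow> ('a::euclidean_space \<Rightarrow> real) \<Rightarrow> 'a \<Rightarrow> real" where
  "partial_d b f z = deriv (\<lambda>h. f (z + h *\<^sub>R b)) 0"

definition laplacian :: "('a::euclidean_space \<Rightarrow> real) \<Rightarrow> 'a \<Rightarrow> real" where
  "laplacian f z = (\<Sum>b\<in>Basis. partial_d b (partial_d b f) z)"

primrec iter_partial :: "'a list \<Rightarrow> ('a::euclidean_space \<Rightarrow> real) \<Rightarrow> 'a \<Rightarrow> real" where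
  "iter_partial [] f = f"
| "iter_partial (b # bs) f = partial_d b (iter_partial bs f)"

text \<open>\<open>C\<^sup>\<infinity>\<close> on an open set. Differentiability of all iterated partial derivatives also makes
  all of them continuous.\<close>

definition smooth_on :: "'a set \<Rightarrow> ('a::euclidean_space \<Rightarrow> real) \<Rightarrow> bool" where
  "smooth_on S f \<longleftrightarrow>
     (\<forall>bs. set bs \<subseteq> Basis \<longrightarrow> (\<forall>z\<in>S. iter_partial bs f differentiable (at z)))"

text \<open>\<open>C\<^sup>\<infinity>\<close> up to the boundary of \<open>K\<close>: smooth inside, and every derivative
  extends continuously to \<open>K\<close>. Only the values of \<open>f\<close> on \<open>K\<close> matter.\<close>

definition smooth_up_to_boundary :: "'a set \<Rightarrow> ('a::euclidean_space \<Rightarrow> real) \<Rightarrow> bool" where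
  "smooth_up_to_boundary K f \<longleftrightarrow>
     continuous_on K f \<and> smooth_on (interior K) f \<and>
     (\<forall>bs. set bs \<subseteq> Basis \<longrightarrow>
        (\<exists>g. continuous_on K g \<and> (\<forall>z\<in>interior K. g z = iter_partial bs f z)))"

definition test_function :: "'a set \<Rightarrow> ('a::euclidean_space \<Rightarrow> real) \<Rightarrow> bool" where
  "test_function U \<phi> \<longleftrightarrow>
     smooth_on UNIV \<phi> \<and> (\<exists>K. compact K \<and> K \<subseteq> U \<and> (\<forall>z. z \<notin> K \<longrightarrow> \<phi> z = 0))"

subsection \<open>Norms and weak derivatives\<close>

definition L1_norm :: "'a set \<Rightarrow> ('a::euclidean_space \<Rightarrow> real) \<Rightarrow> ennreal" where
  "L1_norm S f = (\<integral>\<^sup>+x. ennreal \<bar>f x\<bar> \<partial>lebesgue_on S)"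

text \<open>The square of the \<open>L\<^sup>2\<close> norm.\<close>

definition L2_norm_sq :: "'a set \<Rightarrow> ('a::euclidean_space \<Rightarrow> real) \<Rightarrow> ennreal" where
  "L2_norm_sq S f = (\<integral>\<^sup>+x. ennreal ((f x)\<^sup>2) \<partial>lebesgue_on S)"

definition in_L2 :: "'a set \<Rightarrow> ('a::euclidean_space \<Rightarrow> real) \<Rightarrow> bool" where
  "in_L2 S f \<longleftrightarrow> f \<in> borel_measurable (lebesgue_on S) \<and> L2_norm_sq S f < \<infinity>"

definition loc_integrable :: "'a set \<Rightarrow> ('a::euclidean_space \<Rightarrow> real) \<Rightarrow> bool" where
  "loc_integrable U f \<longleftrightarrow> (\<forall>K. compact K \<and> K \<subseteq> U \<longrightarrow> integrable (lebesgue_on K) f)"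

definition has_weak_partial ::
    "'a set \<Rightarrow> 'a \<Rightarrow> ('a::euclidean_space \<Rightarrow> real) \<Rightarrow> ('a \<Rightarrow> real) \<Rightarrow> bool" where
  "has_weak_partial U b f g \<longleftrightarrow>
     loc_integrable U f \<and> loc_integrable U g \<and>
     (\<forall>\<phi>. test_function U \<phi> \<longrightarrow>
        (\<integral>z. f z * partial_d b \<phi> z \<partial>lebesgue_on U) = - (\<integral>z. g z * \<phi> z \<partial>lebesgue_on U))"

text \<open>Distributional Laplacian in the space variables only, on an open space-time set \<open>W\<close>.\<close>

definition has_weak_space_laplacian ::
    "(real \<times> (real^'n)) set \<Rightarrow> (real \<times> (real^'n) \<Rightarrow> real) \<Rightarrow> (real \<times> (real^'n) \<Rightarrow> real) \<Rightarrow> bool" where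
  "has_weak_space_laplacian W f g \<longleftrightarrow>
     loc_integrable W f \<and> loc_integrable W g \<and>
     (\<forall>\<phi>. test_function W \<phi> \<longrightarrow>
        (\<integral>z. f z * laplacian (\<lambda>y. \<phi> (fst z, y)) (snd z) \<partial>lebesgue_on W) =
        (\<integral>z. g z * \<phi> z \<partial>lebesgue_on W))"

subsection \<open>Sobolev and Bochner spaces\<close>

text \<open>\<open>in_H1 U f G\<close>: \<open>f \<in> H\<^sup>1(U)\<close> with weak gradient \<open>G\<close>.\<close>

definition in_H1 ::
    "(real^'n) set \<Rightarrow> (real^'n \<Rightarrow> real) \<Rightarrow> (real^'n \<Rightarrow> real^'n) \<Rightarrow> bool" where
  "in_H1 U f G \<longleftrightarrow>
     in_L2 U f \<and>
     (\<forall>i. in_L2 U (\<lambda>x. G x $ i) \<and> has_weak_partial U (axis i 1) f (\<lambda>x. G x $ i))"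

definition H1_norm_sq ::
    "(real^'n) set \<Rightarrow> (real^'n \<Rightarrow> real) \<Rightarrow> (real^'n \<Rightarrow> real^'n) \<Rightarrow> ennreal" where
  "H1_norm_sq U f G = L2_norm_sq U f + (\<Sum>i\<in>UNIV. L2_norm_sq U (\<lambda>x. G x $ i))"

text \<open>\<open>H\<^sup>1\<^sub>0(U)\<close> is the closure of the test functions in \<open>H\<^sup>1(U)\<close>.\<close>

definition in_H10 ::
    "(real^'n) set \<Rightarrow> (real^'n \<Rightarrow> real) \<Rightarrow> (real^'n \<Rightarrow> real^'n) \<Rightarrow> bool" where
  "in_H10 U f G \<longleftrightarrow>
     in_H1 U f G \<and>
     (\<exists>\<phi>::nat \<Rightarrow> real^'n \<Rightarrow> real. (\<forall>k. test_function U (\<phi> k)) \<and>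
        (\<lambda>k. H1_norm_sq U (\<lambda>x. f x - \<phi> k x) (\<lambda>x. G x - (\<chi> i. partial_d (axis i 1) (\<phi> k) x)))
          \<longlonglongrightarrow> 0)"

text \<open>\<open>w \<in> L\<^sup>2(\<tau>, T; H\<^sup>1\<^sub>0(U))\<close>. Measurability of \<open>t \<mapsto> w t\<close> with values in \<open>H\<^sup>1\<^sub>0(U)\<close> is expressed as
  joint measurability of \<open>w\<close> and of its space gradient.\<close>

definition in_L2_H10 ::
    "real \<Rightarrow> real \<Rightarrow> (real^'n) set \<Rightarrow> (real \<Rightarrow> real^'n \<Rightarrow> real) \<Rightarrow> bool" where
  "in_L2_H10 \<tau> T U w \<longleftrightarrow>
     (\<lambda>(t, x). w t x) \<in> borel_measurable (lebesgue_on ({\<tau><..<T} \<times> U)) \<and>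
     (\<exists>G. (\<lambda>(t, x). G t x) \<in> borel_measurable (lebesgue_on ({\<tau><..<T} \<times> U)) \<and>
        (AE t in lebesgue_on {\<tau><..<T}. in_H10 U (w t) (G t)) \<and>
        (\<integral>\<^sup>+t. H1_norm_sq U (w t) (G t) \<partial>lebesgue_on {\<tau><..<T}) < \<infinity>)"

definition in_C_L1 :: "real \<Rightarrow> 'a set \<Rightarrow> (real \<Rightarrow> 'a::euclidean_space \<Rightarrow> real) \<Rightarrow> bool" where
  "in_C_L1 T S u \<longleftrightarrow>
     (\<forall>t\<in>{0..T}. integrable (lebesgue_on S) (u t) \<and>
        ((\<lambda>s. L1_norm S (\<lambda>x. u s x - u t x)) \<longlongrightarrow> 0) (at t within {0..T}))"

subsection \<open>Strong solutions of the porous medium equation\<close>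

text \<open>The derivatives \<open>\<partial>\<^sub>t u\<close> and \<open>\<Delta>u\<^sup>2\<close> are distributional on the open cylinder, and
  \<open>L\<^sup>1(\<tau>, T; L\<^sup>1(\<Omega>))\<close> is identified with \<open>L\<^sup>1((\<tau>, T) \<times> \<Omega>)\<close>. Joint measurability is required because
  \<open>u\<close> is a pointwise function, whereas an element of \<open>C([0,T]; L\<^sup>1(\<Omega>))\<close> only has a jointly measurable
  representative.\<close>

definition strong_solution ::
    "real^'n \<Rightarrow> real \<Rightarrow> (real^'n \<Rightarrow> real) \<Rightarrow> (real \<Rightarrow> real^'n \<Rightarrow> real) \<Rightarrow> bool" where
  "strong_solution a T u0 u \<longleftrightarrow>
     (\<lambda>(t, x). u t x) \<in> borel_measurable (lebesgue_on ({0..T} \<times> cbox (- a) a)) \<and>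
     in_C_L1 T (cbox (- a) a) u \<and>
     (AE x in lebesgue_on (cbox (- a) a). u 0 x = u0 x) \<and>
     (\<forall>\<tau>\<in>{0<..<T}. in_L2_H10 \<tau> T (box (- a) a) (\<lambda>t x. (u t x)\<^sup>2)) \<and>
     (\<exists>ut lap.
        has_weak_partial ({0<..<T} \<times> box (- a) a) (1, 0) (\<lambda>(t, x). u t x) ut \<and>
        has_weak_space_laplacian ({0<..<T} \<times> box (- a) a) (\<lambda>(t, x). (u t x)\<^sup>2) lap \<and>
        (\<forall>\<tau>\<in>{0<..<T}. integrable (lebesgue_on ({\<tau><..<T} \<times> box (- a) a)) ut \<and>
                        integrable (lebesgue_on ({\<tau><..<T} \<times> box (- a) a)) lap) \<and>
        (AE z in lebesgue_on ({0<..<T} \<times> box (- a) a). ut z = 1 / 2 * lap z))"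

subsection \<open>Residual and loss functionals\<close>

text \<open>Classical residual \<open>\<partial>\<^sub>t v - \<Delta>v\<^sup>2 / 2\<close>. For \<open>v\<close> smooth up to the boundary of the closed cylinder it is
  meaningful in the interior only; its arbitrary values on the boundary, a null set, do not
  affect any of the integrals below.\<close>

definition residual :: "(real \<Rightarrow> real^'n \<Rightarrow> real) \<Rightarrow> real \<Rightarrow> real^'n \<Rightarrow> real" where
  "residual v t x = deriv (\<lambda>s. v s x) t - 1 / 2 * laplacian (\<lambda>y. (v t y)\<^sup>2) x"

text \<open>Integral over the boundary of \<open>cbox (- a) a\<close> with respect to surface measure, as the sum over the
  \<open>2d\<close> flat faces \<open>x\<^sub>i = \<plusminus> a\<^sub>i\<close>, each with \<open>(d-1)\<close>-dimensional Lebesgue measure (a point mass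
  if \<open>d = 1\<close>); distinct faces overlap in a null set.\<close>

definition box_surface_integral :: "real^'n \<Rightarrow> (real^'n \<Rightarrow> ennreal) \<Rightarrow> ennreal" where
  "box_surface_integral a f =
     (\<Sum>i\<in>UNIV. \<Sum>\<sigma>\<in>{-1, 1}.
        \<integral>\<^sup>+y. f (\<chi> j. if j = i then \<sigma> * a $ i else y j)
          \<partial>(\<Pi>\<^sub>M j\<in>UNIV - {i}. restrict_space lborel {- (a $ j)..a $ j}))"

definition PINN_L1 ::
    "real^'n \<Rightarrow> real \<Rightarrow> real \<Rightarrow> real \<Rightarrow> real \<Rightarrow> (real^'n \<Rightarrow> real) \<Rightarrow> (real \<Rightarrow> real^'n \<Rightarrow> real) \<Rightarrow> ennreal" where
  "PINN_L1 a T \<kappa> \<mu> \<nu> u0 v =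
     ennreal \<kappa> * (\<integral>\<^sup>+(t, x). ennreal \<bar>residual v t x\<bar> \<partial>lebesgue_on ({0..T} \<times> cbox (- a) a)) +
     ennreal \<mu> * (\<integral>\<^sup>+t. box_surface_integral a (\<lambda>x. ennreal \<bar>v t x\<bar>) \<partial>lebesgue_on {0..T}) +
     ennreal \<nu> * (\<integral>\<^sup>+x. ennreal \<bar>v 0 x - u0 x\<bar> \<partial>lebesgue_on (cbox (- a) a))"

definition PINN_L2 ::
    "real^'n \<Rightarrow> real \<Rightarrow> real \<Rightarrow> real \<Rightarrow> real \<Rightarrow> (real^'n \<Rightarrow> real) \<Rightarrow> (real \<Rightarrow> real^'n \<Rightarrow> real) \<Rightarrow> ennreal" where
  "PINN_L2 a T \<kappa> \<mu> \<nu> u0 v =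
     ennreal \<kappa> * (\<integral>\<^sup>+(t, x). ennreal ((residual v t x)\<^sup>2) \<partial>lebesgue_on ({0..T} \<times> cbox (- a) a)) +
     ennreal \<mu> * (\<integral>\<^sup>+t. box_surface_integral a (\<lambda>x. ennreal ((v t x)\<^sup>2)) \<partial>lebesgue_on {0..T}) +
     ennreal \<nu> * (\<integral>\<^sup>+x. ennreal ((v 0 x - u0 x)\<^sup>2) \<partial>lebesgue_on (cbox (- a) a))"

end

theory Submission
  imports Defs
begin

text \<open>Since \<open>u \<ge> 0\<close>, \<open>\<bar>u - v\<bar> = 2 (v - u)\<^sup>+ + u - v\<close>, and the three terms are estimated separately with
  \<open>\<partial>\<^sub>t u = \<Delta>u\<^sup>2 / 2\<close> and \<open>\<partial>\<^sub>t v = \<Delta>v\<^sup>2 / 2 + R\<close>, \<open>R\<close> the residual. On almost every time slice: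
  testing \<open>\<Delta>(v\<^sup>2 - u\<^sup>2)\<close> with an approximation of the indicator of \<open>(v\<^sup>+)\<^sup>2 > u\<^sup>2\<close>, that is of \<open>v > u\<close>,
  gives \<open>\<integral>\<^bsub>v > u\<^esub> \<Delta>(v\<^sup>2 - u\<^sup>2) \<le> 0\<close>; testing \<open>\<Delta>u\<^sup>2\<close> with an approximation of the indicator of \<open>u\<^sup>2 > 0\<close>, which
  is admissible because \<open>u\<^sup>2 \<in> H\<^sup>1\<^sub>0\<close>, gives \<open>\<integral>\<^bsub>u > 0\<^esub> \<Delta>u\<^sup>2 \<le> 0\<close>; and \<open>\<integral>\<Delta>v\<^sup>2 = 0\<close> because the flux \<open>2 v \<nabla>v\<close>
  vanishes on the boundary. Hence \<open>d/dt \<integral>\<bar>u - v\<bar> \<le> \<integral>\<bar>R\<bar>\<close>, with no sign condition on \<open>v\<close>: where \<open>v < 0\<close>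
  only the total fluxes enter. The \<open>L\<^sup>2\<close> bounds follow by Cauchy-Schwarz.\<close>

section \<open>Smooth step functions\<close>

text \<open>Squaring is not monotone on negative numbers: on \<open>{u > v}\<close> the difference
  \<open>u^2 - v^2\<close> may be negative, so testing with the sign of \<open>u - v\<close> is
  impossible. The identity for \<open>\<bar>u - v\<bar>\<close> is chosen so that only
  \<open>{v > u}\<close> and \<open>{u > 0}\<close> occur, where comparing squares is legitimate
  because \<open>u \<ge> 0\<close>. The second obstacle is low regularity. The equation holds as
  distributions on the open cylinder and its terms are integrable only away from
  \<open>t = 0\<close>, so the estimate is proved between interior times and carried to
  \<open>0\<close> and \<open>T\<close> by continuity in \<open>L^1\<close>. For fixed
  \<open>x\<close> an honest time primitive of \<open>u\<close> is needed, although each slice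
  \<open>u t\<close> is known only up to a null set depending on \<open>t\<close>. For fixed
  \<open>t\<close> an elliptic identity is needed for all test functions at once, although a
  space-time identity yields each of them only off its own null set of times. Finally
  \<open>u^2\<close> lies merely in \<open>H^1_0\<close>, so its nonlinear test functions must be
  approximated, while the gradient of \<open>v\<close> may jump to zero across the boundary and only
  its flux \<open>v \<nabla>v\<close> is continuous there.\<close>

definition smooth_real :: "(real \<Rightarrow> real) \<Rightarrow> bool" where
  "smooth_real f \<longleftrightarrow> (\<forall>n x. ((deriv ^^ n) f has_real_derivative (deriv ^^ Suc n) f x) (at x))"

text \<open>By uniqueness of derivatives every iterated \<open>deriv\<close> of \<open>f\<close> is
  again a member of \<open>S\<close>. Smoothness thus follows from exhibiting one set closed under
  differentiation, without computing the derivatives of all orders.\<close>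

lemma smooth_realI:
  assumes "f \<in> S" and step: "\<And>f. f \<in> S \<Longrightarrow> \<exists>g\<in>S. \<forall>x. (f has_real_derivative g x) (at x)"
  shows "smooth_real f"
proof -
  have "(deriv ^^ n) f \<in> S" for n
  proof (induction n)
    case (Suc n)
    from step[OF this] obtain g where g: "g \<in> S" "\<forall>x. ((deriv ^^ n) f has_real_derivative g x) (at x)"
      by blast
    then have "deriv ((deriv ^^ n) f) = g"
      by (auto intro!: DERIV_imp_deriv)
    with g show ?case by simp
  qed (use assms in simp)
  then show ?thesis
    unfolding smooth_real_def using step by (metis DERIV_imp_deriv comp_apply funpow.simps(2))
qed

lemma smooth_real_DERIV: "smooth_real f \<Longrightarrow> (f has_real_derivative deriv f x) (at x)"
  unfolding smooth_real_def by (metis funpow_0 funpow_0 comp_apply funpow.simps)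

lemma smooth_real_higher: "smooth_real f \<Longrightarrow> smooth_real ((deriv ^^ n) f)"
  unfolding smooth_real_def by (metis comp_apply funpow.simps(2) funpow_add add_Suc)

lemma smooth_real_deriv: "smooth_real f \<Longrightarrow> smooth_real (deriv f)"
  using smooth_real_higher[of f 1] by simp

lemma smooth_real_cont: "smooth_real f \<Longrightarrow> continuous_on S f"
  by (meson DERIV_isCont continuous_at_imp_continuous_on smooth_real_DERIV)

lemma smooth_real_affine:
  assumes "smooth_real f" shows "smooth_real (\<lambda>x. f (c * x + d))"
proof (rule smooth_realI)
  let ?S = "{\<lambda>x. c ^ n * (deriv ^^ n) f (c * x + d) |n. True}"
  show "(\<lambda>x. f (c * x + d)) \<in> ?S" by (auto intro!: exI[of _ 0])
  fix h assume "h \<in> ?S"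
  then obtain n where h: "h = (\<lambda>x. c ^ n * (deriv ^^ n) f (c * x + d))" by blast
  have "(h has_real_derivative c ^ Suc n * (deriv ^^ Suc n) f (c * x + d)) (at x)" for x
  proof -
    have d: "((deriv ^^ n) f has_real_derivative (deriv ^^ Suc n) f (c * x + d)) (at (c * x + d))"
      using assms unfolding smooth_real_def by blast
    have "((\<lambda>x. c * x + d) has_real_derivative c) (at x)"
      by (auto intro!: derivative_eq_intros)
    from DERIV_cmult[OF DERIV_chain2[OF d this], of "c ^ n"] show ?thesis
      by (simp add: h mult_ac)
  qed
  then show "\<exists>g\<in>?S. \<forall>x. (h has_real_derivative g x) (at x)"
    by (intro bexI[where x="\<lambda>x. c ^ Suc n * (deriv ^^ Suc n) f (c * x + d)"]) blast+
qed

lemma deriv_affine: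
  assumes "smooth_real f" shows "deriv (\<lambda>x. f (c * x + d)) x = c * deriv f (c * x + d)"
proof -
  have "((\<lambda>x. c * x + d) has_real_derivative c) (at x)"
    by (auto intro!: derivative_eq_intros)
  from DERIV_chain2[OF smooth_real_DERIV[OF assms] this] show ?thesis
    by (intro DERIV_imp_deriv) (simp add: mult.commute)
qed

lemma smooth_real_diff:
  assumes "smooth_real f" "smooth_real g" shows "smooth_real (\<lambda>x. f x - g x)"
proof (rule smooth_realI)
  show "(\<lambda>x. f x - g x) \<in> {\<lambda>x. (deriv ^^ n) f x - (deriv ^^ n) g x |n. True}"
    by (auto intro!: exI[of _ 0])
  fix h assume "h \<in> {\<lambda>x. (deriv ^^ n) f x - (deriv ^^ n) g x |n. True}"
  then obtain n where h: "h = (\<lambda>x. (deriv ^^ n) f x - (deriv ^^ n) g x)" by blast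
  have "\<forall>x. (h has_real_derivative (deriv ^^ Suc n) f x - (deriv ^^ Suc n) g x) (at x)"
    unfolding h using assms unfolding smooth_real_def by (auto intro!: DERIV_diff simp del: funpow.simps)
  then show "\<exists>g'\<in>{\<lambda>x. (deriv ^^ n) f x - (deriv ^^ n) g x |n. True}. \<forall>x. (h has_real_derivative g' x) (at x)"
    by (intro bexI[where x="\<lambda>x. (deriv ^^ Suc n) f x - (deriv ^^ Suc n) g x"]) blast+
qed

lemma deriv_eq_0_outside:
  assumes "\<And>x. x \<notin> {l..r} \<Longrightarrow> f x = (0::real)" and "x \<notin> {l..r::real}"
  shows "deriv f x = 0"
proof -
  have "open (- {l..r})" by (simp add: open_Compl)
  then have "eventually (\<lambda>y. f y = 0) (nhds x)"
    using assms by (auto simp: eventually_nhds intro!: exI[of _ "- {l..r}"])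
  then have "deriv f x = deriv (\<lambda>_. 0) x" by (rule deriv_cong_ev) simp
  then show ?thesis by simp
qed

text \<open>The flat function \<open>exp (- 1 / x)\<close> carries an arbitrary polynomial factor in
  \<open>1 / x\<close> because differentiation changes only that factor; the whole family is
  therefore closed under differentiation.\<close>

definition hexp :: "real poly \<Rightarrow> real \<Rightarrow> real" where
  "hexp p x = (if 0 < x then poly p (1 / x) * exp (- (1 / x)) else 0)"

lemma poly_exp_decay: "((\<lambda>y. poly p y * exp (- y)) \<longlongrightarrow> (0::real)) at_top"
proof -
  have "((\<lambda>y::real. \<Sum>i\<le>degree p. coeff p i * (y ^ i / exp y)) \<longlongrightarrow> (\<Sum>i\<le>degree p. coeff p i * 0)) at_top"
    by (intro tendsto_sum tendsto_mult tendsto_const tendsto_power_div_exp_0)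
  then show ?thesis
    by (simp add: poly_altdef sum_distrib_right exp_minus divide_inverse mult.assoc)
qed

text \<open>With \<open>y = 1 / x\<close> the chain rule gives \<open>- y^2 p'(y)\<close> from the
  polynomial and \<open>y^2 p(y)\<close> from the exponential; the factor \<open>y^2\<close> is the
  double \<open>pCons 0\<close>. At \<open>0\<close> the right difference quotient is again of the
  form polynomial times \<open>exp (- y)\<close> with \<open>y\<close> tending to infinity, hence
  tends to 0.\<close>

lemma hexp_deriv:
  "(hexp p has_real_derivative hexp (pCons 0 (pCons 0 (p - pderiv p))) x) (at x)"
proof -
  consider "x < 0" | "x = 0" | "0 < x" by linarith
  then show ?thesis
  proof cases
    case 1
    have "((\<lambda>_. 0) has_real_derivative 0) (at x)" by simp
    moreover have "\<forall>\<^sub>F y in nhds x. hexp p y = 0"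
      using eventually_nhds_in_open[of "{..<0}" x] 1
      by (auto elim!: eventually_mono simp: hexp_def)
    ultimately show ?thesis using 1
      by (subst DERIV_cong_ev[OF refl _ refl, where g="\<lambda>_. 0"]) (auto simp: hexp_def)
  next
    case 3
    have "((\<lambda>x. poly p (1 / x) * exp (- (1 / x))) has_real_derivative
        poly (pderiv p) (1/x) * (- (1 / x^2)) * exp (- (1 / x)) + poly p (1/x) * (exp (- (1/x)) * (1 / x^2))) (at x)"
      using 3 by (auto intro!: derivative_eq_intros poly_DERIV[THEN DERIV_chain2] simp: power2_eq_square)
    moreover have "\<forall>\<^sub>F y in nhds x. hexp p y = poly p (1 / y) * exp (- (1 / y))"
      using eventually_nhds_in_open[of "{0<..}" x] 3
      by (auto elim!: eventually_mono simp: hexp_def)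
    ultimately show ?thesis using 3
      by (subst DERIV_cong_ev[OF refl _ refl, where g="\<lambda>x. poly p (1 / x) * exp (- (1 / x))"])
        (auto simp: hexp_def field_simps power2_eq_square)
  next
    case 2
    have r: "((\<lambda>h. hexp p h / h) \<longlongrightarrow> 0) (at_right 0)"
    proof -
      have "((\<lambda>h. poly (pCons 0 p) (inverse h) * exp (- inverse h)) \<longlongrightarrow> 0) (at_right (0::real))"
        using filterlim_compose[OF poly_exp_decay filterlim_inverse_at_top_right] .
      moreover have "\<forall>\<^sub>F h in at_right 0. poly (pCons 0 p) (inverse h) * exp (- inverse h) = hexp p h / h"
        unfolding eventually_at_right_field by (auto simp: hexp_def field_simps intro!: exI[of _ 1])
      ultimately show ?thesis by (rule Lim_transform_eventually)
    qed
    have l: "((\<lambda>h. hexp p h / h) \<longlongrightarrow> 0) (at_left 0)"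
      by (rule Lim_transform_eventually[where f="\<lambda>_. 0"])
        (auto simp: eventually_at_left_field hexp_def intro!: exI[of _ "-1"])
    from filterlim_split_at[OF l r] show ?thesis
      unfolding DERIV_def 2 by (simp add: hexp_def)
  qed
qed

lemma hexp_minus: "hexp (- p) x = - hexp p x"
  by (simp add: hexp_def)

section \<open>The smooth transition from 0 to 1 and its derivative\<close>

abbreviation "hexp1 \<equiv> hexp 1"

definition smooth_step :: "real \<Rightarrow> real" where
  "smooth_step x = hexp1 x / (hexp1 x + hexp1 (1 - x))"

lemma hexp1_pos: "0 \<le> hexp1 x" "0 < x \<Longrightarrow> 0 < hexp1 x" "x \<le> 0 \<Longrightarrow> hexp1 x = 0"
  by (auto simp: hexp_def)

lemma hexp_denom_pos: "0 < hexp1 x + hexp1 (1 - x)"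
  using hexp1_pos[of x] hexp1_pos[of "1 - x"] by (cases "0 < x") (auto intro: add_pos_nonneg add_nonneg_pos)

text \<open>An algebra of functions closed under differentiation; membership of \<open>smooth_step\<close> is all that its smoothness needs.\<close>

inductive_set step_algebra :: "(real \<Rightarrow> real) set" where
  hexp_base: "hexp p \<in> step_algebra"
| hexp_refl: "(\<lambda>x. hexp p (1 - x)) \<in> step_algebra"
| hexp_denom: "(\<lambda>x. 1 / (hexp1 x + hexp1 (1 - x))) \<in> step_algebra"
| hexp_add: "f \<in> step_algebra \<Longrightarrow> g \<in> step_algebra \<Longrightarrow> (\<lambda>x. f x + g x) \<in> step_algebra"
| hexp_mult: "f \<in> step_algebra \<Longrightarrow> g \<in> step_algebra \<Longrightarrow> (\<lambda>x. f x * g x) \<in> step_algebra"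

lemma hexp_refl_deriv:
  "((\<lambda>x. hexp p (1 - x)) has_real_derivative hexp (- pCons 0 (pCons 0 (p - pderiv p))) (1 - x)) (at x)"
proof -
  have "((\<lambda>x. 1 - x) has_real_derivative -1) (at x)" by (auto intro!: derivative_eq_intros)
  from DERIV_chain2[OF hexp_deriv this] show ?thesis
    by (rule DERIV_cong) (auto simp: hexp_def algebra_simps)
qed

lemma step_algebra_deriv:
  "f \<in> step_algebra \<Longrightarrow> \<exists>g\<in>step_algebra. \<forall>x. (f has_real_derivative g x) (at x)"
proof (induction rule: step_algebra.induct)
  case (hexp_base p)
  then show ?case using hexp_deriv step_algebra.hexp_base by blast
next
  case (hexp_refl p)
  show ?case
    using hexp_refl_deriv[of p] step_algebra.hexp_refl[of "- pCons 0 (pCons 0 (p - pderiv p))"]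
    by (intro bexI[where x="\<lambda>x. hexp (- pCons 0 (pCons 0 (p - pderiv p))) (1 - x)"]) blast+
next
  case hexp_denom
  let ?q = "pCons 0 (pCons 0 (1 - pderiv 1)) :: real poly"
  let ?d = "\<lambda>x. 1 / (hexp1 x + hexp1 (1 - x))"
  \<comment> \<open>This is \<open>- d' / d^2\<close> for the denominator \<open>d\<close>; the
    minus sign is pushed into the polynomial arguments so that the introduction rules of the algebra
    apply.\<close>
  let ?g = "\<lambda>x. (hexp (- ?q) x + hexp ?q (1 - x)) * (?d x * ?d x)"
  have "?g \<in> step_algebra" by (intro step_algebra.intros)
  moreover have "(?d has_real_derivative ?g x) (at x)" for x
  proof -
    have "((\<lambda>x. hexp1 x + hexp1 (1 - x)) has_real_derivative hexp ?q x + hexp (- ?q) (1 - x)) (at x)"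
      by (intro DERIV_add hexp_deriv hexp_refl_deriv)
    from DERIV_inverse_fun[OF this] hexp_denom_pos[of x]
    have "(?d has_real_derivative - ((hexp ?q x + hexp (- ?q) (1 - x)) * inverse ((hexp1 x + hexp1 (1 - x)) ^ Suc (Suc 0)))) (at x)"
      by (simp add: inverse_eq_divide)
    moreover have "- ((A + - B) * inverse (d ^ Suc (Suc 0))) = (- A + B) * (1 / d * (1 / d))" if "d \<noteq> 0" for A B d :: real
      using that by (simp add: field_simps)
    ultimately show ?thesis
      unfolding hexp_minus using hexp_denom_pos[of x] by (metis (no_types, lifting) less_irrefl)
  qed
  ultimately show ?case by (intro bexI[where x="?g"] allI)
next
  case (hexp_add f g)
  then obtain f' g' where "f' \<in> step_algebra" "g' \<in> step_algebra"
    "\<forall>x. (f has_real_derivative f' x) (at x)" "\<forall>x. (g has_real_derivative g' x) (at x)" by blast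
  then show ?case by (intro bexI[of _ "\<lambda>x. f' x + g' x"] step_algebra.intros) (auto intro!: derivative_intros)
next
  case (hexp_mult f g)
  then obtain f' g' where "f' \<in> step_algebra" "g' \<in> step_algebra"
    "\<forall>x. (f has_real_derivative f' x) (at x)" "\<forall>x. (g has_real_derivative g' x) (at x)" by blast
  with hexp_mult show ?case
    by (intro bexI[of _ "\<lambda>x. f' x * g x + g' x * f x"] step_algebra.intros) (auto intro!: DERIV_mult)
qed

lemma smooth_step_smooth: "smooth_real smooth_step"
proof (rule smooth_realI[OF _ step_algebra_deriv])
  have "(\<lambda>x. hexp1 x * (1 / (hexp1 x + hexp1 (1 - x)))) \<in> step_algebra"
    by (intro step_algebra.intros)
  then show "smooth_step \<in> step_algebra" unfolding smooth_step_def[abs_def] by simp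
qed

lemma smooth_step_simps: "x \<le> 0 \<Longrightarrow> smooth_step x = 0" "1 \<le> x \<Longrightarrow> smooth_step x = 1"
  using hexp1_pos(2)[of x] by (auto simp: smooth_step_def hexp1_pos(3))

lemma smooth_step_bounds: "0 \<le> smooth_step x" "smooth_step x \<le> 1"
  using hexp1_pos(1)[of x] hexp1_pos(1)[of "1-x"] by (auto simp: smooth_step_def divide_le_eq_1 intro!: divide_nonneg_nonneg)

text \<open>After clearing denominators the terms \<open>hexp1 x * hexp1 y\<close> cancel, and
  \<open>hexp1 x * hexp1 (1 - y) \<le> hexp1 y * hexp1 (1 - x)\<close> remains, which follows factor
  by factor from the monotonicity of \<open>hexp1\<close>.\<close>

lemma smooth_step_mono: "mono smooth_step"
proof -
  have h: "hexp1 x \<le> hexp1 y" if "x \<le> y" for x y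
    using that by (auto simp: hexp_def frac_le)
  show ?thesis
  proof
    fix x y :: real assume "x \<le> y"
    then have "hexp1 x \<le> hexp1 y" "hexp1 (1 - y) \<le> hexp1 (1 - x)" by (auto intro: h)
    then have "hexp1 x * hexp1 (1 - y) \<le> hexp1 y * hexp1 (1 - x)"
      by (intro mult_mono) (auto simp: hexp1_pos)
    then show "smooth_step x \<le> smooth_step y"
      unfolding smooth_step_def using hexp_denom_pos[of x] hexp_denom_pos[of y]
      by (simp add: divide_le_eq pos_le_divide_eq algebra_simps)
  qed
qed

text \<open>As the derivative of a monotone step from 0 to 1, the kernel is nonnegative, supported
  in \<open>{0..1}\<close> and of integral exactly 1, so no normalising constant ever
  appears.\<close>

definition bump :: "real \<Rightarrow> real" where "bump = deriv smooth_step"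

lemma bump_smooth: "smooth_real bump"
  unfolding bump_def by (intro smooth_real_deriv smooth_step_smooth)

lemma smooth_step_DERIV: "(smooth_step has_real_derivative bump x) (at x)"
  unfolding bump_def by (intro smooth_real_DERIV smooth_step_smooth)

lemma bump_nonneg: "0 \<le> bump x"
  by (rule mono_on_imp_deriv_nonneg[where A=UNIV and f=smooth_step])
    (use smooth_step_mono smooth_step_DERIV in \<open>auto simp: mono_on_def mono_def\<close>)

lemma bump_outside: "x \<notin> {0..1} \<Longrightarrow> bump x = 0"
proof -
  assume "x \<notin> {0..1}"
  then consider "x < 0" | "1 < x" by fastforce
  then show ?thesis
  proof cases
    case 1
    have "\<forall>\<^sub>F y in nhds x. smooth_step y = 0"
      using eventually_nhds_in_open[of "{..<0}" x] 1
      by (auto elim!: eventually_mono simp: smooth_step_simps)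
    then have "bump x = deriv (\<lambda>_. 0) x" unfolding bump_def by (rule deriv_cong_ev) simp
    then show ?thesis by simp
  next
    case 2
    have "\<forall>\<^sub>F y in nhds x. smooth_step y = 1"
      using eventually_nhds_in_open[of "{1<..}" x] 2
      by (auto elim!: eventually_mono simp: smooth_step_simps)
    then have "bump x = deriv (\<lambda>_. 1) x" unfolding bump_def by (rule deriv_cong_ev) simp
    then show ?thesis by simp
  qed
qed

section \<open>Tensor products of smooth functions\<close>

text \<open>Test functions are built as products of one-variable profiles: a partial derivative
  replaces a single factor, so smoothness and the formulas for all derivatives reduce to calculus in
  one variable.\<close>

definition tensor :: "('a::euclidean_space \<Rightarrow> real \<Rightarrow> real) \<Rightarrow> 'a \<Rightarrow> real" where
  "tensor g z = (\<Prod>b\<in>Basis. g b (z \<bullet> b))"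

lemma tensor_line:
  assumes "c \<in> Basis"
  shows "tensor g (z + h *\<^sub>R c) = g c (z \<bullet> c + h) * (\<Prod>b\<in>Basis - {c}. g b (z \<bullet> b))"
proof -
  have "tensor g (z + h *\<^sub>R c) = g c ((z + h *\<^sub>R c) \<bullet> c) * (\<Prod>b\<in>Basis - {c}. g b ((z + h *\<^sub>R c) \<bullet> b))"
    unfolding tensor_def using assms by (subst prod.remove[of _ c]) auto
  also have "(\<Prod>b\<in>Basis - {c}. g b ((z + h *\<^sub>R c) \<bullet> b)) = (\<Prod>b\<in>Basis - {c}. g b (z \<bullet> b))"
    using assms by (intro prod.cong refl) (auto simp: inner_add_left inner_Basis)
  also have "(z + h *\<^sub>R c) \<bullet> c = z \<bullet> c + h"
    using assms by (simp add: inner_add_left)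
  finally show ?thesis .
qed

lemma tensor_has_partial:
  assumes "c \<in> Basis" "\<And>b. smooth_real (g b)"
  shows "((\<lambda>h. tensor g (z + h *\<^sub>R c)) has_real_derivative tensor (g(c := deriv (g c))) z) (at 0)"
proof -
  have "((\<lambda>h. g c (h + z \<bullet> c)) has_real_derivative deriv (g c) (z \<bullet> c)) (at 0)"
    using DERIV_shift[THEN iffD1, OF smooth_real_DERIV[OF assms(2), of c "0 + z \<bullet> c"]] by simp
  from DERIV_cmult_right[OF this, of "\<Prod>b\<in>Basis - {c}. g b (z \<bullet> b)"]
  have "((\<lambda>h. tensor g (z + h *\<^sub>R c)) has_real_derivative
     deriv (g c) (z \<bullet> c) * (\<Prod>b\<in>Basis - {c}. g b (z \<bullet> b))) (at 0)"
    by (simp add: tensor_line[OF assms(1)] add.commute)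
  also have "deriv (g c) (z \<bullet> c) * (\<Prod>b\<in>Basis - {c}. g b (z \<bullet> b)) = tensor (g(c := deriv (g c))) z"
    using tensor_line[OF assms(1), of "g(c := deriv (g c))" z 0]
    by (auto intro!: prod.cong arg_cong2[where f="(*)"])
  finally show ?thesis .
qed

lemma partial_d_tensor:
  assumes "c \<in> Basis" "\<And>b. smooth_real (g b)"
  shows "partial_d c (\<lambda>y. k * tensor g y) = (\<lambda>y. k * tensor (g(c := deriv (g c))) y)"
  unfolding partial_d_def
  by (intro ext DERIV_imp_deriv DERIV_cmult tensor_has_partial assms)

lemma smooth_upd: "(\<And>b. smooth_real (g b)) \<Longrightarrow> smooth_real ((g(c := deriv (g c))) b)"
  by (simp add: smooth_real_deriv)

lemma iter_partial_tensor:
  assumes "set bs \<subseteq> Basis" "\<And>b. smooth_real (g b)"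
  shows "\<exists>g'. (\<forall>b. smooth_real (g' b)) \<and> iter_partial bs (tensor g) = tensor g'"
  using assms(1)
proof (induction bs)
  case (Cons c bs)
  then obtain g' where g': "\<And>b. smooth_real (g' b)" "iter_partial bs (tensor g) = tensor g'" by auto
  have "iter_partial (c # bs) (tensor g) = tensor (g'(c := deriv (g' c)))"
    using partial_d_tensor[of c g' 1] Cons.prems g' by simp
  then show ?case using smooth_upd[of g' c, OF g'(1)] by blast
qed (use assms in auto)

lemma tensor_differentiable:
  assumes "\<And>b. smooth_real (g b)"
  shows "tensor g differentiable (at z)"
proof -
  have "(\<lambda>z. \<Prod>b\<in>S. g b (z \<bullet> b)) differentiable (at z)" if "finite S" for S
    using that
  proof induction
    case (insert c S)
    have "(\<lambda>z. g c (z \<bullet> c)) differentiable (at z)"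
    proof (rule differentiable_compose[where f="g c" and g="\<lambda>z. z \<bullet> c"])
      show "g c differentiable at (z \<bullet> c)"
        using smooth_real_DERIV[OF assms] real_differentiable_def by blast
      show "(\<lambda>z. z \<bullet> c) differentiable at z"
        by (intro bounded_linear_imp_differentiable bounded_linear_inner_left)
    qed
    with insert show ?case by (simp add: differentiable_mult)
  qed simp
  then show ?thesis unfolding tensor_def by simp
qed

lemma tensor_smooth_on: "(\<And>b. smooth_real (g b)) \<Longrightarrow> smooth_on S (tensor g)"
  unfolding smooth_on_def using iter_partial_tensor[of _ g] tensor_differentiable by metis

lemma tensor_continuous: "(\<And>b. smooth_real (g b)) \<Longrightarrow> continuous_on S (tensor g)"
  by (meson continuous_at_imp_continuous_on differentiable_imp_continuous_within tensor_differentiable)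

text \<open>The support condition is imposed on each factor, which makes it stable under
  differentiating one of them. Smoothness is demanded at every index, so that updated families
  inherit it without a case distinction.\<close>

definition tensor_supp :: "'a::euclidean_space \<Rightarrow> 'a \<Rightarrow> ('a \<Rightarrow> real \<Rightarrow> real) \<Rightarrow> bool" where
  "tensor_supp l r g \<longleftrightarrow> (\<forall>b. smooth_real (g b)) \<and> (\<forall>b\<in>Basis. \<forall>x. x \<notin> {l \<bullet> b..r \<bullet> b} \<longrightarrow> g b x = 0)"

lemma tensor_supp_smooth: "tensor_supp l r g \<Longrightarrow> smooth_real (g b)"
  by (simp add: tensor_supp_def)

lemma tensor_supp_upd: "tensor_supp l r g \<Longrightarrow> tensor_supp l r (g(c := deriv (g c)))"
  unfolding tensor_supp_def using deriv_eq_0_outside[of "l \<bullet> c" "r \<bullet> c" "g c"]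
  by (auto simp: smooth_real_deriv)

lemma tensor_eq_0: "tensor_supp l r g \<Longrightarrow> z \<notin> cbox l r \<Longrightarrow> tensor g z = 0"
  unfolding tensor_def tensor_supp_def mem_box by (auto intro!: prod_zero)

lemma tensor_test_function: "tensor_supp l r g \<Longrightarrow> cbox l r \<subseteq> U \<Longrightarrow> test_function U (tensor g)"
  unfolding test_function_def using tensor_eq_0 tensor_supp_smooth
  by (metis compact_cbox tensor_smooth_on)

lemma tensor_bounded:
  assumes "tensor_supp l r g" shows "\<exists>M. \<forall>z. \<bar>tensor g z\<bar> \<le> M"
proof -
  have "bounded (tensor g ` cbox l r)"
    using tensor_supp_smooth[OF assms]
    by (intro compact_imp_bounded compact_continuous_image tensor_continuous compact_cbox) auto
  then obtain M where "\<forall>z\<in>cbox l r. \<bar>tensor g z\<bar> \<le> M" by (auto simp: bounded_iff)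
  then have "\<bar>tensor g z\<bar> \<le> max M 0" for z
    using tensor_eq_0[OF assms, of z] by (cases "z \<in> cbox l r") (auto simp: max_def intro: order_trans)
  then show ?thesis by blast
qed

text \<open>The time direction of \<open>real \<times> 'a\<close> is recognised by \<open>fst b = 1\<close>; all other basis vectors have \<open>fst b = 0\<close>.\<close>

definition st_tensor :: "(real \<Rightarrow> real) \<Rightarrow> ('a \<Rightarrow> real \<Rightarrow> real) \<Rightarrow> (real \<times> 'a::euclidean_space) \<Rightarrow> real \<Rightarrow> real" where
  "st_tensor \<psi> g b = (if fst b = 1 then \<psi> else g (snd b))"

lemma tensor_st: "tensor (st_tensor \<psi> g) (t, x) = \<psi> t * tensor g x"
proof -
  have "tensor (st_tensor \<psi> g) (t, x) = (\<Prod>b\<in>(\<lambda>u. (u, 0)) ` (Basis::real set) \<union> (\<lambda>u. (0, u)) ` (Basis::'a set). st_tensor \<psi> g b ((t, x) \<bullet> b))"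
    unfolding tensor_def Basis_prod_def ..
  also have "\<dots> = (\<Prod>b\<in>(\<lambda>u. (u, 0::'a)) ` (Basis::real set). st_tensor \<psi> g b ((t, x) \<bullet> b)) *
      (\<Prod>b\<in>(\<lambda>u. (0::real, u)) ` (Basis::'a set). st_tensor \<psi> g b ((t, x) \<bullet> b))"
    by (rule prod.union_disjoint) auto
  also have "\<dots> = \<psi> t * tensor g x"
    unfolding tensor_def by (subst prod.reindex; simp add: inj_on_def st_tensor_def)
  finally show ?thesis .
qed

lemma tensor_supp_st:
  assumes "smooth_real \<psi>" "\<And>t. t \<notin> {p..q} \<Longrightarrow> \<psi> t = 0" "tensor_supp l r g"
  shows "tensor_supp (p, l) (q, r) (st_tensor \<psi> g)"
  using assms unfolding tensor_supp_def st_tensor_def by (auto simp: Basis_prod_def)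

lemma st_test_function:
  assumes "smooth_real \<psi>" "\<And>t. t \<notin> {p..q} \<Longrightarrow> \<psi> t = 0" "tensor_supp l r g" "{p..q} \<times> cbox l r \<subseteq> U"
  shows "test_function U (\<lambda>(t, x). \<psi> t * tensor g x)"
proof -
  have "tensor (st_tensor \<psi> g) = (\<lambda>(t, x). \<psi> t * tensor g x)" by (auto simp: tensor_st)
  then show ?thesis
    using tensor_test_function[OF tensor_supp_st[OF assms(1,2,3)], where U=U] assms(4) by (simp add: cbox_Pair_eq)
qed

lemma partial_d_time:
  assumes "smooth_real \<psi>"
  shows "partial_d (1, 0) (\<lambda>(t, x). \<psi> t * (\<eta>::'a::euclidean_space \<Rightarrow> real) x) (t, x) = deriv \<psi> t * \<eta> x"
proof -
  have "((\<lambda>h. \<psi> (h + t)) has_real_derivative deriv \<psi> t) (at 0)"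
    using DERIV_shift[THEN iffD1, OF smooth_real_DERIV[OF assms, of "0 + t"]] by simp
  from DERIV_cmult_right[OF this, of "\<eta> x"] show ?thesis
    unfolding partial_d_def by (intro DERIV_imp_deriv) (simp add: add.commute)
qed

lemma laplacian_tensor:
  assumes "\<And>b. smooth_real (g b)"
  shows "laplacian (\<lambda>y. k * tensor g y) x = k * (\<Sum>b\<in>Basis. tensor (g(b := deriv (deriv (g b)))) x)"
proof -
  have "partial_d b (partial_d b (\<lambda>y. k * tensor g y)) x = k * tensor (g(b := deriv (deriv (g b)))) x"
    if "b \<in> Basis" for b
    using partial_d_tensor[OF that, of "g(b := deriv (g b))" k] partial_d_tensor[OF that, of g k] assms
    by (simp add: smooth_real_deriv)
  then show ?thesis unfolding laplacian_def by (simp add: sum_distrib_left)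
qed

text \<open>The shifts by \<open>1 / k\<close> and \<open>2 / k\<close> keep the support inside the open interval \<open>{c<..<d}\<close>.\<close>

definition step_bump :: "real \<Rightarrow> real \<Rightarrow> real \<Rightarrow> real \<Rightarrow> real" where
  "step_bump k c d x = smooth_step (k * (x - c) - 1) - smooth_step (k * (x - d) + 2)"

lemma step_bump_smooth: "smooth_real (step_bump k c d)"
proof -
  have "smooth_real (\<lambda>x. smooth_step (k * x + (- k * c - 1)) - smooth_step (k * x + (- k * d + 2)))"
    by (intro smooth_real_diff smooth_real_affine smooth_step_smooth)
  then show ?thesis unfolding step_bump_def[abs_def] by (simp add: algebra_simps)
qed

lemma step_bump_deriv: "deriv (step_bump k c d) x = k * bump (k * (x - c) - 1) - k * bump (k * (x - d) + 2)"
proof -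
  have "((\<lambda>x. k * (x - c) - 1) has_real_derivative k) (at x)" "((\<lambda>x. k * (x - d) + 2) has_real_derivative k) (at x)"
    by (auto intro!: derivative_eq_intros)
  from DERIV_diff[OF DERIV_chain2[OF smooth_step_DERIV this(1)] DERIV_chain2[OF smooth_step_DERIV this(2)]]
  show ?thesis
    unfolding step_bump_def[abs_def] by (intro DERIV_imp_deriv) (simp add: mult.commute)
qed

lemma step_bump_le_1: "\<bar>step_bump k c d x\<bar> \<le> 1"
  unfolding step_bump_def using smooth_step_bounds[of "k * (x - c) - 1"] smooth_step_bounds[of "k * (x - d) + 2"]
  by linarith

text \<open>The first step rises on \<open>{c + 1/k..c + 2/k}\<close> and the second on
  \<open>{d - 2/k..d - 1/k}\<close>. Since \<open>k * (d - c) \<ge> 3\<close>, both are still 0 to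
  the left of \<open>c + 1/k\<close> and both are already 1 to the right of
  \<open>d - 1/k\<close>.\<close>

lemma step_bump_outside:
  assumes "3 / (d - c) \<le> k" "c < d" "x \<notin> {c + 1/k..d - 1/k}"
  shows "step_bump k c d x = 0"
proof -
  have k: "0 < k" "3 \<le> k * (d - c)"
    using assms by (auto simp: pos_divide_le_eq intro: less_le_trans[OF divide_pos_pos, of 3 "d - c"])
  from assms(3) consider "x < c + 1/k" | "d - 1/k < x" by fastforce
  then show ?thesis
  proof cases
    case 1
    then have "k * (x - c) < 1" using k by (simp add: field_simps)
    moreover have "k * (x - d) = k * (x - c) - k * (d - c)" by (simp add: algebra_simps)
    ultimately show ?thesis unfolding step_bump_def using k by (simp add: smooth_step_simps)
  next
    case 2
    then have "k * (x - d) > -1" using k by (simp add: field_simps)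
    moreover have "k * (x - d) = k * (x - c) - k * (d - c)" by (simp add: algebra_simps)
    ultimately show ?thesis unfolding step_bump_def using k by (simp add: smooth_step_simps)
  qed
qed

lemma eventually_real_ge: "\<forall>\<^sub>F k in sequentially. M \<le> real (Suc k)"
proof -
  obtain N where "M \<le> real N" using real_arch_simple by blast
  then show ?thesis unfolding eventually_sequentially by (intro exI[of _ N]) auto
qed

lemma step_bump_limit:
  assumes "c < d"
  shows "(\<lambda>k. step_bump (real (Suc k)) c d x) \<longlonglongrightarrow> indicat_real {c<..<d} x"
proof -
  have "\<forall>\<^sub>F k in sequentially. step_bump (real (Suc k)) c d x = indicat_real {c<..<d} x"
  proof (cases "x \<in> {c<..<d}")
    case True
    show ?thesis
      \<comment> \<open>From these indices on the left step has reached 1 at \<open>x\<close> while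
        the right step is still 0 there.\<close>
      using eventually_real_ge[of "2 / (x - c)"] eventually_real_ge[of "2 / (d - x)"]
    proof eventually_elim
      case (elim k)
      then have "2 \<le> real (Suc k) * (x - c)" "2 \<le> real (Suc k) * (d - x)"
        using True by (auto simp only: pos_divide_le_eq greaterThanLessThan_iff diff_gt_0_iff_gt)
      then show ?case using True unfolding step_bump_def
        by (simp add: smooth_step_simps algebra_simps)
    qed
  next
    case False
    show ?thesis
      using eventually_real_ge[of "3 / (d - c)"]
    proof eventually_elim
      case (elim k)
      have "x \<notin> {c + 1 / real (Suc k)..d - 1 / real (Suc k)}" 
        using False by (auto simp: not_less) (smt (verit) divide_pos_pos of_nat_0_less_iff zero_less_Suc of_nat_Suc)+
      from step_bump_outside[OF elim assms this] False show ?case by simp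
    qed
  qed
  then show ?thesis by (rule tendsto_eventually)
qed

section \<open>Fundamental lemmas of the calculus of variations\<close>

text \<open>The indicator of an open box is a bounded pointwise limit of products of
  \<open>step_bump\<close>, which for large \<open>k\<close> are supported in a closed box inside
  it; dominated convergence with majorant \<open>\<bar>f\<bar>\<close> carries the vanishing
  over.\<close>

lemma integral_open_box_zero:
  fixes f :: "'a::euclidean_space \<Rightarrow> real"
  assumes f: "integrable lborel f"
    and zero: "\<And>g l' r'. tensor_supp l' r' g \<Longrightarrow> cbox l' r' \<subseteq> U \<Longrightarrow> (LBINT x. f x * tensor g x) = 0"
    and cd: "\<And>b. b \<in> Basis \<Longrightarrow> c \<bullet> b < d \<bullet> b" "box c d \<subseteq> U"
  shows "(LBINT x. f x * indicator (box c d) x) = 0"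
proof -
  define g where "g k b = step_bump (real (Suc k)) (c \<bullet> b) (d \<bullet> b)" for k b
  have g_smooth: "smooth_real (g k b)" for k b by (simp add: g_def step_bump_smooth)
  have [measurable]: "tensor (g k) \<in> borel_measurable borel" for k
    by (intro borel_measurable_continuous_onI tensor_continuous g_smooth)
  have lim: "(\<lambda>k. LBINT x. f x * tensor (g k) x) \<longlonglongrightarrow> (LBINT x. f x * indicator (box c d) x)"
  proof (rule integral_dominated_convergence[where w="\<lambda>x. \<bar>f x\<bar>"])
    show "AE x in lborel. (\<lambda>k. f x * tensor (g k) x) \<longlonglongrightarrow> f x * indicator (box c d) x"
    proof (intro AE_I2 tendsto_mult tendsto_const)
      fix x
      have "(\<lambda>k. \<Prod>b\<in>Basis. g k b (x \<bullet> b)) \<longlonglongrightarrow> (\<Prod>b\<in>Basis. indicat_real {c \<bullet> b<..<d \<bullet> b} (x \<bullet> b))"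
        unfolding g_def by (intro tendsto_prod step_bump_limit cd)
      also have "(\<Prod>b\<in>Basis. indicat_real {c \<bullet> b<..<d \<bullet> b} (x \<bullet> b)) = indicator (box c d) x"
        by (auto simp: indicator_def mem_box)
      finally show "(\<lambda>k. tensor (g k) x) \<longlonglongrightarrow> indicator (box c d) x" unfolding tensor_def .
    qed
    show "AE x in lborel. norm (f x * tensor (g k) x) \<le> \<bar>f x\<bar>" for k
    proof (intro AE_I2)
      fix x
      have "\<bar>tensor (g k) x\<bar> \<le> 1"
        unfolding tensor_def abs_prod g_def by (intro prod_le_1) (auto simp: step_bump_le_1)
      from mult_left_mono[OF this abs_ge_zero[of "f x"]] show "norm (f x * tensor (g k) x) \<le> \<bar>f x\<bar>"
        by (simp add: abs_mult)
    qed
  qed (use f in auto)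
  have "\<forall>\<^sub>F k in sequentially. \<forall>b\<in>Basis. 3 / (d \<bullet> b - c \<bullet> b) \<le> real (Suc k)"
    using eventually_real_ge by (intro eventually_ball_finite) auto
  then have "\<forall>\<^sub>F k in sequentially. (LBINT x. f x * tensor (g k) x) = 0"
  proof eventually_elim
    case (elim k)
    let ?l = "c + (1 / real (Suc k)) *\<^sub>R One" and ?r = "d - (1 / real (Suc k)) *\<^sub>R One"
    have "tensor_supp ?l ?r (g k)"
      unfolding tensor_supp_def
    proof (intro conjI allI ballI impI g_smooth)
      fix b x assume "(b::'a) \<in> Basis" "x \<notin> {?l \<bullet> b..?r \<bullet> b}"
      then show "g k b x = 0"
        unfolding g_def using elim cd
        by (intro step_bump_outside) (auto simp: inner_add_left inner_diff_left)
    qed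
    moreover have "cbox ?l ?r \<subseteq> box c d"
    proof
      fix x assume x: "x \<in> cbox ?l ?r"
      have "0 < 1 / real (Suc k)" by simp
      moreover have "c \<bullet> b + 1 / real (Suc k) \<le> x \<bullet> b" "x \<bullet> b \<le> d \<bullet> b - 1 / real (Suc k)" if "b \<in> Basis" for b
        using x that unfolding mem_box by (auto simp: inner_add_left inner_diff_left)
      ultimately show "x \<in> box c d"
        unfolding mem_box by (smt (verit))
    qed
    ultimately show ?case using zero cd(2) by blast
  qed
  then have "(\<lambda>k. LBINT x. f x * tensor (g k) x) \<longlonglongrightarrow> 0" by (rule tendsto_eventually)
  with lim show ?thesis by (rule LIMSEQ_unique)
qed

text \<open>Open boxes form an intersection-stable generator of the Borel sets, so vanishing
  integrals extend from boxes to all Borel sets. Applied to the sets where the function is positive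
  and where it is negative, this leaves only the value 0.\<close>

lemma AE_zero_of_tensor:
  fixes f :: "'a::euclidean_space \<Rightarrow> real"
  assumes f: "integrable lborel f"
    and zero: "\<And>g l' r'. tensor_supp l' r' g \<Longrightarrow> cbox l' r' \<subseteq> box l r \<Longrightarrow> (LBINT x. f x * tensor g x) = 0"
  shows "AE x in lborel. x \<in> box l r \<longrightarrow> f x = 0"
proof -
  define h where "h x = f x * indicator (box l r) x" for x
  have h: "integrable lborel h"
    unfolding h_def using f by (intro integrable_real_mult_indicator) auto
  have box0: "(LINT x:box c d|lborel. h x) = 0" for c d
  proof -
    obtain c' d' where cd': "box l r \<inter> box c d = box c' d'"
      using box_Int_box by blast
    have "(LINT x:box c d|lborel. h x) = (LBINT x. f x * indicator (box c' d') x)"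
      unfolding set_lebesgue_integral_def h_def cd'[symmetric]
      by (auto intro!: Bochner_Integration.integral_cong simp: indicator_def)
    also have "\<dots> = 0"
    proof (cases "box c' d' = {}")
      case False
      then have cd: "c' \<bullet> b < d' \<bullet> b" if "b \<in> Basis" for b using box_ne_empty that by blast
      have "box c' d' \<subseteq> box l r" using cd' by blast
      from integral_open_box_zero[OF f zero cd this] show ?thesis .
    qed simp
    finally show ?thesis .
  qed
  \<comment> \<open>The complement rule of the induction subtracts from the integral over the whole
    space.\<close>
  have hU: "(LINT x:UNIV|lborel. h x) = 0"
  proof -
    have "(LINT x:UNIV|lborel. h x) = (LINT x:box l r|lborel. h x)"
      unfolding set_lebesgue_integral_def h_def
      by (auto intro!: Bochner_Integration.integral_cong simp: indicator_def)
    then show ?thesis using box0 by simp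
  qed
  have si: "set_integrable lborel A h" if "A \<in> sets borel" for A
    using integrable_mult_indicator[of A lborel h] that h unfolding set_integrable_def by simp
  have A0: "(LINT x:A|lborel. h x) = 0" if "A \<in> sets borel" for A
  proof -
    have stable: "Int_stable (range (\<lambda>(a, b). box a b :: 'a set))"
    proof (rule Int_stableI)
      fix A B assume "A \<in> range (\<lambda>(a, b). box a b :: 'a set)" "B \<in> range (\<lambda>(a, b). box a b :: 'a set)"
      then obtain p q p' q' where "A = box p q" "B = box p' q'" by auto
      then have "\<exists>u v. A \<inter> B = box u v" using box_Int_box by blast
      then show "A \<inter> B \<in> range (\<lambda>(a, b). box a b)" by auto
    qed
    have sig: "sigma_sets UNIV (range (\<lambda>(a, b). box a b :: 'a set)) = sets borel"
      by (simp add: borel_eq_box)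
    note stable
    moreover have "range (\<lambda>(a, b). box a b :: 'a set) \<subseteq> Pow UNIV" by simp
    moreover have "A \<in> sigma_sets UNIV (range (\<lambda>(a, b). box a b :: 'a set))" using that sig by simp
    ultimately show ?thesis
    proof (induction rule: sigma_sets_induct_disjoint)
      case (basic A)
      then show ?case using box0 by auto
    next
      case empty
      show ?case by (simp add: set_lebesgue_integral_def)
    next
      case (compl A)
      then have "A \<in> sets borel" using sig by simp
      then have "(LINT x:A \<union> (UNIV - A)|lborel. h x) = (LINT x:A|lborel. h x) + (LINT x:UNIV - A|lborel. h x)"
        by (intro set_integral_Un si) auto
      then show ?case using compl hU by simp
    next
      case (union A)
      then have A: "\<And>i. A i \<in> sets borel" using sig by auto
      have "(LINT x:(\<Union>i. A i)|lborel. h x) = (\<Sum>i. (LINT x:A i|lborel. h x))"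
        using union(1) A by (intro lebesgue_integral_countable_add si) (auto simp: disjoint_family_on_def)
      then show ?case using union by simp
    qed
  qed
  have [measurable]: "h \<in> borel_measurable borel" using h by auto
  have "AE x in lborel. s * h x \<le> 0" if "s \<in> {1, -1}" for s
  proof -
    let ?A = "{x. 0 < s * h x}"
    have m: "?A \<in> sets borel" by measurable
    have "(LBINT x. indicator ?A x * (s * h x)) = s * (LINT x:?A|lborel. h x)"
      unfolding set_lebesgue_integral_def by (subst integral_mult_right_zero[symmetric]) (simp add: mult_ac)
    then have "(LBINT x. indicator ?A x * (s * h x)) = 0" using A0[OF m] by simp
    moreover have "integrable lborel (\<lambda>x. indicator ?A x * (s * h x))"
      using integrable_mult_indicator[of ?A lborel "\<lambda>x. s * h x"] m h by simp
    moreover have "AE x in lborel. 0 \<le> indicator ?A x * (s * h x)"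
      by (auto simp: indicator_def)
    ultimately have "AE x in lborel. indicator ?A x * (s * h x) = 0"
      using integral_nonneg_eq_0_iff_AE by blast
    then show ?thesis by eventually_elim (auto simp: indicator_def split: if_splits)
  qed
  from this[of 1] this[of "-1"] have "AE x in lborel. h x \<le> 0 \<and> 0 \<le> h x" by simp
  then have "AE x in lborel. h x = 0" by eventually_elim auto
  then show ?thesis by eventually_elim (auto simp: h_def)
qed

section \<open>Point evaluations and weak derivatives in time\<close>

lemma bump_integral: "integrable lborel bump" "(LBINT x. bump x) = 1"
proof -
  have eq: "bump x = indicator {0..1} x *\<^sub>R bump x" for x
    using bump_outside[of x] by (auto simp: indicator_def)
  have "(LBINT x. indicator {0..1} x *\<^sub>R bump x) = smooth_step 1 - smooth_step 0"
    using smooth_step_DERIV smooth_real_cont[OF bump_smooth]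
    by (intro integral_FTC_atLeastAtMost)
       (auto simp: has_real_derivative_iff_has_vector_derivative has_vector_derivative_at_within)
  then show "(LBINT x. bump x) = 1" unfolding eq[symmetric] by (simp add: smooth_step_simps)
  have "set_integrable lborel {0..1} bump"
    by (intro borel_integrable_atLeastAtMost' smooth_real_cont bump_smooth)
  then show "integrable lborel bump"
    unfolding set_integrable_def eq[symmetric] .
qed

text \<open>The substitution \<open>z = (k + 1) * (r - s) - e\<close> turns the kernel into the
  fixed density \<open>bump\<close>, and \<open>V\<close> is then evaluated only at
  \<open>s + (z + e) / (k + 1)\<close> with \<open>z\<close> in \<open>{0..1}\<close>. The offset
  \<open>e\<close> decides from which side of \<open>s\<close> the values are taken.\<close>

lemma approx_at_point:
  fixes V :: "real \<Rightarrow> real"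
  assumes V: "V \<in> borel_measurable borel" "\<And>r. \<bar>V r\<bar> \<le> M"
    and lim: "\<And>z. z \<in> {0..1} \<Longrightarrow> (\<lambda>k. V (s + (z + e) / real (Suc k))) \<longlonglongrightarrow> L"
  shows "(\<lambda>k. LBINT r. V r * (real (Suc k) * bump (real (Suc k) * (r - s) - e))) \<longlonglongrightarrow> L"
    and "\<And>k. integrable lborel (\<lambda>r. V r * (real (Suc k) * bump (real (Suc k) * (r - s) - e)))"
proof -
  note [measurable] = V(1)
  have [measurable]: "bump \<in> borel_measurable borel"
    by (intro borel_measurable_continuous_onI smooth_real_cont bump_smooth)
  let ?F = "\<lambda>k r. V r * (real (Suc k) * bump (real (Suc k) * (r - s) - e))"
  have sub: "?F k (s + e / real (Suc k) + 1 / real (Suc k) * z) =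
      real (Suc k) * (V (s + (z + e) / real (Suc k)) * bump z)" for k z
  proof -
    define n where "n = real (Suc k)"
    then have n: "n > 0" by simp
    have 1: "s + e / n + 1 / n * z = s + (z + e) / n" using n by (simp add: field_simps)
    have 2: "n * (s + (z + e) / n - s) - e = z" using n by (simp add: field_simps)
    show ?thesis unfolding n_def[symmetric] 1 2 by simp
  qed
  have dom: "norm (V x * bump z) \<le> M * bump z" for x z
    using mult_right_mono[OF V(2)[of x] bump_nonneg[of z]] by (simp add: abs_mult bump_nonneg)
  have eq: "(LBINT r. ?F k r) = (LBINT z. V (s + (z + e) / real (Suc k)) * bump z)" for k
  proof -
    have "(LBINT r. ?F k r) = \<bar>1 / real (Suc k)\<bar> *\<^sub>R (LBINT z. ?F k (s + e / real (Suc k) + 1 / real (Suc k) * z))"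
      by (rule lborel_integral_real_affine) simp
    then show ?thesis unfolding sub by simp
  qed
  have i: "integrable lborel (\<lambda>z. V (s + (z + e) / real (Suc k)) * bump z)" for k
    by (rule Bochner_Integration.integrable_bound[where f="\<lambda>z. M * bump z"])
       (use bump_integral(1) dom in \<open>auto intro!: AE_I2 intro: order_trans[OF _ abs_ge_self] simp del: of_nat_Suc\<close>)
  then show "integrable lborel (?F k)" for k
    using lborel_integrable_real_affine_iff[of "1 / real (Suc k)" "?F k" "s + e / real (Suc k)"]
    unfolding sub by simp
  have "(\<lambda>k. LBINT z. V (s + (z + e) / real (Suc k)) * bump z) \<longlonglongrightarrow> (LBINT z. L * bump z)"
  proof (rule integral_dominated_convergence[where w="\<lambda>z. M * bump z"])
    show "AE z in lborel. (\<lambda>k. V (s + (z + e) / real (Suc k)) * bump z) \<longlonglongrightarrow> L * bump z"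
    proof (intro AE_I2)
      fix z show "(\<lambda>k. V (s + (z + e) / real (Suc k)) * bump z) \<longlonglongrightarrow> L * bump z"
        using lim[of z] bump_outside[of z] by (cases "z \<in> {0..1}") (auto intro: tendsto_mult)
    qed
    show "AE z in lborel. norm (V (s + (z + e) / real (Suc k)) * bump z) \<le> M * bump z" for k
      using dom by auto
  qed (use bump_integral(1) in auto)
  then show "(\<lambda>k. LBINT r. ?F k r) \<longlonglongrightarrow> L" unfolding eq using bump_integral(2) by simp
qed

text \<open>For \<open>\<psi> = step_bump k s t\<close> the derivative \<open>\<psi>'\<close> approximates the difference of the point masses at \<open>s\<close> and \<open>t\<close>.\<close>

lemma weak_deriv_imp_integral:
  fixes V A :: "real \<Rightarrow> real"
  assumes cont: "continuous_on {s..t} V" and st: "s < t"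
    and A: "set_integrable lborel {s..t} A"
    and weak: "\<And>\<psi>. smooth_real \<psi> \<Longrightarrow> (\<And>r. r \<notin> {s..t} \<Longrightarrow> \<psi> r = 0) \<Longrightarrow>
        (LBINT r. V r * deriv \<psi> r) = - (LBINT r. A r * \<psi> r)"
  shows "V t - V s = (LINT r:{s..t}|lborel. A r)"
proof -
  define V' where "V' r = indicator {s..t} r *\<^sub>R V r" for r
  have [measurable]: "V' \<in> borel_measurable borel"
    unfolding V'_def[abs_def] by (intro borel_measurable_continuous_on_indicator cont) simp
  obtain M0 where M0: "\<And>r. r \<in> {s..t} \<Longrightarrow> \<bar>V r\<bar> \<le> M0"
    using compact_imp_bounded[OF compact_continuous_image[OF cont compact_Icc]] unfolding bounded_iff by (metis image_eqI real_norm_def)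
  define M where "M = max M0 0"
  have M: "\<bar>V' r\<bar> \<le> M" for r
    using M0[of r] by (auto simp: V'_def M_def indicator_def max_def intro: order_trans)
  have limV: "(\<lambda>k. V' (x + w / real (Suc k))) \<longlonglongrightarrow> V x"
    if x: "x \<in> {s..t}" and ev: "\<forall>\<^sub>F k in sequentially. x + w / real (Suc k) \<in> {s..t}" for x w
  proof -
    have "(\<lambda>k. x + w / real (Suc k)) \<longlonglongrightarrow> x + 0"
      by (intro tendsto_add tendsto_const LIMSEQ_Suc[of "\<lambda>k. w / real k"] lim_const_over_n)
    then have "(\<lambda>k. V (x + w / real (Suc k))) \<longlonglongrightarrow> V x"
      using continuous_on_tendsto_compose[OF cont _ x ev] by simp
    moreover have "\<forall>\<^sub>F k in sequentially. V (x + w / real (Suc k)) = V' (x + w / real (Suc k))"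
      using ev by eventually_elim (simp add: V'_def)
    ultimately show ?thesis by (rule Lim_transform_eventually)
  qed
  have ev_small: "\<forall>\<^sub>F k in sequentially. w / real (Suc k) \<le> t - s" for w
    using eventually_real_ge[of "w / (t - s)"]
  proof eventually_elim
    case (elim k)
    then have "w \<le> real (Suc k) * (t - s)" using st by (simp add: pos_divide_le_eq)
    then show ?case by (simp add: pos_divide_le_eq mult.commute)
  qed
  have lim1: "(\<lambda>k. V' (s + (z + 1) / real (Suc k))) \<longlonglongrightarrow> V s" if "z \<in> {0..1}" for z
    using st ev_small[of "z + 1"] that by (intro limV) (auto elim!: eventually_mono)
  have lim2: "(\<lambda>k. V' (t + (z + (-2)) / real (Suc k))) \<longlonglongrightarrow> V t" if "z \<in> {0..1}" for z
  proof (intro limV)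
    show "\<forall>\<^sub>F k in sequentially. t + (z + (-2)) / real (Suc k) \<in> {s..t}"
      using ev_small[of "2 - z"]
    proof eventually_elim
      case (elim k)
      have "(z + (-2)) / real (Suc k) = - ((2 - z) / real (Suc k))" by (simp add: field_simps)
      moreover have "0 \<le> (2 - z) / real (Suc k)" using that by simp
      ultimately show ?case using elim by simp
    qed
  qed (use st in auto)
  let ?\<psi> = "\<lambda>k. step_bump (real (Suc k)) s t"
  \<comment> \<open>The offsets 1 and -2 are those of the two steps in \<open>step_bump\<close>: the
    kernel at \<open>s\<close> samples to the right of \<open>s\<close> and the kernel at
    \<open>t\<close> to the left of \<open>t\<close>, so eventually both see only
    \<open>{s..t}\<close>.\<close>
  note a1 = approx_at_point[where V=V' and s=s and e=1, OF _ M lim1]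
  note a2 = approx_at_point[where V=V' and s=t and e="-2", OF _ M lim2]
  have supp: "\<forall>\<^sub>F k in sequentially. \<forall>r. r \<notin> {s..t} \<longrightarrow> ?\<psi> k r = 0"
    using eventually_real_ge[of "3 / (t - s)"]
  proof eventually_elim
    case (elim k)
    have "0 < 1 / real (Suc k)" by simp
    then have "r \<notin> {s..t} \<Longrightarrow> r \<notin> {s + 1 / real (Suc k)..t - 1 / real (Suc k)}" for r
      unfolding atLeastAtMost_iff by linarith
    then show ?case using step_bump_outside[OF elim st] by blast
  qed
  have "(\<lambda>k. (LBINT r. V' r * (real (Suc k) * bump (real (Suc k) * (r - s) - 1))) -
      (LBINT r. V' r * (real (Suc k) * bump (real (Suc k) * (r - t) - (-2))))) \<longlonglongrightarrow> V s - V t"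
    by (intro tendsto_diff a1(1) a2(1)) auto
  moreover have "\<forall>\<^sub>F k in sequentially. (LBINT r. V' r * (real (Suc k) * bump (real (Suc k) * (r - s) - 1))) -
      (LBINT r. V' r * (real (Suc k) * bump (real (Suc k) * (r - t) - (-2)))) = - (LBINT r. A r * ?\<psi> k r)"
    using supp
  proof eventually_elim
    case (elim k)
    have "(LBINT r. V' r * (real (Suc k) * bump (real (Suc k) * (r - s) - 1))) -
      (LBINT r. V' r * (real (Suc k) * bump (real (Suc k) * (r - t) - (-2)))) =
      (LBINT r. V' r * (real (Suc k) * bump (real (Suc k) * (r - s) - 1)) -
         V' r * (real (Suc k) * bump (real (Suc k) * (r - t) - (-2))))"
      by (intro Bochner_Integration.integral_diff[symmetric] a1(2) a2(2)) auto
    also have "\<dots> = (LBINT r. V r * deriv (?\<psi> k) r)"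
    proof (rule Bochner_Integration.integral_cong[OF refl])
      fix r
      show "V' r * (real (Suc k) * bump (real (Suc k) * (r - s) - 1)) -
         V' r * (real (Suc k) * bump (real (Suc k) * (r - t) - (-2))) = V r * deriv (?\<psi> k) r"
      proof (cases "r \<in> {s..t}")
        case True
        then show ?thesis by (simp add: V'_def step_bump_deriv algebra_simps)
      next
        case False
        then have "deriv (?\<psi> k) r = 0" using elim deriv_eq_0_outside[of s t "?\<psi> k" r] by blast
        then show ?thesis using False by (simp add: V'_def)
      qed
    qed
    also have "\<dots> = - (LBINT r. A r * ?\<psi> k r)"
      using elim by (intro weak step_bump_smooth) blast
    finally show ?case .
  qed
  ultimately have "(\<lambda>k. - (LBINT r. A r * ?\<psi> k r)) \<longlonglongrightarrow> V s - V t"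
    by (rule Lim_transform_eventually)
  moreover have "(\<lambda>k. - (LBINT r. A r * ?\<psi> k r)) \<longlonglongrightarrow> - (LINT r:{s..t}|lborel. A r)"
  proof -
    define A' where "A' r = indicator {s..t} r *\<^sub>R A r" for r
    have A': "integrable lborel A'" using A unfolding A'_def set_integrable_def .
    have [measurable]: "?\<psi> k \<in> borel_measurable borel" for k
      by (intro borel_measurable_continuous_onI smooth_real_cont step_bump_smooth)
    have "(\<lambda>k. LBINT r. A' r * ?\<psi> k r) \<longlonglongrightarrow> (LBINT r. A' r)"
    proof (rule integral_dominated_convergence[where w="\<lambda>r. \<bar>A' r\<bar>"])
      \<comment> \<open>The cutoffs converge to the indicator of the open interval; the two end
        points are a null set.\<close>
      have "AE r in lborel. r \<noteq> s \<and> r \<noteq> t"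
        using AE_lborel_singleton[of s] AE_lborel_singleton[of t] by eventually_elim auto
      then show "AE r in lborel. (\<lambda>k. A' r * ?\<psi> k r) \<longlonglongrightarrow> A' r"
      proof eventually_elim
        case (elim r)
        have "(\<lambda>k. A' r * ?\<psi> k r) \<longlonglongrightarrow> A' r * indicator {s<..<t} r"
          by (intro tendsto_mult tendsto_const step_bump_limit st)
        moreover have "A' r * indicator {s<..<t} r = A' r" using elim by (auto simp: A'_def indicator_def)
        ultimately show ?case by simp
      qed
      show "AE r in lborel. norm (A' r * ?\<psi> k r) \<le> \<bar>A' r\<bar>" for k
        using mult_left_mono[OF step_bump_le_1 abs_ge_zero] by (auto simp: abs_mult)
    qed (use A' in \<open>auto simp del: of_nat_Suc\<close>)
    moreover have "\<forall>\<^sub>F k in sequentially. (LBINT r. A' r * ?\<psi> k r) = (LBINT r. A r * ?\<psi> k r)"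
      using supp
    proof eventually_elim
      case (elim k)
      then show ?case by (intro Bochner_Integration.integral_cong) (auto simp: A'_def indicator_def)
    qed
    ultimately have "(\<lambda>k. (LBINT r. A r * ?\<psi> k r)) \<longlonglongrightarrow> (LBINT r. A' r)"
      by (rule Lim_transform_eventually)
    then show ?thesis unfolding A'_def set_lebesgue_integral_def by (rule tendsto_minus)
  qed
  ultimately have "V s - V t = - (LINT r:{s..t}|lborel. A r)" by (rule LIMSEQ_unique)
  then show ?thesis by simp
qed


text \<open>If the segment leaves \<open>S\<close>, let \<open>c\<close> and \<open>d\<close> be its
  first and last points outside \<open>S\<close>. The two outer pieces have their interiors in
  \<open>S\<close> and obey the mean value theorem; between \<open>c\<close> and \<open>d\<close>
  nothing is gained because \<open>f\<close> is 0 at both. Differentiability at boundary points of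
  \<open>S\<close> never enters.\<close>

lemma lipschitz_zero_extension:
  fixes f :: "real \<Rightarrow> real"
  assumes cont: "continuous_on UNIV f" and S: "open S"
    and deriv: "\<And>x. x \<in> S \<Longrightarrow> (f has_real_derivative f' x) (at x)" "\<And>x. x \<in> S \<Longrightarrow> \<bar>f' x\<bar> \<le> M"
    and M: "0 \<le> M" and out: "\<And>x. x \<notin> S \<Longrightarrow> f x = 0"
  shows "\<bar>f b - f a\<bar> \<le> M * \<bar>b - a\<bar>"
proof -
  have inside: "\<bar>f q - f p\<bar> \<le> M * (q - p)" if pq: "p \<le> q" "{p<..<q} \<subseteq> S" for p q
  proof (cases "p < q")
    case True
    have "\<exists>z. p < z \<and> z < q \<and> f q - f p = (q - p) * f' z"
    proof -
      have "continuous_on {p..q} f" using cont continuous_on_subset by blast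
      then obtain l z where "p < z" "z < q" "(f has_real_derivative l) (at z)" "f q - f p = (q - p) * l"
        using MVT[OF True] deriv pq(2) real_differentiable_def
        by (metis greaterThanLessThan_iff subsetD)
      then show ?thesis using deriv pq(2) DERIV_unique by (metis greaterThanLessThan_iff subsetD)
    qed
    then obtain z where z: "p < z" "z < q" "f q - f p = (q - p) * f' z" by blast
    then have "\<bar>f' z\<bar> \<le> M" using deriv(2) pq(2) by auto
    then show ?thesis using z True by (simp add: abs_mult mult.commute mult_left_mono)
  qed (use that in auto)
  have main: "\<bar>f b - f a\<bar> \<le> M * (b - a)" if ab: "a \<le> b" for a b
  proof (cases "{a..b} \<subseteq> S")
    case True
    then show ?thesis using inside[OF ab] by force
  next
    case False
    define C where "C = {a..b} - S"
    have C: "compact C" "C \<noteq> {}" using False S unfolding C_def by (auto intro: compact_diff)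
    obtain c where c: "c \<in> C" "\<And>x. x \<in> C \<Longrightarrow> c \<le> x" using compact_attains_inf[OF C] by blast
    obtain d where d: "d \<in> C" "\<And>x. x \<in> C \<Longrightarrow> x \<le> d" using compact_attains_sup[OF C] by blast
    have cd: "c \<le> d" "a \<le> c" "d \<le> b" "f c = 0" "f d = 0" using c d out by (auto simp: C_def)
    have "{a<..<c} \<subseteq> S"
    proof
      fix x assume "x \<in> {a<..<c}"
      then show "x \<in> S" using c(2)[of x] cd by (cases "x \<in> S") (auto simp: C_def)
    qed
    moreover have "{d<..<b} \<subseteq> S"
    proof
      fix x assume "x \<in> {d<..<b}"
      then show "x \<in> S" using d(2)[of x] cd by (cases "x \<in> S") (auto simp: C_def)
    qed
    ultimately have le: "\<bar>f c - f a\<bar> \<le> M * (c - a)" "\<bar>f b - f d\<bar> \<le> M * (b - d)"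
      using inside cd by blast+
    have "0 \<le> M * (d - c)" using M cd by simp
    then have "M * (c - a) + M * (b - d) \<le> M * (b - a)" by (simp add: algebra_simps)
    then show ?thesis using le cd by linarith
  qed
  show ?thesis using main[of a b] main[of b a] by (cases "a \<le> b") (auto simp: abs_minus_commute)
qed

section \<open>Integrals over a box of directional derivatives\<close>

lemma eventually_line_in_open:
  fixes x e :: "'a::euclidean_space"
  assumes "open S" "x \<in> S"
  shows "\<forall>\<^sub>F h in nhds 0. x + h *\<^sub>R e \<in> S"
proof -
  have "open ((\<lambda>h. x + h *\<^sub>R e) -` S)" using assms(1) by (intro open_vimage continuous_intros)
  then show ?thesis
    using eventually_nhds_in_open[of "(\<lambda>h. x + h *\<^sub>R e) -` S" 0] assms(2) by simp
qed

lemma continuous_on_compact_abs_bound: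
  fixes f :: "'a::topological_space \<Rightarrow> real"
  assumes "continuous_on K f" "compact K"
  shows "\<exists>M. \<forall>x\<in>K. \<bar>f x\<bar> \<le> M"
  using compact_imp_bounded[OF compact_continuous_image[OF assms]] by (auto simp: bounded_iff)

lemma integral_translate:
  fixes F :: "'a::euclidean_space \<Rightarrow> real"
  assumes "F \<in> borel_measurable borel"
  shows "(LBINT x. F (x + c)) = (LBINT x. F x)"
proof -
  have "(LBINT x. F x) = (\<integral>x. F x \<partial>(distr lborel borel ((+) c)))"
    by (simp add: lborel_distr_plus)
  also have "\<dots> = (LBINT x. F (c + x))"
    using assms by (intro integral_distr) auto
  finally show ?thesis by (simp add: add.commute)
qed

lemma integrable_translate:
  fixes F :: "'a::euclidean_space \<Rightarrow> real"
  assumes "integrable lborel F"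
  shows "integrable lborel (\<lambda>x. F (x + c))"
proof -
  have "integrable (distr lborel borel ((+) c)) F" using assms by (simp add: lborel_distr_plus)
  then show ?thesis by (subst (asm) integrable_distr_eq) (use assms in \<open>auto simp: add.commute\<close>)
qed

lemma integrable_bounded_support:
  fixes F :: "'a::euclidean_space \<Rightarrow> real"
  assumes "F \<in> borel_measurable borel" "bounded S" "\<And>x. x \<notin> S \<Longrightarrow> F x = 0" "\<And>x. \<bar>F x\<bar> \<le> M"
  shows "integrable lborel F"
proof -
  obtain R where "\<forall>x\<in>S. norm x \<le> R" using assms(2) unfolding bounded_iff by blast
  then have R: "S \<subseteq> cball 0 R" by auto
  show ?thesis
  proof (rule integrableI_bounded_set[where A="cball 0 R" and B=M])
    show "emeasure lborel (cball 0 R :: 'a set) < \<infinity>"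
      using emeasure_lborel_cball_finite by (simp add: less_top)
    show "AE x in lborel. x \<notin> cball 0 R \<longrightarrow> F x = 0" using R assms(3) by (intro AE_I2) blast
  qed (use assms in auto)
qed

lemma AE_not_frontier_box: "AE x in lborel. x \<in> box l r \<or> x \<notin> cbox l (r::'a::euclidean_space)"
proof (rule AE_I')
  have "negligible (cbox l r - box l r)" by (rule negligible_frontier_interval)
  then show "cbox l r - box l r \<in> null_sets lborel"
    by (auto simp: null_sets_def null_sets_completion_iff negligible_iff_null_sets)
qed auto

lemma AE_cbox_box: "AE x in lborel. x \<in> cbox l r \<longrightarrow> x \<in> box l (r::'a::euclidean_space)"
  using AE_not_frontier_box[of l r] by eventually_elim auto

text \<open>The difference quotients of \<open>F\<close> in direction \<open>e\<close> integrate to zero by translation invariance, and they are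
  dominated because \<open>F\<close>, extended by zero, is Lipschitz along lines. No regularity of \<open>D\<close> at the boundary of the
  box is required.\<close>

lemma integral_partial_zero:
  fixes F D :: "'a::euclidean_space \<Rightarrow> real"
  assumes cont: "continuous_on UNIV F"
    and out: "\<And>x. x \<notin> box l r \<Longrightarrow> F x = 0" "\<And>x. x \<notin> box l r \<Longrightarrow> D x = 0"
    and deriv: "\<And>x. x \<in> box l r \<Longrightarrow> ((\<lambda>h. F (x + h *\<^sub>R e)) has_real_derivative D x) (at 0)"
    and bound: "\<And>x. \<bar>D x\<bar> \<le> M"
    and meas: "D \<in> borel_measurable borel"
  shows "integrable lborel D" "(LBINT x. D x) = 0"
proof -
  have M: "0 \<le> M" using bound[of undefined] by linarith
  show "integrable lborel D"
    using integrable_bounded_support[OF meas bounded_box out(2) bound] .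
  have lip: "\<bar>F (x + h *\<^sub>R e) - F x\<bar> \<le> M * \<bar>h\<bar>" for x h
  proof -
    have "\<bar>F (x + h *\<^sub>R e) - F (x + 0 *\<^sub>R e)\<bar> \<le> M * \<bar>h - 0\<bar>"
    proof (rule lipschitz_zero_extension[where S="(\<lambda>h. x + h *\<^sub>R e) -` box l r" and f'="\<lambda>h. D (x + h *\<^sub>R e)"])
      show "continuous_on UNIV (\<lambda>h. F (x + h *\<^sub>R e))"
        by (intro continuous_on_compose2[OF cont] continuous_intros) auto
      show "open ((\<lambda>h. x + h *\<^sub>R e) -` box l r)"
        by (intro open_vimage continuous_intros open_box)
      fix k assume "k \<in> (\<lambda>h. x + h *\<^sub>R e) -` box l r"
      then have "((\<lambda>h. F (x + k *\<^sub>R e + h *\<^sub>R e)) has_real_derivative D (x + k *\<^sub>R e)) (at 0)"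
        using deriv by simp
      then have "((\<lambda>h. F (x + (h + k) *\<^sub>R e)) has_real_derivative D (x + k *\<^sub>R e)) (at 0)"
        by (simp add: algebra_simps)
      then show "((\<lambda>h. F (x + h *\<^sub>R e)) has_real_derivative D (x + k *\<^sub>R e)) (at k)"
        using DERIV_shift[of "\<lambda>h. F (x + h *\<^sub>R e)" _ 0 k] by simp
    qed (use bound M out in auto)
    then show ?thesis by simp
  qed
  obtain R where "\<forall>x\<in>box l r. norm x \<le> R" using bounded_box[of l r] unfolding bounded_iff by blast
  then have R: "box l r \<subseteq> cball 0 R" by auto
  have [measurable]: "F \<in> borel_measurable borel" using cont by (rule borel_measurable_continuous_onI)
  obtain B where B: "\<And>x. \<bar>F x\<bar> \<le> B"
  proof -
    obtain B0 where B0: "\<And>x. x \<in> cbox l r \<Longrightarrow> \<bar>F x\<bar> \<le> B0"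
      using continuous_on_compact_abs_bound[OF continuous_on_subset[OF cont] compact_cbox] by blast
    have "\<bar>F x\<bar> \<le> max B0 0" for x
      using B0[of x] out(1)[of x] box_subset_cbox[of l r] by (cases "x \<in> box l r") auto
    with that show ?thesis by blast
  qed
  have F: "integrable lborel F"
    by (rule integrable_bounded_support[where F=F and S="box l r" and M=B]) (use bounded_box out(1) B in auto)
  define Q where "Q k x = real (Suc k) * (F (x + (1 / real (Suc k)) *\<^sub>R e) - F x)" for k x
  have Q0: "(LBINT x. Q k x) = 0" for k
    unfolding Q_def using F integrable_translate[OF F] by (simp add: integral_translate)
  have [measurable]: "Q k \<in> borel_measurable borel" for k unfolding Q_def[abs_def] by measurable
  have "(\<lambda>k. LBINT x. Q k x) \<longlonglongrightarrow> (LBINT x. D x)"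
  proof (rule integral_dominated_convergence[where w="\<lambda>x. M * indicator (cball 0 (R + norm e)) x"])
    \<comment> \<open>The shifts have length at most \<open>norm e\<close>. For \<open>x\<close>
      outside the ball of radius \<open>R + norm e\<close>, both \<open>x\<close> and its shift lie
      outside the ball of radius \<open>R\<close> that contains the box, so the difference quotient
      is 0 there.\<close>
    show "integrable lborel (\<lambda>x. M * indicator (cball (0::'a) (R + norm e)) x)"
      using emeasure_lborel_cball_finite[of "0::'a" "R + norm e"]
      by (intro integrable_mult_right integrable_real_indicator) (auto simp: less_top)
    show "AE x in lborel. norm (Q k x) \<le> M * indicator (cball 0 (R + norm e)) x" for k
    proof (intro AE_I2)
      fix x
      show "norm (Q k x) \<le> M * indicator (cball 0 (R + norm e)) x"
      proof (cases "x \<in> cball 0 (R + norm e)")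
        case True
        have "norm (Q k x) = real (Suc k) * \<bar>F (x + (1 / real (Suc k)) *\<^sub>R e) - F x\<bar>"
          unfolding Q_def by (simp add: abs_mult)
        also have "\<dots> \<le> real (Suc k) * (M * \<bar>1 / real (Suc k)\<bar>)"
          by (intro mult_left_mono lip) simp
        also have "\<dots> = M" by simp
        finally show ?thesis using True by simp
      next
        case False
        have "norm x > R + norm e" using False by simp
        moreover have "norm x \<le> norm (x + (1 / real (Suc k)) *\<^sub>R e) + norm ((1 / real (Suc k)) *\<^sub>R e)"
          using norm_triangle_ineq4[of "x + (1 / real (Suc k)) *\<^sub>R e" "(1 / real (Suc k)) *\<^sub>R e"] by simp
        moreover have "norm ((1 / real (Suc k)) *\<^sub>R e) \<le> norm e"
          using mult_left_mono[of 1 "1 + real k" "norm e"] by (simp add: divide_le_eq)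
        ultimately have "R < norm (x + (1 / real (Suc k)) *\<^sub>R e)" "R < norm x"
          using norm_ge_zero[of e] by linarith+
        then have "F (x + (1 / real (Suc k)) *\<^sub>R e) = 0" "F x = 0"
          using R out(1) by (auto simp: subset_eq) force+
        then show ?thesis using M by (simp add: Q_def)
      qed
    qed
    show "AE x in lborel. (\<lambda>k. Q k x) \<longlonglongrightarrow> D x"
      using AE_not_frontier_box[of l r]
    proof eventually_elim
      case (elim x)
      have d: "((\<lambda>h. F (x + h *\<^sub>R e)) has_real_derivative D x) (at 0)"
      proof (cases "x \<in> box l r")
        case False
        then have x: "x \<in> - cbox l r" using elim by simp
        have "\<forall>\<^sub>F h in nhds 0. x + h *\<^sub>R e \<in> - cbox l r"
          using x by (intro eventually_line_in_open open_Compl closed_cbox)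
        then have "\<forall>\<^sub>F h in nhds 0. F (x + h *\<^sub>R e) = 0"
          using box_subset_cbox[of l r] by (auto elim!: eventually_mono intro!: out(1))
        then show ?thesis
          using out(2)[OF False] by (subst DERIV_cong_ev[OF refl _ refl, where g="\<lambda>_. 0"]) auto
      qed (rule deriv)
      then have "((\<lambda>h. (F (x + h *\<^sub>R e) - F x) / h) \<longlongrightarrow> D x) (at 0)"
        unfolding DERIV_def by simp
      moreover have "filterlim (\<lambda>k. 1 / real (Suc k)) (at 0) sequentially"
        unfolding filterlim_at using LIMSEQ_Suc[OF lim_const_over_n[of 1]] by simp
      ultimately have "(\<lambda>k. (F (x + (1 / real (Suc k)) *\<^sub>R e) - F x) / (1 / real (Suc k))) \<longlonglongrightarrow> D x"
        by (rule filterlim_compose)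
      then show ?case unfolding Q_def by (simp add: mult.commute)
    qed
  qed (use meas in auto)
  then show "(LBINT x. D x) = 0" unfolding Q0 by (simp add: LIMSEQ_const_iff)
qed

section \<open>Positive parts of absolutely continuous functions\<close>

text \<open>Only the inequality of the chain rule is needed, and it follows from the subgradient inequality at the right end
  points of a partition, without differentiating \<open>Y\<close>.\<close>

lemma convex_subgradient_chain:
  fixes f Y H P :: "real \<Rightarrow> real"
  assumes f: "integrable lborel f" and st: "s < t"
    and Y: "\<And>r. r \<in> {s..t} \<Longrightarrow> Y r = c + (LINT q:{s..r}|lborel. f q)"
    and Yc: "continuous_on {s..t} Y"
    and P: "continuous_on UNIV P" "\<And>y. \<bar>P y\<bar> \<le> 1"
    and HP: "\<And>a b. H b - H a \<le> P b * (b - a)"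
  shows "H (Y t) - H (Y s) \<le> (LINT r:{s<..t}|lborel. P (Y r) * f r)"
proof -
  \<comment> \<open>\<open>Y\<close> is controlled only on \<open>{s..t}\<close>; clamping its
    argument gives a continuous function on the whole line, so that \<open>P (Y' r)\<close> is
    Borel.\<close>
  define Y' where "Y' r = Y (max s (min t r))" for r
  have Y'c: "continuous_on UNIV Y'"
    unfolding Y'_def by (intro continuous_on_compose2[OF Yc] continuous_intros) (use st in auto)
  have PY: "continuous_on UNIV (\<lambda>r. P (Y' r))"
    by (intro continuous_on_compose2[OF P(1) Y'c]) auto
  then have [measurable]: "(\<lambda>r. P (Y' r)) \<in> borel_measurable borel" by (rule borel_measurable_continuous_onI)
  note [measurable] = borel_measurable_integrable[OF f]
  have si: "set_integrable lborel A f" if "A \<in> sets borel" for A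
    using integrable_mult_indicator[of A lborel f] that f unfolding set_integrable_def by simp
  define h where "h m = (t - s) / real (Suc m)" for m
  have h: "0 < h m" for m using st by (simp add: h_def)
  \<comment> \<open>\<open>\<tau> m\<close> rounds up to the grid of mesh \<open>h m\<close>. On
    each half-open cell the factor \<open>P\<close> is thus frozen at the right end point, which is
    where the subgradient inequality is applied.\<close>
  define \<tau> where "\<tau> m r = s + h m * of_int \<lceil>(r - s) / h m\<rceil>" for m r
  have [measurable]: "\<tau> m \<in> borel_measurable borel" for m unfolding \<tau>_def[abs_def] by measurable
  have bnd: "\<bar>P x * f r\<bar> \<le> \<bar>f r\<bar>" for x r
    using mult_right_mono[OF P(2)[of x] abs_ge_zero[of "f r"]] by (simp add: abs_mult)
  have siP: "set_integrable lborel A (\<lambda>r. P (Y' (\<tau> m r)) * f r)" if [measurable]: "A \<in> sets borel" for A m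
    unfolding set_integrable_def
  proof (rule Bochner_Integration.integrable_bound[OF f])
    show "AE x in lborel. norm (indicat_real A x *\<^sub>R (P (Y' (\<tau> m x)) * f x)) \<le> norm (f x)"
      using bnd by (auto simp: indicator_def)
    have "(\<lambda>r. P (Y' (\<tau> m r))) \<in> borel_measurable borel"
      using measurable_compose[of "\<tau> m" borel borel "\<lambda>r. P (Y' r)"] by simp
    then show "(\<lambda>x. indicat_real A x *\<^sub>R (P (Y' (\<tau> m x)) * f x)) \<in> borel_measurable lborel" by simp
  qed
  have part: "H (Y (s + h m * real j)) - H (Y s) \<le> (LINT r:{s<..s + h m * real j}|lborel. P (Y' (\<tau> m r)) * f r)"
    if "j \<le> Suc m" for j m
    using that
  proof (induction j)
    case (Suc j)
    let ?p = "s + h m * real j" and ?q = "s + h m * real (Suc j)"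
    have pq: "?p < ?q" using h[of m] by (simp add: algebra_simps)
    have "h m * real (Suc j) \<le> h m * real (Suc m)"
      using Suc.prems h[of m] by (intro mult_left_mono) auto
    also have "\<dots> = t - s" unfolding h_def by simp
    finally have qt: "?q \<le> t" by simp
    have ps: "s \<le> ?p" using h[of m] by simp
    have disj: "{s..?q} = {s..?p} \<union> {?p<..?q}" "{s<..?q} = {s<..?p} \<union> {?p<..?q}" using pq ps by auto
    have "(LINT q:{s..?q}|lborel. f q) = (LINT q:{s..?p}|lborel. f q) + (LINT q:{?p<..?q}|lborel. f q)"
      unfolding disj(1) by (intro set_integral_Un si) auto
    then have dY: "Y ?q - Y ?p = (LINT q:{?p<..?q}|lborel. f q)"
      using Y[of ?q] Y[of ?p] pq qt ps by simp
    have \<tau>: "\<tau> m r = ?q" if "r \<in> {?p<..?q}" for r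
    proof -
      have "\<lceil>(r - s) / h m\<rceil> = int (Suc j)"
        using that h[of m] by (intro ceiling_unique) (auto simp: pos_divide_le_eq pos_less_divide_eq algebra_simps)
      then show ?thesis by (simp add: \<tau>_def)
    qed
    have Y'q: "Y' ?q = Y ?q" using qt pq ps unfolding Y'_def by (simp add: max_def min_def)
    have "H (Y ?q) - H (Y ?p) \<le> P (Y ?q) * (Y ?q - Y ?p)" by (rule HP)
    also have "\<dots> = (LINT r:{?p<..?q}|lborel. P (Y ?q) * f r)"
      unfolding dY by simp
    also have "\<dots> = (LINT r:{?p<..?q}|lborel. P (Y' (\<tau> m r)) * f r)"
      unfolding set_lebesgue_integral_def
      by (intro Bochner_Integration.integral_cong) (auto simp: indicator_def \<tau> Y'q simp del: of_nat_Suc)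
    finally have "H (Y ?q) - H (Y ?p) \<le> (LINT r:{?p<..?q}|lborel. P (Y' (\<tau> m r)) * f r)" .
    moreover have "(LINT r:{s<..?q}|lborel. P (Y' (\<tau> m r)) * f r) =
       (LINT r:{s<..?p}|lborel. P (Y' (\<tau> m r)) * f r) + (LINT r:{?p<..?q}|lborel. P (Y' (\<tau> m r)) * f r)"
      unfolding disj(2) by (intro set_integral_Un siP) auto
    ultimately show ?case using Suc by (simp del: of_nat_Suc)
  qed (simp add: set_lebesgue_integral_def)
  have le: "H (Y t) - H (Y s) \<le> (LINT r:{s<..t}|lborel. P (Y' (\<tau> m r)) * f r)" for m
  proof -
    have "s + h m * real (Suc m) = t" by (simp add: h_def)
    then show ?thesis using part[of "Suc m" m] by simp
  qed
  have lim: "(\<lambda>m. LINT r:{s<..t}|lborel. P (Y' (\<tau> m r)) * f r) \<longlonglongrightarrow> (LINT r:{s<..t}|lborel. P (Y' r) * f r)"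
    unfolding set_lebesgue_integral_def
  proof (rule integral_dominated_convergence[where w="\<lambda>r. \<bar>f r\<bar>"])
    show "AE r in lborel. (\<lambda>m. indicat_real {s<..t} r *\<^sub>R (P (Y' (\<tau> m r)) * f r)) \<longlonglongrightarrow>
       indicat_real {s<..t} r *\<^sub>R (P (Y' r) * f r)"
    proof (intro AE_I2 tendsto_scaleR tendsto_mult tendsto_const)
      fix r
      have "norm (\<tau> m r - r) \<le> (t - s) / real (Suc m)" for m
      proof -
        have "r - s \<le> h m * of_int \<lceil>(r - s) / h m\<rceil>" "h m * of_int \<lceil>(r - s) / h m\<rceil> \<le> r - s + h m"
        proof -
          have "(r - s) / h m \<le> of_int \<lceil>(r - s) / h m\<rceil>" "of_int \<lceil>(r - s) / h m\<rceil> \<le> (r - s) / h m + 1"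
            using ceiling_correct[of "(r - s) / h m"] by linarith+
          from mult_left_mono[OF this(1), of "h m"] mult_left_mono[OF this(2), of "h m"] h[of m]
          show "r - s \<le> h m * of_int \<lceil>(r - s) / h m\<rceil>" "h m * of_int \<lceil>(r - s) / h m\<rceil> \<le> r - s + h m"
            by (simp_all add: distrib_left)
        qed
        then show ?thesis unfolding \<tau>_def h_def by auto
      qed
      moreover have "(\<lambda>m. (t - s) / real (Suc m)) \<longlonglongrightarrow> 0"
        by (rule LIMSEQ_Suc[OF lim_const_over_n])
      ultimately have "(\<lambda>m. \<tau> m r - r) \<longlonglongrightarrow> 0"
        by (rule Lim_null_comparison[OF always_eventually[OF allI]])
      then have "(\<lambda>m. \<tau> m r) \<longlonglongrightarrow> r" by (simp add: LIM_zero_iff)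
      then show "(\<lambda>m. P (Y' (\<tau> m r))) \<longlonglongrightarrow> P (Y' r)"
        by (intro continuous_on_tendsto_compose[OF PY]) auto
    qed
    show "AE r in lborel. norm (indicat_real {s<..t} r *\<^sub>R (P (Y' (\<tau> m r)) * f r)) \<le> \<bar>f r\<bar>" for m
      using bnd by (auto simp: indicator_def)
    have "(\<lambda>r. P (Y' (\<tau> m r))) \<in> borel_measurable borel" for m
      using measurable_compose[of "\<tau> m" borel borel "\<lambda>r. P (Y' r)"] by simp
    then show "(\<lambda>r. indicat_real {s<..t} r *\<^sub>R (P (Y' (\<tau> m r)) * f r)) \<in> borel_measurable lborel" for m by simp
  qed (use f in auto)
  have "H (Y t) - H (Y s) \<le> (LINT r:{s<..t}|lborel. P (Y' r) * f r)"
    using le by (intro LIMSEQ_le_const[OF lim]) auto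
  also have "\<dots> = (LINT r:{s<..t}|lborel. P (Y r) * f r)"
    unfolding set_lebesgue_integral_def
    by (intro Bochner_Integration.integral_cong) (auto simp: indicator_def Y'_def max_def min_def)
  finally show ?thesis .
qed

text \<open>A convex \<open>C\<^sup>1\<close> approximation of the positive part whose derivative vanishes at \<open>0\<close>, so that the limit of the
  derivatives is the indicator of the open half line.\<close>

definition reg_pos' :: "real \<Rightarrow> real \<Rightarrow> real" where
  "reg_pos' e y = 1 - e\<^sup>2 / (max y 0 + e)\<^sup>2"

definition reg_pos :: "real \<Rightarrow> real \<Rightarrow> real" where
  "reg_pos e y = (max y 0)\<^sup>2 / (max y 0 + e)"

text \<open>In the variable \<open>y = max b 0 + e\<close> the function is
  \<open>y - 2 e + e^2 / y\<close>, and the defect in its tangent inequality is the explicit square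
  in the proof. Passing from \<open>max b 0 - max a 0\<close> to \<open>b - a\<close> uses that
  \<open>reg_pos' e b\<close> is nonnegative, and is 0 when \<open>b \<le> 0\<close>.\<close>

lemma reg_pos_subgradient:
  assumes "0 < e" shows "reg_pos e b - reg_pos e a \<le> reg_pos' e b * (b - a)"
proof -
  let ?a = "max a 0 + e" and ?b = "max b 0 + e"
  have p: "0 < ?a" "0 < ?b" using assms by auto
  have r: "reg_pos e y = max y 0 - e + e\<^sup>2 / (max y 0 + e)" for y
    unfolding reg_pos_def using assms by (simp add: field_simps power2_eq_square add_pos_nonneg less_imp_neq add_nonneg_eq_0_iff)
  have P0: "0 \<le> reg_pos' e b"
    unfolding reg_pos'_def using assms by (simp add: divide_le_eq_1 power_mono)
  have "reg_pos e b - reg_pos e a - reg_pos' e b * (max b 0 - max a 0) = e\<^sup>2 * (1 / ?b - 1 / ?a + (?b - ?a) / ?b\<^sup>2)"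
    unfolding r reg_pos'_def by (simp add: algebra_simps diff_divide_distrib)
  also have "1 / ?b - 1 / ?a + (?b - ?a) / ?b\<^sup>2 = - ((?b - ?a)\<^sup>2 / (?a * ?b\<^sup>2))"
    using p by (simp add: divide_simps) (simp add: power2_eq_square algebra_simps)
  also have "e\<^sup>2 * (- ((?b - ?a)\<^sup>2 / (?a * ?b\<^sup>2))) \<le> 0"
    using p by (intro mult_nonneg_nonpos) auto
  finally have "reg_pos e b - reg_pos e a \<le> reg_pos' e b * (max b 0 - max a 0)" by simp
  also have "\<dots> \<le> reg_pos' e b * (b - a)"
  proof (cases "0 < b")
    case True
    then show ?thesis using P0 by (intro mult_left_mono) auto
  next
    case False
    then have "reg_pos' e b = 0" using assms by (simp add: reg_pos'_def)
    then show ?thesis by simp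
  qed
  finally show ?thesis .
qed

text \<open>Limit of the regularised chain inequality: the left side converges at the two end
  points, and the integrands on the right converge pointwise under the majorant
  \<open>\<bar>f\<bar>\<close>.\<close>

lemma pos_part_chain:
  fixes f Y :: "real \<Rightarrow> real"
  assumes f: "integrable lborel f" and st: "s < t"
    and Y: "\<And>r. r \<in> {s..t} \<Longrightarrow> Y r = c + (LINT q:{s..r}|lborel. f q)"
  shows "max (Y t) 0 - max (Y s) 0 \<le> (LINT r:{s<..t}|lborel. indicator {0<..} (Y r) * f r)"
proof -
  have si: "set_integrable lborel A f" if "A \<in> sets borel" for A
    using integrable_mult_indicator[of A lborel f] that f unfolding set_integrable_def by simp
  have Yc: "continuous_on {s..t} Y"
  proof -
    have "continuous_on {s..t} (\<lambda>r. c + integral {s..r} f)"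
      using set_borel_integral_eq_integral(1)[OF si[of "{s..t}"]]
      by (intro continuous_intros indefinite_integral_continuous_1) auto
    moreover have "c + integral {s..r} f = Y r" if "r \<in> {s..t}" for r
      using Y[OF that] set_borel_integral_eq_integral(2)[OF si[of "{s..r}"]] by simp
    ultimately show ?thesis by (rule continuous_on_eq)
  qed
  define e where "e n = 1 / real (Suc n)" for n
  have e: "0 < e n" for n by (simp add: e_def)
  have elim: "e \<longlonglongrightarrow> 0" unfolding e_def by (rule LIMSEQ_Suc[OF lim_const_over_n])
  have bnd: "\<bar>reg_pos' (e n) y\<bar> \<le> 1" for n y
  proof -
    have "(e n)\<^sup>2 \<le> (max y 0 + e n)\<^sup>2" using e[of n] by (intro power_mono) auto
    then show ?thesis
      using e[of n] unfolding reg_pos'_def by (auto simp: abs_le_iff divide_le_eq_1 intro: order_trans[OF _ add_nonneg_nonneg])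
  qed
  have le: "reg_pos (e n) (Y t) - reg_pos (e n) (Y s) \<le> (LINT r:{s<..t}|lborel. reg_pos' (e n) (Y r) * f r)" for n
  proof (rule convex_subgradient_chain[OF f st Y Yc _ bnd reg_pos_subgradient[OF e]])
    have "0 < max y 0 + e n" for y using e[of n] by auto
    then have "max y 0 + e n \<noteq> 0" for y by (metis less_irrefl)
    then show "continuous_on UNIV (reg_pos' (e n))"
      unfolding reg_pos'_def[abs_def] by (intro continuous_intros) auto
  qed
  have limH: "(\<lambda>n. reg_pos (e n) y) \<longlonglongrightarrow> max y 0" for y
  proof (cases "0 < y")
    case True
    have "(\<lambda>n. (max y 0)\<^sup>2 / (max y 0 + e n)) \<longlonglongrightarrow> (max y 0)\<^sup>2 / (max y 0 + 0)"
      using True by (intro tendsto_intros elim) auto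
    then show ?thesis using True by (simp add: reg_pos_def power2_eq_square)
  qed (simp add: reg_pos_def max_def)
  have limP: "(\<lambda>n. reg_pos' (e n) y) \<longlonglongrightarrow> indicator {0<..} y" for y
  proof (cases "0 < y")
    case True
    have "(\<lambda>n. 1 - (e n)\<^sup>2 / (max y 0 + e n)\<^sup>2) \<longlonglongrightarrow> 1 - 0\<^sup>2 / (max y 0 + 0)\<^sup>2"
      using True by (intro tendsto_intros elim) auto
    then show ?thesis using True by (simp add: reg_pos'_def)
  next
    case False
    then have "reg_pos' (e n) y = 0" for n using e[of n] by (simp add: reg_pos'_def max_def)
    then show ?thesis using False by simp
  qed
  note [measurable] = borel_measurable_integrable[OF f]
  define Y' where "Y' r = indicator {s..t} r *\<^sub>R Y r" for r
  have [measurable]: "Y' \<in> borel_measurable borel"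
    unfolding Y'_def[abs_def] by (intro borel_measurable_continuous_on_indicator Yc) simp
  have cong: "(LINT r:{s<..t}|lborel. p (Y r) * f r) = (LINT r:{s<..t}|lborel. p (Y' r) * f r)" for p :: "real \<Rightarrow> real"
    unfolding set_lebesgue_integral_def
    by (intro Bochner_Integration.integral_cong) (auto simp: indicator_def Y'_def)
  have [measurable]: "reg_pos' (e n) \<in> borel_measurable borel" for n unfolding reg_pos'_def[abs_def] by measurable
  have lim: "(\<lambda>n. LINT r:{s<..t}|lborel. reg_pos' (e n) (Y' r) * f r) \<longlonglongrightarrow> (LINT r:{s<..t}|lborel. indicator {0<..} (Y' r) * f r)"
    unfolding set_lebesgue_integral_def
  proof (rule integral_dominated_convergence[where w="\<lambda>r. \<bar>f r\<bar>"])
    show "AE r in lborel. (\<lambda>n. indicat_real {s<..t} r *\<^sub>R (reg_pos' (e n) (Y' r) * f r)) \<longlonglongrightarrow>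
       indicat_real {s<..t} r *\<^sub>R (indicat_real {0<..} (Y' r) * f r)"
      by (intro AE_I2 tendsto_scaleR tendsto_mult tendsto_const limP)
    show "AE r in lborel. norm (indicat_real {s<..t} r *\<^sub>R (reg_pos' (e n) (Y' r) * f r)) \<le> \<bar>f r\<bar>" for n
      using mult_right_mono[OF bnd abs_ge_zero] by (auto simp: indicator_def abs_mult)
  qed (use f in auto)
  show ?thesis
    unfolding cong by (rule LIMSEQ_le[OF tendsto_diff[OF limH limH] lim]) (use le in \<open>auto simp: cong\<close>)
qed

section \<open>Mollification\<close>

text \<open>If \<open>f\<close> is not integrable, its integral is 0 by convention, and
  \<open>g\<close> is nonnegative because it dominates an absolute value.\<close>

lemma abs_integral_le:
  fixes f g :: "'a \<Rightarrow> real"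
  assumes g: "integrable M g" and le: "\<And>x. \<bar>f x\<bar> \<le> g x"
  shows "\<bar>\<integral>x. f x \<partial>M\<bar> \<le> (\<integral>x. g x \<partial>M)"
proof (cases "integrable M f")
  case True
  have "norm (\<integral>x. f x \<partial>M) \<le> (\<integral>x. norm (f x) \<partial>M)" by (rule integral_norm_bound)
  also have "\<dots> \<le> (\<integral>x. g x \<partial>M)" using True g le by (intro integral_mono) auto
  finally show ?thesis by simp
next
  case False
  have "0 \<le> g x" for x using le[of x] by linarith
  then show ?thesis using False by (simp add: not_integrable_integral_eq)
qed

text \<open>The kernel is supported in the unit cube with the origin at a corner, not at the centre.
  Smoothing at scale \<open>1 / k\<close> around \<open>x\<close> therefore looks only in the
  negative coordinate directions, which is harmless for the limit.\<close>

abbreviation mollifier :: "'a::euclidean_space \<Rightarrow> real" where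
  "mollifier \<equiv> tensor (\<lambda>_. bump)"

abbreviation mollifier' :: "'a::euclidean_space \<Rightarrow> 'a \<Rightarrow> real" where
  "mollifier' b \<equiv> tensor ((\<lambda>_. bump)(b := deriv bump))"

lemma mollifier_supp: "tensor_supp 0 One (\<lambda>_. bump)"
  unfolding tensor_supp_def by (auto simp: bump_smooth intro!: bump_outside)

lemma mollifier'_supp: "tensor_supp 0 One ((\<lambda>_. bump)(b := deriv bump))"
  using tensor_supp_upd[OF mollifier_supp, of b] by simp

lemma mollifier_nonneg: "0 \<le> mollifier x"
  unfolding tensor_def by (intro prod_nonneg ballI bump_nonneg)

lemma tensor_supp_continuous: "tensor_supp l r g \<Longrightarrow> continuous_on S (tensor g)"
  by (intro tensor_continuous tensor_supp_smooth)

lemma tensor_supp_integrable: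
  fixes g :: "'a::euclidean_space \<Rightarrow> real \<Rightarrow> real"
  assumes "tensor_supp l r g"
  shows "integrable lborel (tensor g)"
proof -
  obtain M where "\<And>z. \<bar>tensor g z\<bar> \<le> M" using tensor_bounded[OF assms] by blast
  then show ?thesis
    using tensor_eq_0[OF assms] bounded_cbox[of l r]
    by (intro integrable_bounded_support[where S="cbox l r" and M=M] borel_measurable_continuous_onI
        tensor_supp_continuous[OF assms]) auto
qed

lemma mollifier_integral: "(LBINT x. mollifier (x::'a::euclidean_space)) = 1"
proof -
  interpret product_sigma_finite "\<lambda>_::'a. lborel :: real measure" by standard
  have [measurable]: "(mollifier :: 'a \<Rightarrow> real) \<in> borel_measurable borel"
    by (intro borel_measurable_continuous_onI tensor_supp_continuous[OF mollifier_supp])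
  have "(LBINT x. mollifier (x::'a)) =
      (\<integral>x. mollifier (x::'a) \<partial>(distr (\<Pi>\<^sub>M b\<in>Basis. lborel) borel (\<lambda>f. \<Sum>b\<in>Basis. f b *\<^sub>R b)))"
    using lborel_eq[where 'a='a] by simp
  also have "\<dots> = (\<integral>f. mollifier (\<Sum>b\<in>Basis. f b *\<^sub>R b :: 'a) \<partial>(\<Pi>\<^sub>M b\<in>Basis. lborel))"
    by (rule integral_distr) measurable
  also have "\<dots> = (\<integral>f. (\<Prod>b\<in>(Basis::'a set). bump (f b)) \<partial>(\<Pi>\<^sub>M b\<in>Basis. lborel))"
    unfolding tensor_def by (intro Bochner_Integration.integral_cong prod.cong refl) simp
  also have "\<dots> = (\<Prod>b\<in>(Basis::'a set). LBINT x. bump x)"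
    by (intro product_integral_prod bump_integral) auto
  finally show ?thesis by (simp add: bump_integral)
qed

lemma mollify_scaled:
  fixes \<eta> :: "'a::euclidean_space \<Rightarrow> real"
  assumes [measurable]: "\<eta> \<in> borel_measurable borel"
  shows "real (Suc k) ^ DIM('a) * (LBINT y. mollifier (real (Suc k) *\<^sub>R (x - y)) * \<eta> y) =
     (LBINT z. mollifier z * \<eta> (x - (1 / real (Suc k)) *\<^sub>R z))"
proof -
  define n where "n = real (Suc k)"
  have n: "n > 0" by (simp add: n_def)
  have [measurable]: "(mollifier :: 'a \<Rightarrow> real) \<in> borel_measurable borel"
    by (intro borel_measurable_continuous_onI tensor_supp_continuous[OF mollifier_supp])
  have "(LBINT y. mollifier (n *\<^sub>R (x - y)) * \<eta> y) =
    (\<integral>y. mollifier (n *\<^sub>R (x - y)) * \<eta> y \<partial>(density (distr lborel borel (\<lambda>z. x + (- 1 / n) *\<^sub>R z)) (\<lambda>_. ennreal (\<bar>- 1 / n\<bar> ^ DIM('a)))))"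
    using lborel_affine[of "- 1 / n" x] n by (simp add: ennreal_power)
  also have "\<dots> = (\<integral>y. (\<bar>- 1 / n\<bar> ^ DIM('a)) *\<^sub>R (mollifier (n *\<^sub>R (x - y)) * \<eta> y) \<partial>(distr lborel borel (\<lambda>z. x + (- 1 / n) *\<^sub>R z)))"
    by (rule integral_density) auto
  also have "\<dots> = (LBINT z. (\<bar>- 1 / n\<bar> ^ DIM('a)) *\<^sub>R (mollifier (n *\<^sub>R (x - (x + (- 1 / n) *\<^sub>R z))) * \<eta> (x + (- 1 / n) *\<^sub>R z)))"
    by (rule integral_distr) measurable
  also have "\<dots> = (\<bar>- 1 / n\<bar> ^ DIM('a)) * (LBINT z. mollifier z * \<eta> (x - (1 / n) *\<^sub>R z))"
    using n by simp
  finally show ?thesis unfolding n_def[symmetric] using n by (simp add: power_divide)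
qed

lemma mollify_limit:
  fixes \<eta> :: "'a::euclidean_space \<Rightarrow> real"
  assumes c: "continuous_on UNIV \<eta>" and M: "\<And>x. \<bar>\<eta> x\<bar> \<le> M"
  shows "(\<lambda>k. real (Suc k) ^ DIM('a) * (LBINT y. mollifier (real (Suc k) *\<^sub>R (x - y)) * \<eta> y)) \<longlonglongrightarrow> \<eta> x"
    and "\<And>k. \<bar>real (Suc k) ^ DIM('a) * (LBINT y. mollifier (real (Suc k) *\<^sub>R (x - y)) * \<eta> y)\<bar> \<le> M"
proof -
  have [measurable]: "\<eta> \<in> borel_measurable borel" using c by (rule borel_measurable_continuous_onI)
  have [measurable]: "(mollifier :: 'a \<Rightarrow> real) \<in> borel_measurable borel"
    by (intro borel_measurable_continuous_onI tensor_supp_continuous[OF mollifier_supp])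
  have dom: "norm (mollifier z * \<eta> y) \<le> M * mollifier z" for z y :: 'a
    using mult_left_mono[OF M[of y] mollifier_nonneg[of z]]
    by (simp add: abs_mult mollifier_nonneg mult.commute)
  have int: "integrable lborel (\<lambda>z::'a. M * mollifier z)"
    by (intro integrable_mult_right tensor_supp_integrable[OF mollifier_supp])
  have "(\<lambda>k. LBINT z. mollifier z * \<eta> (x - (1 / real (Suc k)) *\<^sub>R z)) \<longlonglongrightarrow> (LBINT z. mollifier (z::'a) * \<eta> x)"
  proof (rule integral_dominated_convergence[where w="\<lambda>z. M * mollifier z"])
    show "AE z in lborel. (\<lambda>k. mollifier z * \<eta> (x - (1 / real (Suc k)) *\<^sub>R z)) \<longlonglongrightarrow> mollifier z * \<eta> x"
    proof (intro AE_I2 tendsto_mult tendsto_const)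
      fix z
      have "(\<lambda>k. x - (1 / real (Suc k)) *\<^sub>R z) \<longlonglongrightarrow> x - 0 *\<^sub>R z"
        by (intro tendsto_intros LIMSEQ_Suc[OF lim_const_over_n])
      then show "(\<lambda>k. \<eta> (x - (1 / real (Suc k)) *\<^sub>R z)) \<longlonglongrightarrow> \<eta> x"
        using continuous_on_tendsto_compose[OF c] by auto
    qed
  qed (use int dom in auto)
  then show "(\<lambda>k. real (Suc k) ^ DIM('a) * (LBINT y. mollifier (real (Suc k) *\<^sub>R (x - y)) * \<eta> y)) \<longlonglongrightarrow> \<eta> x"
    unfolding mollify_scaled[OF \<open>\<eta> \<in> borel_measurable borel\<close>] by (simp add: mollifier_integral)
  fix k
  have "\<bar>LBINT z. mollifier z * \<eta> (x - (1 / real (Suc k)) *\<^sub>R z)\<bar> \<le> (LBINT z. M * mollifier (z::'a))"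
    using abs_integral_le[OF int] dom by simp
  then show "\<bar>real (Suc k) ^ DIM('a) * (LBINT y. mollifier (real (Suc k) *\<^sub>R (x - y)) * \<eta> y)\<bar> \<le> M"
    unfolding mollify_scaled[OF \<open>\<eta> \<in> borel_measurable borel\<close>] by (simp add: mollifier_integral)
qed

text \<open>The partial derivatives are carried as data \<open>D\<close> and are required along
  coordinate lines only. This is the form in which compositions such as
  \<open>p (\<theta> + \<sigma> \<phi>)\<close> can be verified, where \<open>C^\<infinity>\<close>
  smoothness would fail.\<close>

definition C1c :: "'a::euclidean_space set \<Rightarrow> ('a \<Rightarrow> real) \<Rightarrow> ('a \<Rightarrow> 'a \<Rightarrow> real) \<Rightarrow> bool" where
  "C1c U \<eta> D \<longleftrightarrow> continuous_on UNIV \<eta> \<and>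
     (\<exists>K. compact K \<and> K \<subseteq> U \<and> (\<forall>x. x \<notin> K \<longrightarrow> \<eta> x = 0 \<and> (\<forall>b\<in>Basis. D b x = 0))) \<and>
     (\<forall>b\<in>Basis. continuous_on UNIV (D b) \<and>
        (\<forall>x. ((\<lambda>h. \<eta> (x + h *\<^sub>R b)) has_real_derivative D b x) (at 0)))"

lemma continuous_compact_support_bounded:
  fixes \<eta> :: "'a::euclidean_space \<Rightarrow> real"
  assumes "continuous_on UNIV \<eta>" "compact K" "\<And>x. x \<notin> K \<Longrightarrow> \<eta> x = 0"
  shows "\<exists>M. \<forall>x. \<bar>\<eta> x\<bar> \<le> M" "integrable lborel \<eta>"
proof -
  obtain M where M: "\<And>x. x \<in> K \<Longrightarrow> \<bar>\<eta> x\<bar> \<le> M"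
    using continuous_on_compact_abs_bound[OF continuous_on_subset[OF assms(1)] assms(2)] by blast
  have *: "\<bar>\<eta> x\<bar> \<le> max M 0" for x
    using M[of x] assms(3)[of x] by (cases "x \<in> K") auto
  then show "\<exists>M. \<forall>x. \<bar>\<eta> x\<bar> \<le> M" by blast
  show "integrable lborel \<eta>"
    using * assms(3) compact_imp_bounded[OF assms(2)] borel_measurable_continuous_onI[OF assms(1)]
    by (rule_tac integrable_bounded_support[where S=K and M="max M 0"]) auto
qed

lemma integrable_tensor_product:
  fixes f :: "'a::euclidean_space \<Rightarrow> real" and g :: "'b::euclidean_space \<Rightarrow> real"
  assumes f: "integrable lborel f" and g: "integrable lborel g"
  shows "integrable (lborel \<Otimes>\<^sub>M lborel) (\<lambda>(x, y). f x * g y)"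
proof -
  note [measurable] = borel_measurable_integrable[OF f] borel_measurable_integrable[OF g]
  show ?thesis
  proof (rule lborel_pair.Fubini_integrable)
    show "integrable lborel (\<lambda>x. LBINT y. norm (case (x, y) of (x, y) \<Rightarrow> f x * g y))"
      using f by (simp add: abs_mult)
  qed (use g in auto)
qed

text \<open>Since \<open>k\<close> is bounded by \<open>M\<close>, the product
  \<open>M \<bar>f x\<bar> \<bar>g y\<bar>\<close> is an integrable majorant on the product
  space.\<close>

lemma Fubini_kernel:
  fixes f :: "'a::euclidean_space \<Rightarrow> real" and g :: "'a \<Rightarrow> real" and k :: "'a \<Rightarrow> real"
  assumes f: "integrable lborel f" and g: "integrable lborel g"
    and k: "k \<in> borel_measurable borel" "\<And>z. \<bar>k z\<bar> \<le> M"
  shows "(LBINT y. g y * (LBINT x. f x * k (c *\<^sub>R (x - y)))) =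
         (LBINT x. f x * (LBINT y. k (c *\<^sub>R (x - y)) * g y))"
proof -
  note [measurable] = borel_measurable_integrable[OF f] borel_measurable_integrable[OF g] k(1)
  have i: "integrable (lborel \<Otimes>\<^sub>M lborel) (\<lambda>(x, y). f x * k (c *\<^sub>R (x - y)) * g y)"
  proof (rule Bochner_Integration.integrable_bound)
    show "integrable (lborel \<Otimes>\<^sub>M lborel) (\<lambda>(x, y). (M * f x) * g y)"
      by (intro integrable_tensor_product integrable_mult_right f g)
    have "\<bar>f x * k (c *\<^sub>R (x - y)) * g y\<bar> \<le> \<bar>M * f x * g y\<bar>" for x y
    proof -
      have "\<bar>k (c *\<^sub>R (x - y))\<bar> * (\<bar>f x\<bar> * \<bar>g y\<bar>) \<le> M * (\<bar>f x\<bar> * \<bar>g y\<bar>)"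
        using k(2) by (intro mult_right_mono) auto
      moreover have "M \<ge> 0" using k(2)[of 0] by linarith
      ultimately show ?thesis by (simp add: abs_mult mult_ac)
    qed
    then show "AE p in lborel \<Otimes>\<^sub>M lborel. norm (case p of (x, y) \<Rightarrow> f x * k (c *\<^sub>R (x - y)) * g y)
        \<le> norm (case p of (x, y) \<Rightarrow> M * f x * g y)" by auto
  qed measurable
  have "(LBINT y. (LBINT x. f x * k (c *\<^sub>R (x - y)) * g y)) =
      (LBINT x. (LBINT y. f x * k (c *\<^sub>R (x - y)) * g y))"
    using lborel_pair.Fubini_integral[OF i] by simp
  moreover have "(LBINT x. f x * k (c *\<^sub>R (x - y)) * g y) = g y * (LBINT x. f x * k (c *\<^sub>R (x - y)))" for y
    by (simp add: mult.commute[of _ "g y"])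
  moreover have "(LBINT y. f x * k (c *\<^sub>R (x - y)) * g y) = f x * (LBINT y. k (c *\<^sub>R (x - y)) * g y)" for x
    by (simp add: mult.assoc)
  ultimately show ?thesis by (simp only:)
qed

lemma kernel_derivative:
  fixes x y b :: "'a::euclidean_space"
  assumes "b \<in> Basis"
  shows "((\<lambda>h. mollifier (c *\<^sub>R (x - (y + h *\<^sub>R b)))) has_real_derivative - c * mollifier' b (c *\<^sub>R (x - y))) (at 0)"
proof -
  have d: "((\<lambda>h. mollifier (c *\<^sub>R (x - y) + h *\<^sub>R b)) has_real_derivative mollifier' b (c *\<^sub>R (x - y))) (at (- c * 0))"
    using tensor_has_partial[OF assms, of "\<lambda>_. bump"] by (simp add: bump_smooth)
  have "((\<lambda>h. - c * h) has_real_derivative - c) (at 0)" by (auto intro!: derivative_eq_intros)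
  from DERIV_chain2[OF d this] show ?thesis
    by (simp add: algebra_simps)
qed

text \<open>Integration by parts in \<open>y\<close>: the minus sign from differentiating
  \<open>x - y\<close> and the minus sign from moving the derivative to \<open>\<eta>\<close>
  cancel.\<close>

lemma kernel_parts:
  fixes \<eta> :: "'a::euclidean_space \<Rightarrow> real"
  assumes C: "C1c (box l r) \<eta> D" and b: "b \<in> Basis"
  shows "(LBINT y. c * mollifier' b (c *\<^sub>R (x - y)) * \<eta> y) = (LBINT y. mollifier (c *\<^sub>R (x - y)) * D b y)"
proof -
  obtain K where K: "compact K" "K \<subseteq> box l r" "\<And>x. x \<notin> K \<Longrightarrow> \<eta> x = 0" "\<And>x. x \<notin> K \<Longrightarrow> D b x = 0"
    using C b unfolding C1c_def by blast
  have c: "continuous_on UNIV \<eta>" "continuous_on UNIV (D b)"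
    and d: "\<And>x. ((\<lambda>h. \<eta> (x + h *\<^sub>R b)) has_real_derivative D b x) (at 0)"
    using C b unfolding C1c_def by blast+
  let ?\<rho> = "\<lambda>y. mollifier (c *\<^sub>R (x - y))" and ?\<rho>' = "\<lambda>y. - c * mollifier' b (c *\<^sub>R (x - y))"
  have r: "continuous_on UNIV ?\<rho>" "continuous_on UNIV ?\<rho>'"
    by (intro continuous_intros continuous_on_compose2[OF tensor_supp_continuous[OF mollifier_supp, of UNIV]]
       continuous_on_compose2[OF tensor_supp_continuous[OF mollifier'_supp, of UNIV b]]; auto)+
  let ?D = "\<lambda>y. ?\<rho>' y * \<eta> y + D b y * ?\<rho> y"
  have cD: "continuous_on UNIV ?D" by (intro continuous_intros r c)
  have DK: "\<And>y. y \<notin> K \<Longrightarrow> ?D y = 0" using K by simp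
  obtain M where M: "\<And>y. \<bar>?D y\<bar> \<le> M"
    using continuous_compact_support_bounded(1)[OF cD K(1) DK] by blast
  have "(LBINT y. ?D y) = 0"
  proof (rule integral_partial_zero(2)[where F="\<lambda>y. ?\<rho> y * \<eta> y" and e=b and M=M and l=l and r=r])
    show "continuous_on UNIV (\<lambda>y. ?\<rho> y * \<eta> y)" by (intro continuous_intros r c)
    show "((\<lambda>h. ?\<rho> (y + h *\<^sub>R b) * \<eta> (y + h *\<^sub>R b)) has_real_derivative ?D y) (at 0)" for y
      using DERIV_mult[OF kernel_derivative[OF b, of c x y] d[of y]] by simp
    show "?D \<in> borel_measurable borel" using cD by (rule borel_measurable_continuous_onI)
  qed (use K M in \<open>auto simp: subset_eq\<close>)
  moreover have "integrable lborel (\<lambda>y. ?\<rho>' y * \<eta> y)" "integrable lborel (\<lambda>y. D b y * ?\<rho> y)"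
    using K by (intro continuous_compact_support_bounded(2)[where K=K] continuous_intros r c; simp)+
  ultimately show ?thesis by (simp add: mult.commute mult.left_commute)
qed

text \<open>A distributional identity that is known for translated mollifiers only extends to all \<open>C\<^sup>1\<close> functions of compact support, by
  integration against \<open>\<eta> y\<close>. On a time slice only countably many test functions are available outside a common null set,
  and the mollifiers with centres in a countable dense set are such a family.\<close>

lemma weak_divergence_C1c:
  fixes f :: "'a::euclidean_space \<Rightarrow> real" and G :: "'a \<Rightarrow> 'a \<Rightarrow> real"
  assumes f: "integrable lborel f" and G: "\<And>b. b \<in> Basis \<Longrightarrow> integrable lborel (G b)"
    and kernel: "\<And>k y. cbox y (y + (1 / real (Suc k)) *\<^sub>R One) \<subseteq> box l r \<Longrightarrow>
      (LBINT x. f x * mollifier (real (Suc k) *\<^sub>R (x - y))) =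
      - (\<Sum>b\<in>Basis. LBINT x. G b x * (real (Suc k) * mollifier' b (real (Suc k) *\<^sub>R (x - y))))"
    and C: "C1c (box l r) \<eta> D"
  shows "(LBINT x. f x * \<eta> x) = - (\<Sum>b\<in>Basis. LBINT x. G b x * D b x)"
proof -
  obtain K where K: "compact K" "K \<subseteq> box l r" "\<And>x. x \<notin> K \<Longrightarrow> \<eta> x = 0" "\<And>x b. x \<notin> K \<Longrightarrow> b \<in> Basis \<Longrightarrow> D b x = 0"
    using C unfolding C1c_def by blast
  have c: "continuous_on UNIV \<eta>" "\<And>b. b \<in> Basis \<Longrightarrow> continuous_on UNIV (D b)"
    using C unfolding C1c_def by blast+
  have \<eta>i: "integrable lborel \<eta>" using continuous_compact_support_bounded(2)[OF c(1) K(1,3)] by blast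
  obtain e where e: "e > 0" "(\<Union>x\<in>K. ball x e) \<subseteq> box l r"
    using compact_subset_open_imp_ball_epsilon_subset[OF K(1) open_box K(2)] by blast
  \<comment> \<open>The cube of side \<open>1 / (k + 1)\<close> at a point of \<open>K\<close> stays
    in the box once its diameter is below the distance \<open>e\<close>; the \<open>+ 1\<close> in
    the threshold makes this comparison strict.\<close>
  have ev: "\<forall>\<^sub>F k in sequentially. \<forall>y\<in>K. cbox y (y + (1 / real (Suc k)) *\<^sub>R One) \<subseteq> box l r"
    using eventually_real_ge[of "(norm (One::'a) + 1) / e"]
  proof eventually_elim
    case (elim k)
    have k: "norm (One::'a) / real (Suc k) < e"
      using elim e(1) by (simp add: field_simps del: of_nat_Suc)
    show ?case
    proof (intro ballI subsetI)
      fix y x assume y: "y \<in> K" and x: "x \<in> cbox y (y + (1 / real (Suc k)) *\<^sub>R One)"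
      have "norm (x - y) \<le> norm ((1 / real (Suc k)) *\<^sub>R (One::'a))"
      proof (rule norm_le_componentwise)
        fix b :: 'a assume b: "b \<in> Basis"
        then have "y \<bullet> b \<le> x \<bullet> b" "x \<bullet> b \<le> y \<bullet> b + 1 / real (Suc k)"
          using x unfolding mem_box by (auto simp: inner_add_left)
        then show "\<bar>(x - y) \<bullet> b\<bar> \<le> \<bar>(1 / real (Suc k)) *\<^sub>R One \<bullet> b\<bar>"
          using b by (simp add: inner_diff_left)
      qed
      also have "\<dots> < e" using k by simp
      finally have "x \<in> ball y e" by (simp add: dist_norm norm_minus_commute)
      then show "x \<in> box l r" using e(2) y by blast
    qed
  qed
  define N where "N k = real (Suc k) ^ DIM('a)" for k
  define I where "I \<zeta> k x = N k * (LBINT y. mollifier (real (Suc k) *\<^sub>R (x - y)) * \<zeta> y)" for \<zeta> :: "'a \<Rightarrow> real" and k x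
  have lim: "(\<lambda>k. LBINT x. g x * I \<zeta> k x) \<longlonglongrightarrow> (LBINT x. g x * \<zeta> x)"
    if g: "integrable lborel g" and \<zeta>: "continuous_on UNIV \<zeta>" "\<And>x. x \<notin> K \<Longrightarrow> \<zeta> x = 0" for g \<zeta>
  proof -
    note [measurable] = borel_measurable_integrable[OF g] borel_measurable_continuous_onI[OF \<zeta>(1)]
    have [measurable]: "(mollifier :: 'a \<Rightarrow> real) \<in> borel_measurable borel"
      by (intro borel_measurable_continuous_onI tensor_supp_continuous[OF mollifier_supp])
    obtain M where M: "\<And>x. \<bar>\<zeta> x\<bar> \<le> M"
      using continuous_compact_support_bounded(1)[OF \<zeta>(1) K(1) \<zeta>(2)] by blast
    have [measurable]: "I \<zeta> k \<in> borel_measurable borel" for k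
      unfolding I_def[abs_def] by measurable
    show ?thesis
    proof (rule integral_dominated_convergence[where w="\<lambda>x. \<bar>g x\<bar> * M"])
      show "AE x in lborel. (\<lambda>k. g x * I \<zeta> k x) \<longlonglongrightarrow> g x * \<zeta> x"
        unfolding I_def N_def by (intro AE_I2 tendsto_mult tendsto_const mollify_limit[OF \<zeta>(1) M])
      show "AE x in lborel. norm (g x * I \<zeta> k x) \<le> \<bar>g x\<bar> * M" for k
        using mult_left_mono[OF mollify_limit(2)[OF \<zeta>(1) M] abs_ge_zero]
        unfolding I_def N_def by (auto simp: abs_mult)
    qed (use g in auto)
  qed
  have "\<forall>\<^sub>F k in sequentially. (LBINT x. f x * I \<eta> k x) = - (\<Sum>b\<in>Basis. LBINT x. G b x * I (D b) k x)"
    using ev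
  proof eventually_elim
    case (elim k)
    let ?c = "real (Suc k)"
    obtain M where M: "\<And>z::'a. \<bar>mollifier z\<bar> \<le> M" using tensor_bounded[OF mollifier_supp] by blast
    have m: "(mollifier :: 'a \<Rightarrow> real) \<in> borel_measurable borel"
      "mollifier' b \<in> borel_measurable borel" for b :: 'a
      by (intro borel_measurable_continuous_onI tensor_supp_continuous[OF mollifier_supp]
         tensor_supp_continuous[OF mollifier'_supp])+
    have "(LBINT x. f x * (LBINT y. mollifier (?c *\<^sub>R (x - y)) * \<eta> y)) =
      (LBINT y. \<eta> y * (LBINT x. f x * mollifier (?c *\<^sub>R (x - y))))"
      by (rule Fubini_kernel[OF f \<eta>i m(1) M, symmetric])
    also have "\<dots> = (LBINT y. \<eta> y * (- (\<Sum>b\<in>Basis. LBINT x. G b x * (?c * mollifier' b (?c *\<^sub>R (x - y))))))"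
    proof (rule Bochner_Integration.integral_cong[OF refl])
      fix y
      \<comment> \<open>For \<open>y\<close> outside \<open>K\<close> the weight
        \<open>\<eta> y\<close> is 0, so the kernel identity is used only at centres whose cube lies
        in the box.\<close>
      show "\<eta> y * (LBINT x. f x * mollifier (?c *\<^sub>R (x - y))) =
        \<eta> y * (- (\<Sum>b\<in>Basis. LBINT x. G b x * (?c * mollifier' b (?c *\<^sub>R (x - y)))))"
        using kernel[of y k] elim K(3)[of y] by (cases "y \<in> K") auto
    qed
    also have "\<dots> = - (\<Sum>b\<in>Basis. LBINT y. \<eta> y * (LBINT x. G b x * (?c * mollifier' b (?c *\<^sub>R (x - y)))))"
    proof -
      have "integrable lborel (\<lambda>y. \<eta> y * (LBINT x. G b x * (?c * mollifier' b (?c *\<^sub>R (x - y)))))" if b: "b \<in> Basis" for b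
      proof -
        obtain M where M: "\<And>z::'a. \<bar>mollifier' b z\<bar> \<le> M" using tensor_bounded[OF mollifier'_supp] by blast
        note [measurable] = borel_measurable_integrable[OF G[OF b]] borel_measurable_integrable[OF \<eta>i] m(2)[of b]
        have i: "integrable lborel (\<lambda>x. G b x * (?c * mollifier' b (?c *\<^sub>R (x - y))))" for y
          by (rule Bochner_Integration.integrable_bound[where f="\<lambda>x. G b x * (?c * M)"])
            (use G[OF b] M in \<open>auto simp: abs_mult intro!: mult_left_mono order_trans[OF M abs_ge_self]\<close>)
        have "\<bar>LBINT x. G b x * (?c * mollifier' b (?c *\<^sub>R (x - y)))\<bar> \<le> (LBINT x. \<bar>G b x\<bar> * (?c * M))" for y
          using G[OF b] M by (intro abs_integral_le) (auto simp: abs_mult intro!: mult_left_mono)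
        then have "norm (\<eta> y * (LBINT x. G b x * (?c * mollifier' b (?c *\<^sub>R (x - y)))))
            \<le> norm (\<eta> y * (LBINT x. \<bar>G b x\<bar> * (?c * M)))" for y
          unfolding real_norm_def abs_mult[of "\<eta> y"] by (intro mult_left_mono abs_ge_zero) (rule order_trans[OF _ abs_ge_self])
        then show ?thesis
          by (intro Bochner_Integration.integrable_bound[OF integrable_mult_left[OF \<eta>i]] AE_I2) measurable
      qed
      then show ?thesis
        by (simp add: sum_distrib_left Bochner_Integration.integral_sum del: of_nat_Suc)
    qed
    also have "\<dots> = - (\<Sum>b\<in>Basis. LBINT x. G b x * (LBINT y. mollifier (?c *\<^sub>R (x - y)) * D b y))"
    proof -
      have "(LBINT y. \<eta> y * (LBINT x. G b x * (?c * mollifier' b (?c *\<^sub>R (x - y))))) =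
        (LBINT x. G b x * (LBINT y. mollifier (?c *\<^sub>R (x - y)) * D b y))" if b: "b \<in> Basis" for b
      proof -
        obtain M where M: "\<And>z::'a. \<bar>mollifier' b z\<bar> \<le> M" using tensor_bounded[OF mollifier'_supp] by blast
        have "(LBINT y. \<eta> y * (LBINT x. G b x * (?c * mollifier' b (?c *\<^sub>R (x - y))))) =
          (LBINT x. G b x * (LBINT y. (?c * mollifier' b (?c *\<^sub>R (x - y))) * \<eta> y))"
          using Fubini_kernel[OF G[OF b] \<eta>i, of "\<lambda>z. ?c * mollifier' b z" "?c * M" ?c] m(2)[of b] M
          by (simp add: abs_mult mult_left_mono del: of_nat_Suc integral_mult_right_zero integral_mult_left_zero)
        then show ?thesis unfolding kernel_parts[OF C b] .
      qed
      then show ?thesis by (simp cong: sum.cong)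
    qed
    finally have *: "(LBINT x. f x * (LBINT y. mollifier (?c *\<^sub>R (x - y)) * \<eta> y)) =
      - (\<Sum>b\<in>Basis. LBINT x. G b x * (LBINT y. mollifier (?c *\<^sub>R (x - y)) * D b y))" .
    have I_out: "(LBINT x. g x * I \<zeta> k x) = N k * (LBINT x. g x * (LBINT y. mollifier (?c *\<^sub>R (x - y)) * \<zeta> y))" for g \<zeta>
      unfolding I_def by (simp add: mult.left_commute del: of_nat_Suc)
    show ?case unfolding I_out * by (simp add: sum_distrib_left del: of_nat_Suc)
  qed
  moreover have "(\<lambda>k. LBINT x. f x * I \<eta> k x) \<longlonglongrightarrow> (LBINT x. f x * \<eta> x)"
    using f c K by (intro lim) auto
  ultimately have "(\<lambda>k. - (\<Sum>b\<in>Basis. LBINT x. G b x * I (D b) k x)) \<longlonglongrightarrow> (LBINT x. f x * \<eta> x)"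
    by (rule Lim_transform_eventually[rotated])
  moreover have "(\<lambda>k. - (\<Sum>b\<in>Basis. LBINT x. G b x * I (D b) k x)) \<longlonglongrightarrow> - (\<Sum>b\<in>Basis. LBINT x. G b x * D b x)"
    using G c K by (intro tendsto_minus tendsto_sum lim) auto
  ultimately show ?thesis by (rule LIMSEQ_unique)
qed

section \<open>Nonlinear test functions\<close>

lemma continuous_zero_outside_compact:
  fixes g :: "'a::euclidean_space \<Rightarrow> real"
  assumes "open U" "continuous_on U g" "compact K" "K \<subseteq> U" "\<And>x. x \<notin> K \<Longrightarrow> g x = 0"
  shows "continuous_on UNIV g"
proof -
  have "continuous_on (U \<union> - K) g"
  proof (rule continuous_on_open_Un)
    show "continuous_on (- K) g" using assms(5) by (subst continuous_on_cong[OF refl, where g="\<lambda>_. 0"]) auto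
  qed (use assms in \<open>auto intro: compact_imp_closed\<close>)
  moreover have "U \<union> - K = UNIV" using assms(4) by blast
  ultimately show ?thesis by simp
qed

section \<open>Square integrable functions on the whole space\<close>

definition sqint :: "('a::euclidean_space \<Rightarrow> real) \<Rightarrow> bool" where
  "sqint f \<longleftrightarrow> f \<in> borel_measurable borel \<and> integrable lborel (\<lambda>x. (f x)\<^sup>2)"

lemma abs_prod_le_squares: "\<bar>a * b\<bar> \<le> a\<^sup>2 + (b::real)\<^sup>2"
proof -
  have "0 \<le> (\<bar>a\<bar> - \<bar>b\<bar>)\<^sup>2" by simp
  then have "2 * \<bar>a * b\<bar> \<le> a\<^sup>2 + b\<^sup>2" by (simp add: power2_diff abs_mult)
  then show ?thesis using abs_ge_zero[of "a * b"] by linarith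
qed

lemma sqint_mult:
  assumes "sqint f" "sqint g" shows "integrable lborel (\<lambda>x. f x * g x)"
proof (rule Bochner_Integration.integrable_bound)
  show "integrable lborel (\<lambda>x. (f x)\<^sup>2 + (g x)\<^sup>2)" using assms by (auto simp: sqint_def)
  show "AE x in lborel. norm (f x * g x) \<le> norm ((f x)\<^sup>2 + (g x)\<^sup>2)"
    using abs_prod_le_squares by (auto intro!: AE_I2)
qed (use assms in \<open>auto simp: sqint_def\<close>)

lemma sqint_add:
  assumes "sqint f" "sqint g" shows "sqint (\<lambda>x. f x + g x)"
proof -
  have "integrable lborel (\<lambda>x. (f x)\<^sup>2 + (g x)\<^sup>2 + 2 * (f x * g x))"
    using sqint_mult[OF assms] assms by (auto simp: sqint_def)
  then show ?thesis using assms unfolding sqint_def by (auto simp: power2_sum mult.assoc)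
qed

lemma sqint_cmult: "sqint f \<Longrightarrow> sqint (\<lambda>x. c * f x)"
  by (auto simp: sqint_def power_mult_distrib)

lemma sqint_diff: "sqint f \<Longrightarrow> sqint g \<Longrightarrow> sqint (\<lambda>x. f x - g x)"
  using sqint_add[of f "\<lambda>x. (-1) * g x"] sqint_cmult[of g "-1"] by simp

lemma sqint_bounded_support:
  assumes "f \<in> borel_measurable borel" "bounded S" "\<And>x. x \<notin> S \<Longrightarrow> f x = 0" "\<And>x. \<bar>f x\<bar> \<le> M"
  shows "sqint f"
proof -
  have "\<bar>(f x)\<^sup>2\<bar> \<le> M\<^sup>2" for x using power_mono[OF assms(4)[of x] abs_ge_zero, of 2] by simp
  then have "integrable lborel (\<lambda>x. (f x)\<^sup>2)"
    using assms by (intro integrable_bounded_support[where S=S and M="M\<^sup>2"]) auto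
  then show ?thesis using assms by (simp add: sqint_def)
qed

lemma C1c_sqint:
  assumes "C1c U \<eta> D"
  shows "sqint \<eta>" "b \<in> Basis \<Longrightarrow> sqint (D b)"
proof -
  obtain K where K: "compact K" "\<And>x. x \<notin> K \<Longrightarrow> \<eta> x = 0" "\<And>x b. x \<notin> K \<Longrightarrow> b \<in> Basis \<Longrightarrow> D b x = 0"
    using assms unfolding C1c_def by blast
  have c: "continuous_on UNIV \<eta>" "\<And>b. b \<in> Basis \<Longrightarrow> continuous_on UNIV (D b)"
    using assms unfolding C1c_def by blast+
  have *: "sqint \<zeta>" if z: "continuous_on UNIV \<zeta>" "\<And>x. x \<notin> K \<Longrightarrow> \<zeta> x = 0" for \<zeta> :: "'a \<Rightarrow> real"
  proof -
    obtain m where "\<And>x. \<bar>\<zeta> x\<bar> \<le> m" using continuous_compact_support_bounded(1)[OF z(1) K(1) z(2)] by blast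
    then show ?thesis using z K(1) borel_measurable_continuous_onI[OF z(1)]
      by (intro sqint_bounded_support[where S=K and M=m]) (auto intro: compact_imp_bounded)
  qed
  show "sqint \<eta>" using * c K by blast
  show "b \<in> Basis \<Longrightarrow> sqint (D b)" using * c K by blast
qed

text \<open>Weighted Young inequality
  \<open>\<bar>E d\<bar> \<le> \<delta> E^2 + d^2 / \<delta>\<close>: a small
  \<open>\<delta>\<close> disposes of the first term, and for that fixed \<open>\<delta>\<close> the
  convergence of \<open>d\<close> disposes of the second.\<close>

lemma sqint_pairing_tendsto_0:
  assumes E: "sqint E" and d: "\<And>j. sqint (d j)"
    and lim: "(\<lambda>j. LBINT x. (d j x)\<^sup>2) \<longlonglongrightarrow> 0"
  shows "(\<lambda>j::nat. LBINT x. \<bar>E x * d j x\<bar>) \<longlonglongrightarrow> 0"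
proof (rule LIMSEQ_I)
  fix e :: real assume e: "0 < e"
  define A where "A = (LBINT x. (E x)\<^sup>2)"
  have A: "0 \<le> A" unfolding A_def by simp
  \<comment> \<open>The \<open>+ 1\<close> keeps the denominator positive when \<open>E\<close> is 0
    almost everywhere.\<close>
  define \<delta> where "\<delta> = e / (2 * (A + 1))"
  have \<delta>: "0 < \<delta>" using A e by (simp add: \<delta>_def)
  have \<delta>A: "\<delta> * A < e / 2"
  proof -
    have "\<delta> * A < \<delta> * (A + 1)" using \<delta> by simp
    also have "\<dots> = e / 2" using A by (simp add: \<delta>_def field_simps)
    finally show ?thesis .
  qed
  have bnd: "(LBINT x. \<bar>E x * d j x\<bar>) \<le> \<delta> * A + (1 / \<delta>) * (LBINT x. (d j x)\<^sup>2)" for j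
  proof -
    have pt: "\<bar>E x * d j x\<bar> \<le> \<delta> * (E x)\<^sup>2 + (1 / \<delta>) * (d j x)\<^sup>2" for x
    proof -
      have "\<bar>(sqrt \<delta> * E x) * (d j x / sqrt \<delta>)\<bar> \<le> (sqrt \<delta> * E x)\<^sup>2 + (d j x / sqrt \<delta>)\<^sup>2"
        by (rule abs_prod_le_squares)
      then show ?thesis using \<delta> by (simp add: power_mult_distrib power_divide)
    qed
    have "(LBINT x. \<bar>E x * d j x\<bar>) \<le> (LBINT x. \<delta> * (E x)\<^sup>2 + (1 / \<delta>) * (d j x)\<^sup>2)"
      using sqint_mult[OF E d[of j]] E d[of j] pt by (intro integral_mono) (auto simp: sqint_def)
    then show ?thesis using E d[of j] by (simp add: sqint_def A_def)
  qed
  obtain N where N: "\<And>j. j \<ge> N \<Longrightarrow> (LBINT x. (d j x)\<^sup>2) < \<delta> * (e / 2)"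
    using LIMSEQ_D[OF lim, of "\<delta> * (e / 2)"] \<delta> e by auto
  have "norm ((LBINT x. \<bar>E x * d j x\<bar>) - 0) < e" if "j \<ge> N" for j
  proof -
    have "(1 / \<delta>) * (LBINT x. (d j x)\<^sup>2) < e / 2"
      using N[OF that] \<delta> by (simp add: pos_divide_less_eq mult.commute)
    moreover have "0 \<le> (LBINT x. \<bar>E x * d j x\<bar>)" by simp
    ultimately show ?thesis using bnd[of j] \<delta>A unfolding real_norm_def by linarith
  qed
  then show "\<exists>N. \<forall>j\<ge>N. norm ((LBINT x. \<bar>E x * d j x\<bar>) - 0) < e" by blast
qed

lemma sqint_AE_subseq:
  fixes w :: "'a::euclidean_space \<Rightarrow> real" and d :: "nat \<Rightarrow> 'a \<Rightarrow> real"
  assumes w: "\<And>j. sqint (d j)" and lim: "(\<lambda>j. LBINT x. (d j x)\<^sup>2) \<longlonglongrightarrow> 0"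
  shows "\<exists>r. strict_mono r \<and> (AE x in lborel. (\<lambda>j. d (r j) x) \<longlonglongrightarrow> 0)"
proof -
  have "\<exists>r::nat\<Rightarrow>nat. strict_mono r \<and> (AE x in lborel. (\<lambda>j. (d (r j) x)\<^sup>2) \<longlonglongrightarrow> 0)"
    using tendsto_L1_AE_subseq[of lborel "\<lambda>j x. (d j x)\<^sup>2"] w lim by (auto simp: sqint_def)
  then obtain r :: "nat \<Rightarrow> nat" where r: "strict_mono r" "AE x in lborel. (\<lambda>j. (d (r j) x)\<^sup>2) \<longlonglongrightarrow> 0" by blast
  have "AE x in lborel. (\<lambda>j. d (r j) x) \<longlonglongrightarrow> 0"
    using r(2)
  proof eventually_elim
    case (elim x)
    from tendsto_real_sqrt[OF this] show ?case by (simp add: tendsto_rabs_zero_iff)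
  qed
  with r show ?thesis by blast
qed

text \<open>Since \<open>p\<close> vanishes on \<open>{..\<epsilon>}\<close> and \<open>\<theta>\<close> vanishes at the boundary, \<open>p (\<theta> + \<sigma> \<phi>)\<close> has compact support for every \<open>\<phi>\<close> with
  compact support.\<close>

locale cutoff_data =
  fixes l r :: "'a::euclidean_space" and \<theta> :: "'a \<Rightarrow> real" and D\<theta> :: "'a \<Rightarrow> 'a \<Rightarrow> real"
    and p p' :: "real \<Rightarrow> real" and \<epsilon> M M' :: real
  assumes \<theta>: "continuous_on UNIV \<theta>" "\<And>x. x \<notin> box l r \<Longrightarrow> \<theta> x = 0"
    and D\<theta>: "\<And>b. b \<in> Basis \<Longrightarrow> continuous_on (box l r) (D\<theta> b)" "\<And>b x. \<bar>D\<theta> b x\<bar> \<le> M"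
      "\<And>b x. x \<notin> box l r \<Longrightarrow> D\<theta> b x = 0"
      "\<And>b x. b \<in> Basis \<Longrightarrow> x \<in> box l r \<Longrightarrow> ((\<lambda>h. \<theta> (x + h *\<^sub>R b)) has_real_derivative D\<theta> b x) (at 0)"
    and p: "\<And>s. (p has_real_derivative p' s) (at s)" "continuous_on UNIV p'" "\<And>s. \<bar>p s\<bar> \<le> 1" "\<And>s. \<bar>p' s\<bar> \<le> M'"
      "0 < \<epsilon>" "\<And>s. s \<le> \<epsilon> \<Longrightarrow> p s = 0" "\<And>s. s \<le> \<epsilon> \<Longrightarrow> p' s = 0"
begin

lemma p_cont: "continuous_on UNIV p"
  using p(1) by (meson DERIV_isCont continuous_at_imp_continuous_on)

lemma p'_weight: "\<bar>e * (p' s * h)\<bar> \<le> M' * \<bar>e * h\<bar>"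
  using mult_right_mono[OF p(4)[of s] abs_ge_zero[of "e * h"]] by (simp add: abs_mult mult.left_commute)

lemma C1c_cutoff:
  assumes C: "C1c (box l r) \<phi> D\<phi>"
  shows "C1c (box l r) (\<lambda>x. p (\<theta> x + \<sigma> * \<phi> x)) (\<lambda>b x. p' (\<theta> x + \<sigma> * \<phi> x) * (D\<theta> b x + \<sigma> * D\<phi> b x))"
proof -
  obtain K where K: "compact K" "K \<subseteq> box l r" "\<And>x. x \<notin> K \<Longrightarrow> \<phi> x = 0"
    using C unfolding C1c_def by blast
  have c: "continuous_on UNIV \<phi>" "\<And>b. b \<in> Basis \<Longrightarrow> continuous_on UNIV (D\<phi> b)"
    and d: "\<And>b x. b \<in> Basis \<Longrightarrow> ((\<lambda>h. \<phi> (x + h *\<^sub>R b)) has_real_derivative D\<phi> b x) (at 0)"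
    using C unfolding C1c_def by blast+
  \<comment> \<open>Off \<open>K'\<close> both \<open>\<phi> = 0\<close> and
    \<open>\<theta> \<le> \<epsilon>\<close> hold, so \<open>p\<close> and \<open>p'\<close> vanish
    there. The second part of \<open>K'\<close> avoids the boundary of the box because
    \<open>\<theta>\<close> is 0 outside the open box and \<open>\<epsilon>\<close> is
    positive.\<close>
  define K' where "K' = K \<union> (cbox l r \<inter> {x. \<epsilon> \<le> \<theta> x})"
  have "closed {x. \<epsilon> \<le> \<theta> x}" using \<theta>(1) by (intro closed_Collect_le continuous_intros) 
  then have K'c: "compact K'" unfolding K'_def using K(1) by (intro compact_Un compact_Int_closed) auto
  have K'sub: "K' \<subseteq> box l r" unfolding K'_def using K(2) \<theta>(2) p(5) by force
  have small: "\<theta> x + \<sigma> * \<phi> x \<le> \<epsilon>" if "x \<notin> K'" for x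
  proof -
    have "\<phi> x = 0" using that K(3) by (auto simp: K'_def)
    moreover have "\<theta> x \<le> \<epsilon>"
      using that \<theta>(2)[of x] p(5) box_subset_cbox[of l r] by (cases "x \<in> box l r") (auto simp: K'_def)
    ultimately show ?thesis by simp
  qed
  let ?q = "\<lambda>x. \<theta> x + \<sigma> * \<phi> x"
  have qc: "continuous_on UNIV ?q" by (intro continuous_intros \<theta> c)
  show ?thesis
    unfolding C1c_def
  proof (intro conjI ballI allI exI[of _ K'] impI)
    show "continuous_on UNIV (\<lambda>x. p (?q x))" by (intro continuous_on_compose2[OF p_cont qc]) auto
    fix b :: 'a assume b: "b \<in> Basis"
    \<comment> \<open>\<open>D\<theta>\<close> may be discontinuous at the boundary of the box, but
      the factor \<open>p'\<close> is 0 off \<open>K'\<close>; continuity inside the box therefore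
      suffices.\<close>
    show "continuous_on UNIV (\<lambda>x. p' (?q x) * (D\<theta> b x + \<sigma> * D\<phi> b x))"
    proof (rule continuous_zero_outside_compact[OF open_box[of l r] _ K'c K'sub])
      show "continuous_on (box l r) (\<lambda>x. p' (?q x) * (D\<theta> b x + \<sigma> * D\<phi> b x))"
        by (intro continuous_intros continuous_on_compose2[OF p(2)] continuous_on_subset[OF qc] D\<theta>(1)
            continuous_on_subset[OF c(2)] b) auto
    qed (use small p(7) in auto)
    fix x
    show "((\<lambda>h. p (?q (x + h *\<^sub>R b))) has_real_derivative p' (?q x) * (D\<theta> b x + \<sigma> * D\<phi> b x)) (at 0)"
    proof (cases "x \<in> box l r")
      case True
      have "((\<lambda>h. ?q (x + h *\<^sub>R b)) has_real_derivative D\<theta> b x + \<sigma> * D\<phi> b x) (at 0)"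
        by (intro DERIV_add DERIV_cmult d D\<theta>(4) b True)
      moreover have "(p has_real_derivative p' (?q x)) (at (?q (x + 0 *\<^sub>R b)))" using p(1) by simp
      ultimately show ?thesis by (rule DERIV_chain2[rotated])
    next
      case False
      have "\<forall>\<^sub>F h in nhds 0. x + h *\<^sub>R b \<in> - K'"
        using False K'sub K'c by (intro eventually_line_in_open open_Compl compact_imp_closed) auto
      then have "\<forall>\<^sub>F h in nhds 0. p (?q (x + h *\<^sub>R b)) = 0"
        using small p(6) by (auto elim!: eventually_mono)
      moreover have "p' (?q x) = 0" using False K'sub small p(7) by blast
      ultimately show ?thesis
        by (subst DERIV_cong_ev[OF refl _ refl, where g="\<lambda>_. 0"]) auto
    qed
  qed (use K'c K'sub small p(6,7) in auto)
qed

text \<open>With \<open>\<phi> j\<close> in place of \<open>w\<close> the composite is an admissible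
  test function. In the limit, convergence almost everywhere along a subsequence handles
  \<open>p\<close> and \<open>p'\<close> against the fixed integrands. The gradients converge only
  in \<open>L^2\<close>, so their error \<open>d\<close> is kept separate and paired with
  \<open>E\<close>.\<close>

lemma nonlinear_test:
  fixes \<phi> :: "nat \<Rightarrow> 'a \<Rightarrow> real" and D\<phi> :: "nat \<Rightarrow> 'a \<Rightarrow> 'a \<Rightarrow> real"
  assumes f: "integrable lborel f" and E: "\<And>b. b \<in> Basis \<Longrightarrow> sqint (E b)"
    and pairing: "\<And>\<eta> D. C1c (box l r) \<eta> D \<Longrightarrow> (LBINT x. f x * \<eta> x) = - (\<Sum>b\<in>Basis. LBINT x. E b x * D b x)"
    and \<phi>: "\<And>j. C1c (box l r) (\<phi> j) (D\<phi> j)"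
    and w: "sqint w" and G: "\<And>b. b \<in> Basis \<Longrightarrow> sqint (G b)"
    and lim: "(\<lambda>j. LBINT x. (w x - \<phi> j x)\<^sup>2) \<longlonglongrightarrow> 0"
      "\<And>b. b \<in> Basis \<Longrightarrow> (\<lambda>j. LBINT x. (G b x - D\<phi> j b x)\<^sup>2) \<longlonglongrightarrow> 0"
  shows "(LBINT x. f x * p (\<theta> x + \<sigma> * w x)) =
     - (\<Sum>b\<in>Basis. LBINT x. E b x * (p' (\<theta> x + \<sigma> * w x) * (D\<theta> b x + \<sigma> * G b x)))"
proof -
  have \<phi>s: "sqint (\<phi> j)" and D\<phi>s: "b \<in> Basis \<Longrightarrow> sqint (D\<phi> j b)" for j b
    using C1c_sqint[OF \<phi>[of j]] by auto
  obtain \<rho> :: "nat \<Rightarrow> nat" where \<rho>: "strict_mono \<rho>" "AE x in lborel. (\<lambda>j. w x - \<phi> (\<rho> j) x) \<longlonglongrightarrow> 0"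
    using sqint_AE_subseq[of "\<lambda>j x. w x - \<phi> j x", OF sqint_diff[OF w \<phi>s] lim(1)] by blast
  let ?q = "\<lambda>j x. \<theta> x + \<sigma> * \<phi> (\<rho> j) x" and ?qw = "\<lambda>x. \<theta> x + \<sigma> * w x"
  have qlim: "AE x in lborel. (\<lambda>j. ?q j x) \<longlonglongrightarrow> ?qw x"
    using \<rho>(2)
  proof eventually_elim
    case (elim x)
    have "(\<lambda>j. w x - (w x - \<phi> (\<rho> j) x)) \<longlonglongrightarrow> w x - 0" by (intro tendsto_diff tendsto_const elim)
    then have "(\<lambda>j. \<phi> (\<rho> j) x) \<longlonglongrightarrow> w x" by simp
    then show ?case by (intro tendsto_intros)
  qed
  note [measurable] = borel_measurable_integrable[OF f] borel_measurable_continuous_onI[OF \<theta>(1)]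
    borel_measurable_continuous_onI[OF p_cont] borel_measurable_continuous_onI[OF p(2)]
  have [measurable]: "\<phi> j \<in> borel_measurable borel" "w \<in> borel_measurable borel" for j
    using \<phi>s w by (auto simp: sqint_def)
  have lhs: "(\<lambda>j. LBINT x. f x * p (?q j x)) \<longlonglongrightarrow> (LBINT x. f x * p (?qw x))"
  proof (rule integral_dominated_convergence[where w="\<lambda>x. \<bar>f x\<bar>"])
    show "AE x in lborel. (\<lambda>j. f x * p (?q j x)) \<longlonglongrightarrow> f x * p (?qw x)"
      using qlim
    proof eventually_elim
      case (elim x)
      then show ?case by (intro tendsto_mult tendsto_const continuous_on_tendsto_compose[OF p_cont]) auto
    qed
    show "AE x in lborel. norm (f x * p (?q j x)) \<le> \<bar>f x\<bar>" for j
      using mult_left_mono[OF p(3) abs_ge_zero] by (auto simp: abs_mult)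
  qed (use f in auto)
  have rhs: "(\<lambda>j. LBINT x. E b x * (p' (?q j x) * (D\<theta> b x + \<sigma> * D\<phi> (\<rho> j) b x))) \<longlonglongrightarrow>
     (LBINT x. E b x * (p' (?qw x) * (D\<theta> b x + \<sigma> * G b x)))" if b: "b \<in> Basis" for b
  proof -
    have D\<theta>m: "D\<theta> b \<in> borel_measurable borel"
    proof -
      have "(\<lambda>x. indicator (box l r) x *\<^sub>R D\<theta> b x) \<in> borel_measurable borel"
        by (intro borel_measurable_continuous_on_indicator D\<theta>(1) b) simp
      moreover have "(\<lambda>x. indicator (box l r) x *\<^sub>R D\<theta> b x) = D\<theta> b"
        using D\<theta>(3)[of _ b] by (intro ext) (auto simp: indicator_def)
      ultimately show ?thesis by simp
    qed
    have D\<theta>s: "sqint (D\<theta> b)"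
      using sqint_bounded_support[OF D\<theta>m bounded_box[of l r] D\<theta>(3) D\<theta>(2)] by blast
    define H where "H x = D\<theta> b x + \<sigma> * G b x" for x
    have H: "sqint H" unfolding H_def[abs_def] by (intro sqint_add sqint_cmult D\<theta>s G b)
    define d where "d j x = G b x - D\<phi> (\<rho> j) b x" for j x
    have d: "sqint (d j)" for j unfolding d_def[abs_def] by (intro sqint_diff G D\<phi>s b)
    have dlim: "(\<lambda>j. LBINT x. (d j x)\<^sup>2) \<longlonglongrightarrow> 0"
      using LIMSEQ_subseq_LIMSEQ[OF lim(2)[OF b] \<rho>(1)] by (simp add: d_def o_def)
    have [measurable]: "E b \<in> borel_measurable borel" "H \<in> borel_measurable borel" "d j \<in> borel_measurable borel" for j
      using E[OF b] H d by (auto simp: sqint_def)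
    have M': "0 \<le> M'" using p(4)[of 0] by linarith
    have main: "(\<lambda>j. LBINT x. E b x * (p' (?q j x) * H x)) \<longlonglongrightarrow> (LBINT x. E b x * (p' (?qw x) * H x))"
    proof (rule integral_dominated_convergence[where w="\<lambda>x. M' * \<bar>E b x * H x\<bar>"])
      show "AE x in lborel. (\<lambda>j. E b x * (p' (?q j x) * H x)) \<longlonglongrightarrow> E b x * (p' (?qw x) * H x)"
        using qlim
      proof eventually_elim
        case (elim x)
        then show ?case by (intro tendsto_mult tendsto_const continuous_on_tendsto_compose[OF p(2)]) auto
      qed
      show "AE x in lborel. norm (E b x * (p' (?q j x) * H x)) \<le> M' * \<bar>E b x * H x\<bar>" for j
        using p'_weight by (auto simp del: abs_mult)
    qed (use sqint_mult[OF E[OF b] H] in auto)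
    have err: "(\<lambda>j. \<sigma> * (LBINT x. E b x * (p' (?q j x) * d j x))) \<longlonglongrightarrow> \<sigma> * 0"
    proof (intro tendsto_mult tendsto_const)
      have "norm (LBINT x. E b x * (p' (?q j x) * d j x)) \<le> M' * (LBINT x. \<bar>E b x * d j x\<bar>)" for j
      proof -
        have "norm (LBINT x. E b x * (p' (?q j x) * d j x)) \<le> (LBINT x. M' * \<bar>E b x * d j x\<bar>)"
          unfolding real_norm_def
          using sqint_mult[OF E[OF b] d[of j]] p'_weight
          by (intro abs_integral_le integrable_mult_right integrable_abs) blast+
        then show ?thesis by simp
      qed
      moreover have "(\<lambda>j. M' * (LBINT x. \<bar>E b x * d j x\<bar>)) \<longlonglongrightarrow> 0"
        using tendsto_mult_right_zero[OF sqint_pairing_tendsto_0[OF E[OF b] d dlim]] by simp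
      ultimately show "(\<lambda>j. LBINT x. E b x * (p' (?q j x) * d j x)) \<longlonglongrightarrow> 0"
        by (rule Lim_null_comparison[OF always_eventually[OF allI]])
    qed
    have i: "integrable lborel (\<lambda>x. E b x * (p' (?q j x) * h x))" if h: "sqint h" for h j
    proof (rule Bochner_Integration.integrable_bound[where f="\<lambda>x. M' * (E b x * h x)"])
      show "AE x in lborel. norm (E b x * (p' (?q j x) * h x)) \<le> norm (M' * (E b x * h x))"
        using p'_weight M' by (auto simp: abs_mult)
      have [measurable]: "h \<in> borel_measurable borel" using h by (simp add: sqint_def)
      show "(\<lambda>x. E b x * (p' (?q j x) * h x)) \<in> borel_measurable lborel" by measurable
    qed (use sqint_mult[OF E[OF b] h] in auto)
    have "(LBINT x. E b x * (p' (?q j x) * (D\<theta> b x + \<sigma> * D\<phi> (\<rho> j) b x))) =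
       (LBINT x. E b x * (p' (?q j x) * H x)) - \<sigma> * (LBINT x. E b x * (p' (?q j x) * d j x))" for j
    proof -
      have "(LBINT x. E b x * (p' (?q j x) * (D\<theta> b x + \<sigma> * D\<phi> (\<rho> j) b x))) =
        (LBINT x. E b x * (p' (?q j x) * H x) - \<sigma> * (E b x * (p' (?q j x) * d j x)))"
        by (intro Bochner_Integration.integral_cong) (auto simp: H_def d_def algebra_simps)
      then show ?thesis using i[OF H] i[OF d] by simp
    qed
    then show ?thesis using tendsto_diff[OF main err] by (simp add: H_def)
  qed
  have "(\<lambda>j. LBINT x. f x * p (?q j x)) \<longlonglongrightarrow>
     - (\<Sum>b\<in>Basis. LBINT x. E b x * (p' (?qw x) * (D\<theta> b x + \<sigma> * G b x)))"
    unfolding pairing[OF C1c_cutoff[OF \<phi>]] by (intro tendsto_minus tendsto_sum rhs)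
  with lhs show ?thesis by (rule LIMSEQ_unique)
qed

end

section \<open>Comparison on a time slice\<close>

lemma bump_bounded: "\<exists>M. \<forall>x. \<bar>bump x\<bar> \<le> M"
  using continuous_compact_support_bounded(1)[of bump "{0..1}"] smooth_real_cont[OF bump_smooth] bump_outside
  by auto

text \<open>The shift by \<open>- 1\<close> delays the rise to \<open>1 / (n + 1)\<close>. This is
  the strictly positive threshold that \<open>cutoff_data\<close> demands, and it still leaves the
  indicator of the open half line in the limit.\<close>

definition ramp :: "nat \<Rightarrow> real \<Rightarrow> real" where
  "ramp n s = smooth_step (real (Suc n) * s - 1)"

definition ramp' :: "nat \<Rightarrow> real \<Rightarrow> real" where
  "ramp' n s = real (Suc n) * bump (real (Suc n) * s - 1)"

lemma ramp_DERIV: "(ramp n has_real_derivative ramp' n s) (at s)"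
proof -
  have "((\<lambda>s. real (Suc n) * s - 1) has_real_derivative real (Suc n)) (at s)"
    by (auto intro!: derivative_eq_intros)
  from DERIV_chain2[OF smooth_step_DERIV this] show ?thesis
    unfolding ramp_def[abs_def] ramp'_def by (simp add: mult.commute)
qed

lemma ramp'_nonneg: "0 \<le> ramp' n s"
  unfolding ramp'_def by (simp add: bump_nonneg)

lemma ramp_zero:
  assumes "s \<le> 1 / real (Suc n)" shows "ramp n s = 0" "ramp' n s = 0"
proof -
  have "real (Suc n) * s - 1 \<le> 0" using mult_left_mono[OF assms, of "real (Suc n)"] by simp
  \<comment> \<open>\<open>bump_outside\<close> does not cover the end point 0; the value there
    comes from continuity along negative arguments.\<close>
  moreover have "bump 0 = 0"
  proof -
    have "(\<lambda>k. bump (- (1 / real (Suc k)))) \<longlonglongrightarrow> bump (- 0)"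
      by (intro continuous_on_tendsto_compose[OF smooth_real_cont[OF bump_smooth, of UNIV]] tendsto_minus
          LIMSEQ_Suc[OF lim_const_over_n]) auto
    moreover have "bump (- (1 / real (Suc k))) = 0" for k by (intro bump_outside) simp
    ultimately show ?thesis by (simp add: LIMSEQ_const_iff)
  qed
  moreover have "bump y = 0" if "y < 0" for y using that by (intro bump_outside) auto
  ultimately have "bump (real (Suc n) * s - 1) = 0" "smooth_step (real (Suc n) * s - 1) = 0"
    by (metis order_le_less, intro smooth_step_simps)
  then show "ramp n s = 0" "ramp' n s = 0" by (simp_all only: ramp_def ramp'_def mult_zero_right)
qed

lemma ramp_limit: "(\<lambda>n. ramp n s) \<longlonglongrightarrow> indicator {0<..} s"
proof (cases "0 < s")
  case True
  have "\<forall>\<^sub>F n in sequentially. ramp n s = indicator {0<..} s"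
    using eventually_real_ge[of "2 / s"]
  proof eventually_elim
    case (elim n)
    then have "2 \<le> real (Suc n) * s" using True by (simp add: pos_divide_le_eq)
    then show ?case using True unfolding ramp_def by (simp add: smooth_step_simps)
  qed
  then show ?thesis by (rule tendsto_eventually)
next
  case False
  then have "ramp n s = 0" for n
    by (intro ramp_zero(1)) (auto intro: order_trans[of s 0])
  then show ?thesis using False by simp
qed

lemma cutoff_data_ramp:
  assumes "continuous_on UNIV \<theta>" "\<And>x. x \<notin> box l r \<Longrightarrow> \<theta> x = 0"
    "\<And>b. b \<in> Basis \<Longrightarrow> continuous_on (box l r) (D\<theta> b)" "\<And>b x. \<bar>D\<theta> b x\<bar> \<le> M"
      "\<And>b x. x \<notin> box l r \<Longrightarrow> D\<theta> b x = 0"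
      "\<And>b x. b \<in> Basis \<Longrightarrow> x \<in> box l r \<Longrightarrow> ((\<lambda>h. \<theta> (x + h *\<^sub>R b)) has_real_derivative D\<theta> b x) (at 0)"
  shows "\<exists>M'. cutoff_data l r \<theta> D\<theta> (ramp n) (ramp' n) (1 / real (Suc n)) M M'"
proof -
  obtain B where B: "\<And>x. \<bar>bump x\<bar> \<le> B" using bump_bounded by blast
  have "cutoff_data l r \<theta> D\<theta> (ramp n) (ramp' n) (1 / real (Suc n)) M (real (Suc n) * B)"
  proof
    show "continuous_on UNIV (ramp' n)"
      unfolding ramp'_def[abs_def]
      by (intro continuous_intros continuous_on_compose2[OF smooth_real_cont[OF bump_smooth, of UNIV]]) auto
    show "\<bar>ramp n s\<bar> \<le> 1" for s using smooth_step_bounds by (simp add: ramp_def abs_le_iff del: of_nat_Suc)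
    show "\<bar>ramp' n s\<bar> \<le> real (Suc n) * B" for s
      unfolding ramp'_def abs_mult using B by (simp add: mult_left_mono del: of_nat_Suc)
  qed (use assms ramp_DERIV ramp_zero in auto)
  then show ?thesis by blast
qed

lemma ramp_integral_limit:
  assumes f: "integrable lborel f" and q: "q \<in> borel_measurable borel"
  shows "(\<lambda>n. LBINT x. f x * ramp n (q x)) \<longlonglongrightarrow> (LBINT x. f x * indicator {0<..} (q x))"
proof -
  have [measurable]: "ramp n \<in> borel_measurable borel" for n
    by (intro borel_measurable_continuous_onI continuous_at_imp_continuous_on ballI DERIV_isCont[OF ramp_DERIV])
  note [measurable] = q borel_measurable_integrable[OF f]
  show ?thesis
  proof (rule integral_dominated_convergence[where w="\<lambda>x. \<bar>f x\<bar>"])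
    show "AE x in lborel. (\<lambda>n. f x * ramp n (q x)) \<longlonglongrightarrow> f x * indicator {0<..} (q x)"
      by (intro AE_I2 tendsto_mult tendsto_const ramp_limit)
    show "AE x in lborel. norm (f x * ramp n (q x)) \<le> \<bar>f x\<bar>" for n
      using mult_left_mono[of "\<bar>ramp n _\<bar>" 1 "\<bar>f _\<bar>"] smooth_step_bounds
      by (auto simp: abs_mult ramp_def)
  qed (use f in auto)
qed

text \<open>The approximants \<open>\<phi>\<close> encode the zero boundary values of
  \<open>w\<close>. They are kept as data because nonlinear composition yields a test function of
  compact support for them, but not for \<open>w\<close> itself.\<close>

locale slice_data =
  fixes l r :: "'a::euclidean_space" and f w :: "'a \<Rightarrow> real" and G :: "'a \<Rightarrow> 'a \<Rightarrow> real"
    and \<phi> :: "nat \<Rightarrow> 'a \<Rightarrow> real" and D\<phi> :: "nat \<Rightarrow> 'a \<Rightarrow> 'a \<Rightarrow> real"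
  assumes f: "integrable lborel f" and w: "sqint w" and G: "\<And>b. b \<in> Basis \<Longrightarrow> sqint (G b)"
    and pairing: "\<And>\<eta> D. C1c (box l r) \<eta> D \<Longrightarrow> (LBINT x. f x * \<eta> x) = - (\<Sum>b\<in>Basis. LBINT x. G b x * D b x)"
    and \<phi>: "\<And>j. C1c (box l r) (\<phi> j) (D\<phi> j)"
    and lim: "(\<lambda>j. LBINT x. (w x - \<phi> j x)\<^sup>2) \<longlonglongrightarrow> 0"
      "\<And>b. b \<in> Basis \<Longrightarrow> (\<lambda>j. LBINT x. (G b x - D\<phi> j b x)\<^sup>2) \<longlonglongrightarrow> 0"
begin

text \<open>Here \<open>f\<close> is the weak Laplacian and \<open>G\<close> the weak gradient of \<open>w\<close>.\<close>

lemma integral_laplacian_pos_set: "(LBINT x. f x * indicator {0<..} (w x)) \<le> 0"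
proof -
  have "(LBINT x. f x * ramp n (w x)) \<le> 0" for n
  proof -
    \<comment> \<open>With \<open>\<theta> = 0\<close> and \<open>\<sigma> = 1\<close> the test
      function is \<open>ramp n\<close> of \<open>w\<close>, and the right-hand side becomes minus
      the integral of \<open>ramp' n w\<close> times the squared gradient.\<close>
    obtain M' where "cutoff_data l r (\<lambda>_. 0) (\<lambda>_ _. 0) (ramp n) (ramp' n) (1 / real (Suc n)) 0 M'"
      using cutoff_data_ramp[of "\<lambda>_. 0" l r "\<lambda>_ _. 0" 0 n] by auto
    then interpret cutoff_data l r "\<lambda>_. 0" "\<lambda>_ _. 0" "ramp n" "ramp' n" "1 / real (Suc n)" 0 M' .
    have "0 \<le> (\<Sum>b\<in>Basis. LBINT x. G b x * (ramp' n (w x) * G b x))"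
      by (intro sum_nonneg integral_nonneg_AE AE_I2)
        (simp add: ramp'_nonneg mult.left_commute[of "G _ _" "ramp' n _"])
    then show ?thesis using nonlinear_test[OF f G pairing \<phi> w G lim, where \<sigma>=1] by simp
  qed
  moreover have "(\<lambda>n. LBINT x. f x * ramp n (w x)) \<longlonglongrightarrow> (LBINT x. f x * indicator {0<..} (w x))"
    using w by (intro ramp_integral_limit f) (simp add: sqint_def)
  ultimately show ?thesis by (intro LIMSEQ_le_const2) auto
qed

end

text \<open>A smooth slice extended by zero from the open box: \<open>v\<close> stays continuous on
  the whole space, whereas \<open>Dv\<close> and \<open>DDv\<close> are merely bounded there and may
  jump at the boundary.\<close>

locale smooth_slice =
  fixes l r :: "'a::euclidean_space" and v :: "'a \<Rightarrow> real" and Dv DDv :: "'a \<Rightarrow> 'a \<Rightarrow> real" and M :: real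
  assumes v: "continuous_on UNIV v" "\<And>x. x \<notin> box l r \<Longrightarrow> v x = 0"
    and Dv: "\<And>b. b \<in> Basis \<Longrightarrow> continuous_on (box l r) (Dv b)" "\<And>b x. \<bar>Dv b x\<bar> \<le> M"
      "\<And>b x. x \<notin> box l r \<Longrightarrow> Dv b x = 0"
      "\<And>b x. b \<in> Basis \<Longrightarrow> x \<in> box l r \<Longrightarrow> ((\<lambda>h. v (x + h *\<^sub>R b)) has_real_derivative Dv b x) (at 0)"
    and DDv: "\<And>b. b \<in> Basis \<Longrightarrow> continuous_on (box l r) (DDv b)" "\<And>b x. \<bar>DDv b x\<bar> \<le> M"
      "\<And>b x. x \<notin> box l r \<Longrightarrow> DDv b x = 0"
      "\<And>b x. b \<in> Basis \<Longrightarrow> x \<in> box l r \<Longrightarrow> ((\<lambda>h. Dv b (x + h *\<^sub>R b)) has_real_derivative DDv b x) (at 0)"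
begin

lemma v_bounded: "\<exists>B. \<forall>x. \<bar>v x\<bar> \<le> B"
  by (rule continuous_compact_support_bounded(1)[OF v(1) compact_cbox[of l r]])
    (use v(2) box_subset_cbox[of l r] in blast)

text \<open>Inside the box this is the Laplacian of \<open>v^2\<close>, written as the divergence of
  the flux \<open>2 * v * Dv b\<close> with the product rule carried out.\<close>

definition L :: "'a \<Rightarrow> real" where
  "L x = (\<Sum>b\<in>Basis. 2 * (Dv b x)\<^sup>2 + 2 * v x * DDv b x)"

lemma measurable_zero_ext:
  assumes "continuous_on (box l r) g" "\<And>x. x \<notin> box l r \<Longrightarrow> g x = (0::real)"
  shows "g \<in> borel_measurable borel"
proof -
  have "(\<lambda>x. indicator (box l r) x *\<^sub>R g x) \<in> borel_measurable borel"
    by (intro borel_measurable_continuous_on_indicator assms) simp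
  moreover have "(\<lambda>x. indicator (box l r) x *\<^sub>R g x) = g"
    using assms(2) by (intro ext) (auto simp: indicator_def)
  ultimately show ?thesis by simp
qed

lemma Dv_meas: "b \<in> Basis \<Longrightarrow> Dv b \<in> borel_measurable borel"
  and DDv_meas: "b \<in> Basis \<Longrightarrow> DDv b \<in> borel_measurable borel"
  by (intro measurable_zero_ext Dv DDv; simp)+

lemma v_meas: "v \<in> borel_measurable borel"
  using v(1) by (rule borel_measurable_continuous_onI)

text \<open>At points outside the open box \<open>v\<close> tends to 0 while \<open>Dv b\<close>
  stays bounded, so the product is continuous across the boundary even where \<open>Dv b\<close>
  jumps.\<close>

lemma flux_continuous: "b \<in> Basis \<Longrightarrow> continuous_on UNIV (\<lambda>x. c * v x * Dv b x)"
proof -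
  assume b: "b \<in> Basis"
  have "isCont (\<lambda>x. c * v x * Dv b x) x" for x
  proof (cases "x \<in> box l r")
    case True
    have "continuous_on (box l r) (\<lambda>x. c * v x * Dv b x)"
      by (intro continuous_intros continuous_on_subset[OF v(1)] Dv b) auto
    then show ?thesis using True open_box continuous_on_eq_continuous_at by blast
  next
    case False
    have "(v \<longlongrightarrow> v x) (at x)" using v(1) by (simp add: continuous_on_def)
    then have "((\<lambda>y. \<bar>c\<bar> * \<bar>v y\<bar> * M) \<longlongrightarrow> \<bar>c\<bar> * \<bar>v x\<bar> * M) (at x)" by (intro tendsto_intros)
    then have "((\<lambda>y. \<bar>c\<bar> * \<bar>v y\<bar> * M) \<longlongrightarrow> 0) (at x)" using v(2)[OF False] by simp
    then have "((\<lambda>x. c * v x * Dv b x) \<longlongrightarrow> 0) (at x)"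
      by (rule Lim_null_comparison[rotated]) (auto simp: abs_mult intro!: always_eventually mult_left_mono Dv(2))
    then show ?thesis using v(2)[OF False] by (simp add: isCont_def)
  qed
  then show ?thesis by (simp add: continuous_at_imp_continuous_on)
qed

lemma flux_deriv:
  "b \<in> Basis \<Longrightarrow> x \<in> box l r \<Longrightarrow>
    ((\<lambda>h. 2 * v (x + h *\<^sub>R b) * Dv b (x + h *\<^sub>R b)) has_real_derivative 2 * (Dv b x)\<^sup>2 + 2 * v x * DDv b x) (at 0)"
  using DERIV_mult[OF DERIV_cmult[OF Dv(4), of b x 2] DDv(4), of b x]
  by (simp add: power2_eq_square mult_ac)

lemma flux_deriv_bound: "\<exists>B. \<forall>b x. \<bar>2 * (Dv b x)\<^sup>2 + 2 * v x * DDv b x\<bar> \<le> B"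
proof -
  obtain B where B: "\<And>x. \<bar>v x\<bar> \<le> B" using v_bounded by blast
  have "\<bar>2 * (Dv b x)\<^sup>2 + 2 * v x * DDv b x\<bar> \<le> 2 * M\<^sup>2 + 2 * B * M" for b x
  proof -
    have "(Dv b x)\<^sup>2 \<le> M\<^sup>2" using power_mono[OF Dv(2)[of b x] abs_ge_zero, of 2] by simp
    moreover have "\<bar>v x * DDv b x\<bar> \<le> B * M" unfolding abs_mult using B[of x] DDv(2)[of b x]
      by (intro mult_mono) (auto intro: order_trans[OF abs_ge_zero])
    moreover have "2 * v x * DDv b x = 2 * (v x * DDv b x)" "2 * B * M = 2 * (B * M)" by simp_all
    ultimately show ?thesis using zero_le_power2[of "Dv b x"] unfolding abs_le_iff by linarith
  qed
  then show ?thesis by blast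
qed

text \<open>The integrand is the derivative along \<open>b\<close> of the flux, which is continuous
  and vanishes outside the open box. This is where the Dirichlet condition on the competitor removes
  the boundary term.\<close>

lemma flux_deriv_integral:
  assumes b: "b \<in> Basis"
  shows "integrable lborel (\<lambda>x. 2 * (Dv b x)\<^sup>2 + 2 * v x * DDv b x)"
    "(LBINT x. 2 * (Dv b x)\<^sup>2 + 2 * v x * DDv b x) = 0"
proof -
  obtain B where B: "\<And>b x. \<bar>2 * (Dv b x)\<^sup>2 + 2 * v x * DDv b x\<bar> \<le> B" using flux_deriv_bound by blast
  note [measurable] = Dv_meas[OF b] DDv_meas[OF b] v_meas
  note * = integral_partial_zero[where F="\<lambda>x. 2 * v x * Dv b x" and e=b and M=B and l=l and r=r
      and D="\<lambda>x. 2 * (Dv b x)\<^sup>2 + 2 * v x * DDv b x", OF flux_continuous[OF b] _ _ flux_deriv[OF b] B]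
  show "integrable lborel (\<lambda>x. 2 * (Dv b x)\<^sup>2 + 2 * v x * DDv b x)"
    using v Dv by (intro *(1)) auto
  show "(LBINT x. 2 * (Dv b x)\<^sup>2 + 2 * v x * DDv b x) = 0"
    using v Dv by (intro *(2)) auto
qed

lemma L_integral: "integrable lborel L" "(LBINT x. L x) = 0"
proof -
  show "integrable lborel L"
    unfolding L_def[abs_def] by (intro Bochner_Integration.integrable_sum flux_deriv_integral)
  have "(LBINT x. L x) = (\<Sum>b\<in>Basis. LBINT x. 2 * (Dv b x)\<^sup>2 + 2 * v x * DDv b x)"
    unfolding L_def by (intro Bochner_Integration.integral_sum flux_deriv_integral)
  also have "\<dots> = 0" by (rule sum.neutral, rule ballI, rule flux_deriv_integral(2))
  finally show "(LBINT x. L x) = 0" .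
qed

text \<open>The divergence of flux times \<open>\<eta>\<close> integrates to zero direction by
  direction; the compact support of \<open>\<eta>\<close> makes each product continuous on the whole
  space.\<close>

lemma L_pairing:
  assumes C: "C1c (box l r) \<eta> D"
  shows "(LBINT x. L x * \<eta> x) = - (\<Sum>b\<in>Basis. LBINT x. 2 * v x * Dv b x * D b x)"
proof -
  obtain K where K: "compact K" "K \<subseteq> box l r" "\<And>x. x \<notin> K \<Longrightarrow> \<eta> x = 0" "\<And>x b. x \<notin> K \<Longrightarrow> b \<in> Basis \<Longrightarrow> D b x = 0"
    using C unfolding C1c_def by blast
  have c: "continuous_on UNIV \<eta>" "\<And>b. b \<in> Basis \<Longrightarrow> continuous_on UNIV (D b)"
    and d: "\<And>b x. b \<in> Basis \<Longrightarrow> ((\<lambda>h. \<eta> (x + h *\<^sub>R b)) has_real_derivative D b x) (at 0)"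
    using C unfolding C1c_def by blast+
  have main: "integrable lborel (\<lambda>x. (2 * (Dv b x)\<^sup>2 + 2 * v x * DDv b x) * \<eta> x)"
    "(LBINT x. (2 * (Dv b x)\<^sup>2 + 2 * v x * DDv b x) * \<eta> x) = - (LBINT x. 2 * v x * Dv b x * D b x)"
    if b: "b \<in> Basis" for b
  proof -
    let ?F = "\<lambda>x. 2 * v x * Dv b x" and ?F' = "\<lambda>x. 2 * (Dv b x)\<^sup>2 + 2 * v x * DDv b x"
    have F'c: "continuous_on (box l r) ?F'"
      by (intro continuous_intros continuous_on_subset[OF v(1)] Dv DDv b) auto
    have c1: "continuous_on UNIV (\<lambda>x. ?F' x * \<eta> x)"
      by (rule continuous_zero_outside_compact[OF open_box[of l r] _ K(1,2)])
        (use K(3) in \<open>auto intro!: continuous_intros F'c intro: continuous_on_subset[OF c(1)]\<close>)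
    have c2: "continuous_on UNIV (\<lambda>x. ?F x * D b x)" by (intro continuous_on_mult flux_continuous[OF b] c(2)[OF b])
    have i: "integrable lborel (\<lambda>x. ?F' x * \<eta> x)" "integrable lborel (\<lambda>x. ?F x * D b x)"
      using K b by (intro continuous_compact_support_bounded(2)[OF c1 K(1)] continuous_compact_support_bounded(2)[OF c2 K(1)]; simp)+
    let ?D = "\<lambda>x. ?F' x * \<eta> x + D b x * ?F x"
    have cD: "continuous_on UNIV ?D"
      using continuous_on_add[OF c1 c2] by (simp add: mult.commute)
    have DK: "?D x = 0" if "x \<notin> K" for x using K that b by simp
    obtain B where B: "\<And>x. \<bar>?D x\<bar> \<le> B"
      using continuous_compact_support_bounded(1)[OF cD K(1) DK] by blast
    have "(LBINT x. ?D x) = 0"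
    proof (rule integral_partial_zero(2)[where F="\<lambda>x. ?F x * \<eta> x" and e=b and M=B and l=l and r=r])
      show "continuous_on UNIV (\<lambda>x. ?F x * \<eta> x)" by (intro continuous_on_mult flux_continuous[OF b] c)
      show "((\<lambda>h. ?F (x + h *\<^sub>R b) * \<eta> (x + h *\<^sub>R b)) has_real_derivative ?D x) (at 0)" if "x \<in> box l r" for x
        using DERIV_mult[OF flux_deriv[OF b that] d[OF b, of x]] by simp
      show "?D \<in> borel_measurable borel" using cD by (rule borel_measurable_continuous_onI)
      show "?D x = 0" if "x \<notin> box l r" for x using DK K(2) that by blast
    qed (use v(2) B in auto)
    then show "(LBINT x. ?F' x * \<eta> x) = - (LBINT x. ?F x * D b x)"
      using i by (simp add: mult.commute[of "D b _"])
    show "integrable lborel (\<lambda>x. ?F' x * \<eta> x)" by (rule i)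
  qed
  have "(LBINT x. L x * \<eta> x) = (\<Sum>b\<in>Basis. LBINT x. (2 * (Dv b x)\<^sup>2 + 2 * v x * DDv b x) * \<eta> x)"
    unfolding L_def sum_distrib_right by (intro Bochner_Integration.integral_sum main)
  then show ?thesis using main by (simp add: sum_negf)
qed

end

locale slice_comparison = slice_data + smooth_slice +
  assumes w_nonneg: "AE x in lborel. 0 \<le> w x"
begin

text \<open>Where \<open>(max v 0)\<^sup>2 > w \<ge> 0\<close> one has \<open>v > 0\<close>, so there the gradient of \<open>(max v 0)\<^sup>2\<close> is that of \<open>v\<^sup>2\<close>, and the pairing with the
  test function becomes a sum of squares.\<close>

lemma comparison: "(LBINT x. (L x - f x) * indicator {0<..} ((max (v x) 0)\<^sup>2 - w x)) \<le> 0"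
proof -
  \<comment> \<open>The square of the positive part is used instead of \<open>v^2\<close>, since
    \<open>v^2 > w\<close> would also hold where \<open>v\<close> is very negative. Moreover
    \<open>(max s 0)^2\<close> is continuously differentiable, so \<open>\<theta>\<close> qualifies
    for \<open>cutoff_data\<close>.\<close>
  define \<theta> where "\<theta> x = (max (v x) 0)\<^sup>2" for x
  define D\<theta> where "D\<theta> b x = 2 * max (v x) 0 * Dv b x" for b x
  obtain B where B: "\<And>x. \<bar>v x\<bar> \<le> B" using v_bounded by blast
  have sq_deriv: "((\<lambda>s. (max s 0)\<^sup>2) has_real_derivative 2 * max s 0) (at s)" for s :: real
  proof -
    consider "s < 0" | "s = 0" | "0 < s" by linarith
    then show ?thesis
    proof cases
      case 1
      have "\<forall>\<^sub>F y in nhds s. (max y 0)\<^sup>2 = 0"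
        using eventually_nhds_in_open[of "{..<0}" s] 1 by (auto elim!: eventually_mono)
      then show ?thesis using 1 by (subst DERIV_cong_ev[OF refl _ refl, where g="\<lambda>_. 0"]) auto
    next
      case 3
      have "\<forall>\<^sub>F y in nhds s. (max y 0)\<^sup>2 = y\<^sup>2"
        using eventually_nhds_in_open[of "{0<..}" s] 3 by (auto elim!: eventually_mono)
      then show ?thesis using 3
        by (subst DERIV_cong_ev[OF refl _ refl, where g="\<lambda>y. y\<^sup>2"]) (auto intro!: derivative_eq_intros)
    next
      case 2
      have "((\<lambda>h. \<bar>h\<bar>) \<longlongrightarrow> 0) (at (0::real))" by (rule tendsto_rabs_zero[OF tendsto_ident_at])
      moreover have "norm ((max h 0)\<^sup>2 / h) \<le> \<bar>h\<bar>" for h :: real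
        by (simp add: max_def power2_eq_square)
      ultimately have "((\<lambda>h. (max h 0)\<^sup>2 / h) \<longlongrightarrow> 0) (at (0::real))"
        by (rule Lim_null_comparison[OF always_eventually[OF allI], rotated])
      then show ?thesis using 2 by (simp add: DERIV_def)
    qed
  qed
  have \<theta>D: "((\<lambda>h. \<theta> (x + h *\<^sub>R b)) has_real_derivative D\<theta> b x) (at 0)" if "b \<in> Basis" "x \<in> box l r" for b x
  proof -
    have "((\<lambda>s. (max s 0)\<^sup>2) has_real_derivative 2 * max (v x) 0) (at (v (x + 0 *\<^sub>R b)))"
      using sq_deriv by simp
    from DERIV_chain2[OF this Dv(4)[OF that]] show ?thesis unfolding \<theta>_def D\<theta>_def .
  qed
  have \<theta>c: "continuous_on UNIV \<theta>" unfolding \<theta>_def by (intro continuous_intros v)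
  have D\<theta>c: "continuous_on (box l r) (D\<theta> b)" if "b \<in> Basis" for b
    unfolding D\<theta>_def by (intro continuous_intros continuous_on_subset[OF v(1)] Dv that) auto
  have D\<theta>b: "\<bar>D\<theta> b x\<bar> \<le> 2 * B * M" for b x
  proof -
    have "\<bar>max (v x) 0\<bar> * \<bar>Dv b x\<bar> \<le> B * M"
      using B[of x] Dv(2)[of b x] by (intro mult_mono) auto
    then show ?thesis by (simp add: D\<theta>_def abs_mult)
  qed
  \<comment> \<open>\<open>E\<close> is the gradient of \<open>v^2 - w\<close> and belongs to the
    Laplacian \<open>L - f\<close>, whereas the test function is built from
    \<open>\<theta> - w\<close>. The two gradients agree where \<open>v > 0\<close>, hence wherever
    \<open>ramp'\<close> is nonzero.\<close>
  define E where "E b x = 2 * v x * Dv b x - G b x" for b x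
  have fx: "sqint (\<lambda>x. 2 * v x * Dv b x)" if b: "b \<in> Basis" for b
  proof (rule sqint_bounded_support[where S="box l r" and M="2 * B * M"])
    note [measurable] = Dv_meas[OF b] v_meas
    show "(\<lambda>x. 2 * v x * Dv b x) \<in> borel_measurable borel" by measurable
    show "\<bar>2 * v x * Dv b x\<bar> \<le> 2 * B * M" for x
      using mult_mono[OF B[of x] Dv(2)[of b x]] B[of x] by (simp add: abs_mult)
  qed (use v(2) in \<open>auto simp: bounded_box\<close>)
  have E: "sqint (E b)" if "b \<in> Basis" for b
    unfolding E_def[abs_def] by (intro sqint_diff fx G that)
  have E_pair: "(LBINT x. (L x - f x) * \<eta> x) = - (\<Sum>b\<in>Basis. LBINT x. E b x * D b x)"
    if C: "C1c (box l r) \<eta> D" for \<eta> D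
  proof -
    obtain K where K: "compact K" "\<And>x. x \<notin> K \<Longrightarrow> \<eta> x = 0" "\<And>x b. x \<notin> K \<Longrightarrow> b \<in> Basis \<Longrightarrow> D b x = 0"
      using C unfolding C1c_def by blast
    have c: "continuous_on UNIV \<eta>" "\<And>b. b \<in> Basis \<Longrightarrow> continuous_on UNIV (D b)"
      using C unfolding C1c_def by blast+
    obtain m where m: "\<And>x. \<bar>\<eta> x\<bar> \<le> m" using continuous_compact_support_bounded(1)[OF c(1) K(1,2)] by blast
    have i: "integrable lborel (\<lambda>x. g x * \<eta> x)" if g: "integrable lborel g" for g
    proof (rule Bochner_Integration.integrable_bound[where f="\<lambda>x. g x * m"])
      note [measurable] = borel_measurable_integrable[OF g] borel_measurable_continuous_onI[OF c(1)]
      show "(\<lambda>x. g x * \<eta> x) \<in> borel_measurable lborel" by measurable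
      have "\<bar>\<eta> x\<bar> \<le> \<bar>m\<bar>" for x using m[of x] by linarith
      then show "AE x in lborel. norm (g x * \<eta> x) \<le> norm (g x * m)" by (auto simp: abs_mult intro!: mult_left_mono)
    qed (use g in auto)
    have Ds: "sqint (D b)" if "b \<in> Basis" for b using C1c_sqint(2)[OF C that] .
    have "(LBINT x. (L x - f x) * \<eta> x) = (LBINT x. L x * \<eta> x) - (LBINT x. f x * \<eta> x)"
      using i[OF L_integral(1)] i[OF f] by (simp add: left_diff_distrib)
    also have "\<dots> = - (\<Sum>b\<in>Basis. (LBINT x. 2 * v x * Dv b x * D b x) - (LBINT x. G b x * D b x))"
      unfolding L_pairing[OF C] pairing[OF C] by (simp add: sum_subtractf)
    also have "\<dots> = - (\<Sum>b\<in>Basis. LBINT x. E b x * D b x)"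
    proof -
      have "(LBINT x. 2 * v x * Dv b x * D b x) - (LBINT x. G b x * D b x) = (LBINT x. E b x * D b x)"
        if b: "b \<in> Basis" for b
        unfolding E_def left_diff_distrib
        by (rule Bochner_Integration.integral_diff[symmetric]) (intro sqint_mult fx G Ds b)+
      then show ?thesis by simp
    qed
    finally show ?thesis .
  qed
  have Lf: "integrable lborel (\<lambda>x. L x - f x)" using L_integral f by simp
  have le: "(LBINT x. (L x - f x) * ramp n (\<theta> x + (- 1) * w x)) \<le> 0" for n
  proof -
    have "\<exists>M'. cutoff_data l r \<theta> D\<theta> (ramp n) (ramp' n) (1 / real (Suc n)) (2 * B * M) M'"
      by (rule cutoff_data_ramp[OF \<theta>c _ D\<theta>c D\<theta>b _ \<theta>D]) (use v(2) in \<open>auto simp: \<theta>_def D\<theta>_def\<close>)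
    then obtain M' where "cutoff_data l r \<theta> D\<theta> (ramp n) (ramp' n) (1 / real (Suc n)) (2 * B * M) M'" by blast
    then interpret c: cutoff_data l r \<theta> D\<theta> "ramp n" "ramp' n" "1 / real (Suc n)" "2 * B * M" M' .
    have "0 \<le> (LBINT x. E b x * (ramp' n (\<theta> x + (- 1) * w x) * (D\<theta> b x + (- 1) * G b x)))" for b
    proof (rule integral_nonneg_AE)
      show "AE x in lborel. 0 \<le> E b x * (ramp' n (\<theta> x + (- 1) * w x) * (D\<theta> b x + (- 1) * G b x))"
        using w_nonneg
      proof eventually_elim
        case (elim x)
        show ?case
        proof (cases "0 < \<theta> x - w x")
          case True
          then have "0 < v x" using elim by (cases "0 < v x") (auto simp: \<theta>_def)
          then have "D\<theta> b x + (- 1) * G b x = E b x" by (simp add: D\<theta>_def E_def)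
          then show ?thesis by (simp only:) (simp add: ramp'_nonneg mult.left_commute[of "E b x"])
        next
          case False
          then have "\<theta> x + (- 1) * w x \<le> 1 / real (Suc n)" by (auto intro: order_trans[of _ 0])
          then show ?thesis by (simp only: ramp_zero(2) mult_zero_left mult_zero_right order_refl)
        qed
      qed
    qed
    then have "0 \<le> (\<Sum>b\<in>Basis. LBINT x. E b x * (ramp' n (\<theta> x + (- 1) * w x) * (D\<theta> b x + (- 1) * G b x)))"
      by (intro sum_nonneg)
    then show ?thesis
      using c.nonlinear_test[OF Lf E E_pair \<phi> w G lim, where \<sigma>="-1"] by linarith
  qed
  have "(\<lambda>n. LBINT x. (L x - f x) * ramp n (\<theta> x + (- 1) * w x)) \<longlonglongrightarrow>
      (LBINT x. (L x - f x) * indicator {0<..} (\<theta> x + (- 1) * w x))"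
  proof (intro ramp_integral_limit Lf)
    have "w \<in> borel_measurable borel" using w by (simp add: sqint_def)
    then show "(\<lambda>x. \<theta> x + (- 1) * w x) \<in> borel_measurable borel"
      using borel_measurable_continuous_onI[OF \<theta>c] by measurable
  qed
  then have "(LBINT x. (L x - f x) * indicator {0<..} (\<theta> x + (- 1) * w x)) \<le> 0"
    using le by (intro LIMSEQ_le_const2) auto
  then show ?thesis by (simp add: \<theta>_def)
qed

end

section \<open>Borel representatives of a strong solution\<close>

lemma AE_lebesgue_on_iff:
  assumes "S \<in> sets borel"
  shows "(AE z in lebesgue_on S. P z) \<longleftrightarrow> (AE z in lborel. z \<in> S \<longrightarrow> P z)"
  using assms by (subst AE_restrict_space_iff) (auto simp: AE_completion_iff)

lemma lebesgue_measurable_AE: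
  fixes f g :: "'a::euclidean_space \<Rightarrow> real"
  assumes g: "g \<in> borel_measurable borel" and eq: "AE z in lborel. f z = g z"
  shows "f \<in> borel_measurable lebesgue"
proof -
  show ?thesis
  proof (rule measurableI)
    fix A :: "real set" assume "A \<in> sets borel"
    then have "g -` A \<inter> space lborel \<in> sets lborel" using g by (intro measurable_sets) auto
    then have "g -` A \<in> sets lebesgue" by auto
    moreover have ae: "AE z in lebesgue. z \<in> g -` A \<longleftrightarrow> z \<in> f -` A"
      using eq unfolding AE_completion_iff by eventually_elim auto
    ultimately have "f -` A \<in> sets lebesgue"
      using completion.in_sets_AE[OF ae] by simp
    then show "f -` A \<inter> space lebesgue \<in> sets lebesgue" by simp
  qed simp
qed

text \<open>The definitions integrate over \<open>lebesgue_on S\<close>, while product measures,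
  translations and scalings are handled with \<open>lborel\<close>. A Borel representative extended
  by zero connects the two.\<close>

lemma lebesgue_on_transfer:
  fixes f g :: "'a::euclidean_space \<Rightarrow> real"
  assumes S: "S \<in> sets borel" and g: "g \<in> borel_measurable borel"
    and out: "\<And>z. z \<notin> S \<Longrightarrow> g z = 0" and eq: "AE z in lborel. z \<in> S \<longrightarrow> f z = g z"
  shows "f \<in> borel_measurable (lebesgue_on S)"
    "integrable (lebesgue_on S) f \<longleftrightarrow> integrable lborel g"
    "(\<integral>z. f z \<partial>lebesgue_on S) = (LBINT z. g z)"
proof -
  have S': "S \<inter> space lebesgue \<in> sets lebesgue" using S by simp
  have eq': "AE z in lborel. indicator S z *\<^sub>R f z = g z"
    using eq by eventually_elim (auto simp: indicator_def out)
  have m: "(\<lambda>z. indicator S z *\<^sub>R f z) \<in> borel_measurable lebesgue"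
    by (rule lebesgue_measurable_AE[OF g eq'])
  have m': "g \<in> borel_measurable lebesgue" using g by (intro measurable_completion) simp
  have eq'': "AE z in lebesgue. indicator S z *\<^sub>R f z = g z" using eq' by (simp add: AE_completion_iff)
  show "f \<in> borel_measurable (lebesgue_on S)"
    using m S' by (simp add: borel_measurable_restrict_space_iff[OF S'])
  have "integrable (lebesgue_on S) f \<longleftrightarrow> integrable lebesgue (\<lambda>z. indicator S z *\<^sub>R f z)"
    by (rule integrable_restrict_space[OF S'])
  also have "\<dots> \<longleftrightarrow> integrable lebesgue g"
    by (rule integrable_cong_AE[OF m m' eq''])
  also have "\<dots> \<longleftrightarrow> integrable lborel g" using g by (intro integrable_completion) simp
  finally show "integrable (lebesgue_on S) f \<longleftrightarrow> integrable lborel g" .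
  have "(\<integral>z. f z \<partial>lebesgue_on S) = (\<integral>z. indicator S z *\<^sub>R f z \<partial>lebesgue)"
    by (rule integral_restrict_space[OF S'])
  also have "\<dots> = (\<integral>z. g z \<partial>lebesgue)"
    by (rule integral_cong_AE[OF m m' eq''])
  also have "\<dots> = (LBINT z. g z)" using g by (intro integral_completion) simp
  finally show "(\<integral>z. f z \<partial>lebesgue_on S) = (LBINT z. g z)" .
qed

lemma nn_integral_lebesgue_on:
  assumes "S \<in> sets borel" and "AE z in lborel. z \<in> S \<longrightarrow> f z = (g z :: ennreal)"
  shows "(\<integral>\<^sup>+z. f z \<partial>lebesgue_on S) = (\<integral>\<^sup>+z. g z * indicator S z \<partial>lborel)"
proof -
  have "(\<integral>\<^sup>+z. f z \<partial>lebesgue_on S) = (\<integral>\<^sup>+z. f z * indicator S z \<partial>lborel)"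
    using assms(1) by (subst nn_integral_restrict_space) (auto simp: nn_integral_completion)
  also have "\<dots> = (\<integral>\<^sup>+z. g z * indicator S z \<partial>lborel)"
    by (rule nn_integral_cong_AE) (use assms(2) in \<open>eventually_elim, auto simp: indicator_def\<close>)
  finally show ?thesis .
qed

lemma borel_representative:
  fixes f :: "'a::euclidean_space \<Rightarrow> real"
  assumes S: "S \<in> sets borel" and f: "f \<in> borel_measurable (lebesgue_on S)"
  shows "\<exists>g. g \<in> borel_measurable borel \<and> (\<forall>z. z \<notin> S \<longrightarrow> g z = 0) \<and> (AE z in lborel. z \<in> S \<longrightarrow> f z = g z)"
proof -
  have S': "S \<inter> space lebesgue \<in> sets lebesgue" using S by simp
  have "(\<lambda>z. indicator S z *\<^sub>R f z) \<in> borel_measurable lebesgue"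
    using f S' by (simp add: borel_measurable_restrict_space_iff[OF S'])
  then obtain g where g: "g \<in> borel_measurable lborel" "AE z in lborel. indicator S z *\<^sub>R f z = g z"
    using completion_ex_borel_measurable_real by blast
  show ?thesis
  proof (intro exI[of _ "\<lambda>z. indicator S z * g z"] conjI allI impI)
    show "(\<lambda>z. indicator S z * g z) \<in> borel_measurable borel" using g(1) S by simp
    show "AE z in lborel. z \<in> S \<longrightarrow> f z = indicator S z * g z" using g(2) by eventually_elim auto
  qed auto
qed

lemma measurable_comp_fst:
  fixes f :: "'a::euclidean_space \<Rightarrow> real"
  assumes "f \<in> borel_measurable borel"
  shows "(\<lambda>z::'a \<times> 'b::euclidean_space. f (fst z)) \<in> borel_measurable borel"
  by (rule measurable_compose[OF borel_measurable_continuous_onI assms]) (intro continuous_intros)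

lemma measurable_comp_snd:
  fixes f :: "'a::euclidean_space \<Rightarrow> real"
  assumes "f \<in> borel_measurable borel"
  shows "(\<lambda>z::'b::euclidean_space \<times> 'a. f (snd z)) \<in> borel_measurable borel"
  by (rule measurable_compose[OF borel_measurable_continuous_onI assms]) (intro continuous_intros)

text \<open>\<open>U\<close> and \<open>F\<close> are Borel representatives of \<open>u\<close> and \<open>\<partial>\<^sub>t u\<close>, so that \<open>2 F\<close> represents \<open>\<Delta>u\<^sup>2\<close>.\<close>

locale energy_solution =
  fixes a :: "real^'n" and T :: real and u :: "real \<Rightarrow> real^'n \<Rightarrow> real" and U F :: "real \<times> (real^'n) \<Rightarrow> real"
  assumes a_pos: "\<forall>i. 0 < a $ i" and T_pos: "0 < T"
    and U_meas: "U \<in> borel_measurable borel" and F_meas: "F \<in> borel_measurable borel"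
    and U_out: "\<And>z. z \<notin> {0<..<T} \<times> box (- a) a \<Longrightarrow> U z = 0"
    and F_out: "\<And>z. z \<notin> {0<..<T} \<times> box (- a) a \<Longrightarrow> F z = 0"
    and U_eq: "AE z in lborel. z \<in> {0<..<T} \<times> box (- a) a \<longrightarrow> U z = u (fst z) (snd z)"
    and cont: "in_C_L1 T (cbox (- a) a) u"
    and nonneg: "\<And>t. t \<in> {0..T} \<Longrightarrow> AE x in lborel. x \<in> cbox (- a) a \<longrightarrow> 0 \<le> u t x"
    and H10: "AE t in lborel. t \<in> {0<..<T} \<longrightarrow> (\<exists>G. in_H10 (box (- a) a) (\<lambda>x. (u t x)\<^sup>2) G)"
    and F_int: "\<And>\<tau>. \<tau> \<in> {0<..<T} \<Longrightarrow> integrable lborel (\<lambda>z. indicator ({\<tau><..<T} \<times> box (- a) a) z * F z)"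
    and U_int: "\<And>K. compact K \<Longrightarrow> K \<subseteq> {0<..<T} \<times> box (- a) a \<Longrightarrow> integrable lborel (\<lambda>z. indicator K z * U z)"
    and U2_int: "\<And>K. compact K \<Longrightarrow> K \<subseteq> {0<..<T} \<times> box (- a) a \<Longrightarrow> integrable lborel (\<lambda>z. indicator K z * (U z)\<^sup>2)"
    and weak_time: "\<And>\<psi> p q g l r. smooth_real \<psi> \<Longrightarrow> (\<And>t. t \<notin> {p..q} \<Longrightarrow> \<psi> t = 0) \<Longrightarrow> tensor_supp l r g \<Longrightarrow>
       {p..q} \<times> cbox l r \<subseteq> {0<..<T} \<times> box (- a) a \<Longrightarrow>
       (LBINT z. U z * (deriv \<psi> (fst z) * tensor g (snd z))) = - (LBINT z. F z * (\<psi> (fst z) * tensor g (snd z)))"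
    and weak_lap: "\<And>\<psi> p q g l r. smooth_real \<psi> \<Longrightarrow> (\<And>t. t \<notin> {p..q} \<Longrightarrow> \<psi> t = 0) \<Longrightarrow> tensor_supp l r g \<Longrightarrow>
       {p..q} \<times> cbox l r \<subseteq> {0<..<T} \<times> box (- a) a \<Longrightarrow>
       (LBINT z. (U z)\<^sup>2 * (\<psi> (fst z) * (\<Sum>b\<in>Basis. tensor (g(b := deriv (deriv (g b)))) (snd z)))) =
       (LBINT z. 2 * F z * (\<psi> (fst z) * tensor g (snd z)))"

text \<open>The thresholds \<open>T / (n + 2)\<close> lie strictly between 0 and \<open>T\<close>
  and tend to 0; they replace a condition for every \<open>\<tau>\<close> by countably many, as
  statements holding almost everywhere require.\<close>

lemma exhaust_time:
  assumes "0 < (t::real)" "t < T" shows "\<exists>n. T / real (n + 2) < t"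
proof -
  obtain n where n: "T / t < real n" using reals_Archimedean2 by blast
  then have "T / t < real (n + 2)" by simp
  then have "T / real (n + 2) < t" using assms by (simp add: field_simps)
  then show ?thesis by blast
qed

text \<open>Because \<open>lap = 2 * ut\<close> almost everywhere, a single Borel function
  \<open>F\<close> serves both weak identities. Of all test functions only the products
  \<open>\<psi>(t) g(x)\<close> are retained.\<close>

lemma strong_solution_energy:
  fixes a :: "real^'n"
  assumes a_pos: "\<forall>i. 0 < a $ i" and T_pos: "0 < T" and sol: "strong_solution a T u0 u"
    and u_nonneg: "\<forall>t\<in>{0..T}. AE x in lebesgue_on (cbox (- a) a). 0 \<le> u t x"
  shows "\<exists>U F. energy_solution a T u U F"
proof -
  let ?\<Omega> = "box (- a) a" and ?W = "{0<..<T} \<times> box (- a) a"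
  obtain ut lap where um: "(\<lambda>(t, x). u t x) \<in> borel_measurable (lebesgue_on ({0..T} \<times> cbox (- a) a))"
    and cont: "in_C_L1 T (cbox (- a) a) u"
    and L2: "\<And>\<tau>. \<tau>\<in>{0<..<T} \<Longrightarrow> in_L2_H10 \<tau> T ?\<Omega> (\<lambda>t x. (u t x)\<^sup>2)"
    and ut: "has_weak_partial ?W (1, 0) (\<lambda>(t, x). u t x) ut"
    and lap: "has_weak_space_laplacian ?W (\<lambda>(t, x). (u t x)\<^sup>2) lap"
    and int: "\<And>\<tau>. \<tau>\<in>{0<..<T} \<Longrightarrow> integrable (lebesgue_on ({\<tau><..<T} \<times> ?\<Omega>)) ut"
    and eq: "AE z in lebesgue_on ?W. ut z = 1 / 2 * lap z"
    using sol unfolding strong_solution_def by blast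
  have opW: "open ?W" by (intro open_Times open_box) auto
  then have W: "?W \<in> sets borel" by simp
  have sub: "?W \<subseteq> {0..T} \<times> cbox (- a) a" using box_subset_cbox[of "- a" a] by auto
  have cl: "{0..T} \<times> cbox (- a) a \<in> sets borel"
    by (intro borel_closed closed_Times) auto
  obtain U0 where U0: "U0 \<in> borel_measurable borel"
      "AE z in lborel. z \<in> {0..T} \<times> cbox (- a) a \<longrightarrow> (case z of (t, x) \<Rightarrow> u t x) = U0 z"
    using borel_representative[OF cl um] by blast
  define U where "U z = indicator ?W z * U0 z" for z
  have U_meas[measurable]: "U \<in> borel_measurable borel" unfolding U_def[abs_def] using U0(1) W by simp
  have U_out: "U z = 0" if "z \<notin> ?W" for z using that by (simp add: U_def)
  have U_eq: "AE z in lborel. z \<in> ?W \<longrightarrow> U z = u (fst z) (snd z)"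
    using U0(2) by eventually_elim (use sub in \<open>auto simp: U_def\<close>)
  define S where "S n = {T / real (n + 2)<..<T} \<times> ?\<Omega>" for n :: nat
  have \<tau>n: "T / real (n + 2) \<in> {0<..<T}" for n
    using T_pos mult_pos_pos[of "1 + real n" T] by (auto simp: field_simps add_pos_nonneg)
  have Sset: "S n \<in> sets borel" for n unfolding S_def by (intro borel_open open_Times open_box) auto
  have Smem: "z \<in> ?W \<longleftrightarrow> (\<exists>n. z \<in> S n)" for z
  proof
    assume "z \<in> ?W"
    then show "\<exists>n. z \<in> S n" using exhaust_time[of "fst z" T] by (auto simp: S_def)
  next
    assume "\<exists>n. z \<in> S n"
    then obtain n where n: "T / real (n + 2) < fst z" "fst z < T" "snd z \<in> ?\<Omega>" by (auto simp: S_def)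
    moreover have "0 < T / real (n + 2)" using \<tau>n[of n] by simp
    ultimately show "z \<in> ?W" by (cases z) auto
  qed
  have Sev: "\<forall>\<^sub>F n in sequentially. z \<in> S n" if z: "z \<in> ?W" for z
  proof -
    obtain n where n: "z \<in> S n" using z Smem by blast
    have "z \<in> S m" if "n \<le> m" for m
    proof -
      have "T / real (m + 2) \<le> T / real (n + 2)" using that T_pos by (intro divide_left_mono) auto
      then show ?thesis using n by (auto simp: S_def)
    qed
    then show ?thesis by (auto simp: eventually_sequentially)
  qed
  \<comment> \<open>\<open>ut\<close> is known to be integrable only on
    \<open>(\<tau>, T) \<times> \<Omega>\<close>; measurability on the full cylinder is glued
    together along the increasing sets \<open>S n\<close>.\<close>
  have "(\<lambda>z. indicator ?W z *\<^sub>R ut z) \<in> borel_measurable lebesgue"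
  proof (rule borel_measurable_LIMSEQ_real)
    show "(\<lambda>z. indicator (S n) z *\<^sub>R ut z) \<in> borel_measurable lebesgue" for n
      using int[OF \<tau>n[of n]] Sset[of n]
      by (subst borel_measurable_restrict_space_iff[symmetric]) (auto simp: S_def)
    show "(\<lambda>n. indicator (S n) z *\<^sub>R ut z) \<longlonglongrightarrow> indicator ?W z *\<^sub>R ut z" for z
    proof (cases "z \<in> ?W")
      case True
      have "\<forall>\<^sub>F n in sequentially. indicator (S n) z *\<^sub>R ut z = indicator ?W z *\<^sub>R ut z"
        using Sev[OF True] by eventually_elim (use True in auto)
      then show ?thesis by (rule tendsto_eventually)
    next
      case False
      then have "z \<notin> S n" for n using Smem by blast
      then show ?thesis using False by simp
    qed
  qed
  then have "ut \<in> borel_measurable (lebesgue_on ?W)"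
    using W by (subst borel_measurable_restrict_space_iff) auto
  from borel_representative[OF W this] obtain F where F_meas[measurable]: "F \<in> borel_measurable borel"
    and F_out: "\<And>z. z \<notin> ?W \<Longrightarrow> F z = 0" and F_eq: "AE z in lborel. z \<in> ?W \<longrightarrow> ut z = F z" by blast
  have lap_eq: "AE z in lborel. z \<in> ?W \<longrightarrow> lap z = 2 * F z"
    using F_eq eq[unfolded AE_lebesgue_on_iff[OF W]] by eventually_elim auto
  have "energy_solution a T u U F"
  proof
    show "AE x in lborel. x \<in> cbox (- a) a \<longrightarrow> 0 \<le> u t x" if "t \<in> {0..T}" for t
      using u_nonneg that by (simp add: AE_lebesgue_on_iff)
    \<comment> \<open>The gradient provided for different \<open>\<tau>\<close> may differ, so only
      the existence of some gradient at almost every time is kept.\<close>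
    have "AE t in lborel. \<forall>n. t \<in> {T / real (n + 2)<..<T} \<longrightarrow> (\<exists>G. in_H10 ?\<Omega> (\<lambda>x. (u t x)\<^sup>2) G)"
      unfolding AE_all_countable
    proof
      fix n
      obtain G where "AE t in lebesgue_on {T / real (n + 2)<..<T}. in_H10 ?\<Omega> (\<lambda>x. (u t x)\<^sup>2) (G t)"
        using L2[OF \<tau>n[of n]] unfolding in_L2_H10_def by blast
      then have "AE t in lborel. t \<in> {T / real (n + 2)<..<T} \<longrightarrow> in_H10 ?\<Omega> (\<lambda>x. (u t x)\<^sup>2) (G t)"
        by (subst (asm) AE_lebesgue_on_iff) simp_all
      then show "AE t in lborel. t \<in> {T / real (n + 2)<..<T} \<longrightarrow> (\<exists>G. in_H10 ?\<Omega> (\<lambda>x. (u t x)\<^sup>2) G)"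
        by eventually_elim blast
    qed
    then show "AE t in lborel. t \<in> {0<..<T} \<longrightarrow> (\<exists>G. in_H10 ?\<Omega> (\<lambda>x. (u t x)\<^sup>2) G)"
    proof eventually_elim
      case (elim t)
      then show ?case using exhaust_time[of t T] by auto
    qed
    show "integrable lborel (\<lambda>z. indicator ({\<tau><..<T} \<times> ?\<Omega>) z * F z)" if \<tau>: "\<tau> \<in> {0<..<T}" for \<tau>
    proof -
      have S: "{\<tau><..<T} \<times> ?\<Omega> \<in> sets borel" by (intro borel_open open_Times open_box) auto
      have "AE z in lborel. z \<in> {\<tau><..<T} \<times> ?\<Omega> \<longrightarrow> ut z = indicator ({\<tau><..<T} \<times> ?\<Omega>) z * F z"
        using F_eq by eventually_elim (use \<tau> in auto)
      from lebesgue_on_transfer(2)[OF S _ _ this] int[OF \<tau>] S show ?thesis by simp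
    qed
    fix K :: "(real \<times> (real^'n)) set" assume K: "compact K" "K \<subseteq> ?W"
    have Kb: "K \<in> sets borel" using K(1) by (simp add: compact_imp_closed)
    have "AE z in lborel. z \<in> K \<longrightarrow> (case z of (t, x) \<Rightarrow> u t x) = indicator K z * U z"
      using U_eq by eventually_elim (use K in \<open>auto simp: subset_eq\<close>)
    from lebesgue_on_transfer(2)[OF Kb _ _ this] Kb show "integrable lborel (\<lambda>z. indicator K z * U z)"
      using ut K unfolding has_weak_partial_def loc_integrable_def by simp
    have "AE z in lborel. z \<in> K \<longrightarrow> (case z of (t, x) \<Rightarrow> (u t x)\<^sup>2) = indicator K z * (U z)\<^sup>2"
      using U_eq by eventually_elim (use K in \<open>auto simp: subset_eq\<close>)
    from lebesgue_on_transfer(2)[OF Kb _ _ this] Kb show "integrable lborel (\<lambda>z. indicator K z * (U z)\<^sup>2)"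
      using lap K unfolding has_weak_space_laplacian_def loc_integrable_def by simp
  next
    fix \<psi> p q g l r
    assume \<psi>: "smooth_real \<psi>" "\<And>t. t \<notin> {p..q} \<Longrightarrow> \<psi> t = 0" and g: "tensor_supp l r g"
      and sub: "{p..q} \<times> cbox l r \<subseteq> ?W"
    let ?\<phi> = "\<lambda>(t, x). \<psi> t * tensor g x"
    have test: "test_function ?W ?\<phi>" by (rule st_test_function[OF \<psi> g sub])
    have psi[measurable]: "\<psi> \<in> borel_measurable borel" "deriv \<psi> \<in> borel_measurable borel"
      "tensor g \<in> borel_measurable borel" and g2: "tensor (g(b := deriv (deriv (g b)))) \<in> borel_measurable borel" for b
      using tensor_supp_upd[OF tensor_supp_upd[OF g, of b], of b]
      by (auto intro!: borel_measurable_continuous_onI smooth_real_cont smooth_real_deriv \<psi> tensor_supp_continuous[OF g]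
         tensor_supp_continuous)
    note [measurable] = measurable_comp_fst[OF psi(1)] measurable_comp_fst[OF psi(2)] measurable_comp_snd[OF psi(3)]
      measurable_comp_snd[OF g2]
    have 1: "(\<integral>z. (case z of (t, x) \<Rightarrow> u t x) * partial_d (1, 0) ?\<phi> z \<partial>lebesgue_on ?W) =
      (LBINT z. U z * (deriv \<psi> (fst z) * tensor g (snd z)))"
    proof (rule lebesgue_on_transfer(3)[OF W])
      show "AE z in lborel. z \<in> ?W \<longrightarrow> (case z of (t, x) \<Rightarrow> u t x) * partial_d (1, 0) ?\<phi> z =
         U z * (deriv \<psi> (fst z) * tensor g (snd z))"
        using U_eq by eventually_elim (auto simp: partial_d_time[OF \<psi>(1)])
    qed (use U_out in auto)
    have 2: "(\<integral>z. ut z * ?\<phi> z \<partial>lebesgue_on ?W) = (LBINT z. F z * (\<psi> (fst z) * tensor g (snd z)))"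
      by (rule lebesgue_on_transfer(3)[OF W]) (use F_eq F_out in \<open>auto elim!: eventually_mono\<close>)
    show "(LBINT z. U z * (deriv \<psi> (fst z) * tensor g (snd z))) = - (LBINT z. F z * (\<psi> (fst z) * tensor g (snd z)))"
      unfolding 1[symmetric] 2[symmetric] using ut test unfolding has_weak_partial_def by blast
    have 3: "(\<integral>z. (case z of (t, x) \<Rightarrow> (u t x)\<^sup>2) * laplacian (\<lambda>y. ?\<phi> (fst z, y)) (snd z) \<partial>lebesgue_on ?W) =
      (LBINT z. (U z)\<^sup>2 * (\<psi> (fst z) * (\<Sum>b\<in>Basis. tensor (g(b := deriv (deriv (g b)))) (snd z))))"
    proof (rule lebesgue_on_transfer(3)[OF W])
      show "AE z in lborel. z \<in> ?W \<longrightarrow> (case z of (t, x) \<Rightarrow> (u t x)\<^sup>2) * laplacian (\<lambda>y. ?\<phi> (fst z, y)) (snd z) =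
         (U z)\<^sup>2 * (\<psi> (fst z) * (\<Sum>b\<in>Basis. tensor (g(b := deriv (deriv (g b)))) (snd z)))"
        using U_eq by eventually_elim (auto simp: laplacian_tensor tensor_supp_smooth[OF g])
    qed (use U_out in auto)
    have 4: "(\<integral>z. lap z * ?\<phi> z \<partial>lebesgue_on ?W) = (LBINT z. 2 * F z * (\<psi> (fst z) * tensor g (snd z)))"
      by (rule lebesgue_on_transfer(3)[OF W]) (use lap_eq F_out in \<open>auto elim!: eventually_mono\<close>)
    show "(LBINT z. (U z)\<^sup>2 * (\<psi> (fst z) * (\<Sum>b\<in>Basis. tensor (g(b := deriv (deriv (g b)))) (snd z)))) =
       (LBINT z. 2 * F z * (\<psi> (fst z) * tensor g (snd z)))"
      unfolding 3[symmetric] 4[symmetric] using lap test unfolding has_weak_space_laplacian_def by blast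
  qed (use a_pos T_pos U_meas F_meas U_out F_out U_eq cont in auto)
  then show ?thesis by blast
qed

section \<open>Time slices of a strong solution\<close>

lemma test_function_C1c:
  fixes \<phi> :: "'a::euclidean_space \<Rightarrow> real"
  assumes "test_function U \<phi>"
  shows "C1c U \<phi> (\<lambda>b. partial_d b \<phi>)"
proof -
  obtain K where K: "compact K" "K \<subseteq> U" "\<And>z. z \<notin> K \<Longrightarrow> \<phi> z = 0"
    and sm: "smooth_on UNIV \<phi>" using assms unfolding test_function_def by blast
  have d0: "\<phi> differentiable (at z)" for z
    using sm[unfolded smooth_on_def, rule_format, of "[]" z] by simp
  have d1: "partial_d b \<phi> differentiable (at z)" if "b \<in> Basis" for b z
    using sm[unfolded smooth_on_def, rule_format, of "[b]" z] that by simp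
  have D: "((\<lambda>h. \<phi> (x + h *\<^sub>R b)) has_real_derivative partial_d b \<phi> x) (at 0)" for x b
  proof -
    have "(\<lambda>h. \<phi> (x + h *\<^sub>R b)) differentiable (at 0)"
      by (rule differentiable_compose[where f=\<phi> and g="\<lambda>h. x + h *\<^sub>R b"]) (auto intro!: d0 derivative_intros)
    then obtain d where "((\<lambda>h. \<phi> (x + h *\<^sub>R b)) has_real_derivative d) (at 0)"
      using real_differentiable_def by blast
    then show ?thesis unfolding partial_d_def by (simp add: DERIV_imp_deriv)
  qed
  have out: "partial_d b \<phi> x = 0" if "x \<notin> K" for x b
  proof -
    have "\<forall>\<^sub>F h in nhds 0. x + h *\<^sub>R b \<in> - K"
      using that K(1) by (intro eventually_line_in_open open_Compl compact_imp_closed) auto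
    then have "\<forall>\<^sub>F h in nhds 0. \<phi> (x + h *\<^sub>R b) = 0"
      using K(3) by (auto elim!: eventually_mono)
    then have "partial_d b \<phi> x = deriv (\<lambda>_. 0) (0::real)" unfolding partial_d_def by (rule deriv_cong_ev) simp
    then show ?thesis by simp
  qed
  have "continuous_on UNIV \<phi>" "\<And>b. b \<in> Basis \<Longrightarrow> continuous_on UNIV (partial_d b \<phi>)"
    by (intro continuous_at_imp_continuous_on ballI differentiable_imp_continuous_within d0 d1; assumption)+
  then show ?thesis
    unfolding C1c_def using K out D by (intro conjI exI[of _ K] ballI allI impI) auto
qed

lemma sqint_finite_nn:
  fixes g :: "'a::euclidean_space \<Rightarrow> real"
  assumes g: "g \<in> borel_measurable borel" and fin: "(\<integral>\<^sup>+x. ennreal ((g x)\<^sup>2) \<partial>lborel) < \<infinity>"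
  shows "sqint g"
  unfolding sqint_def
  using assms by (auto intro!: integrableI_bounded)

lemma L2_norm_sq_transfer:
  fixes f g :: "'a::euclidean_space \<Rightarrow> real"
  assumes "S \<in> sets borel" "\<And>x. x \<notin> S \<Longrightarrow> g x = 0" "AE x in lborel. x \<in> S \<longrightarrow> f x = g x"
  shows "L2_norm_sq S f = (\<integral>\<^sup>+x. ennreal ((g x)\<^sup>2) \<partial>lborel)"
proof -
  have "AE x in lborel. x \<in> S \<longrightarrow> ennreal ((f x)\<^sup>2) = ennreal ((g x)\<^sup>2)"
    using assms(3) by eventually_elim auto
  then have "L2_norm_sq S f = (\<integral>\<^sup>+x. ennreal ((g x)\<^sup>2) * indicator S x \<partial>lborel)"
    unfolding L2_norm_sq_def by (rule nn_integral_lebesgue_on[OF assms(1)])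
  also have "\<dots> = (\<integral>\<^sup>+x. ennreal ((g x)\<^sup>2) \<partial>lborel)"
    by (rule nn_integral_cong) (auto simp: indicator_def assms(2))
  finally show ?thesis .
qed

lemma sqint_tendsto_0:
  fixes d :: "nat \<Rightarrow> 'a::euclidean_space \<Rightarrow> real"
  assumes d: "\<And>j. sqint (d j)" and lim: "(\<lambda>j. \<integral>\<^sup>+x. ennreal ((d j x)\<^sup>2) \<partial>lborel) \<longlonglongrightarrow> 0"
  shows "(\<lambda>j. LBINT x. (d j x)\<^sup>2) \<longlonglongrightarrow> 0"
proof -
  have "(\<integral>\<^sup>+x. ennreal ((d j x)\<^sup>2) \<partial>lborel) = ennreal (LBINT x. (d j x)\<^sup>2)" for j
    using d[of j] by (intro nn_integral_eq_integral) (auto simp: sqint_def)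
  then show ?thesis using lim by (simp add: tendsto_ennreal_iff[of _ _ 0, simplified])
qed

lemma sqint_integrable:
  fixes g :: "'a::euclidean_space \<Rightarrow> real"
  assumes g: "sqint g" and S: "bounded S" "S \<in> sets borel" and out: "\<And>x. x \<notin> S \<Longrightarrow> g x = 0"
  shows "integrable lborel g"
proof -
  have i: "sqint (indicat_real S)"
    using S by (intro sqint_bounded_support[where S=S and M=1]) (auto simp: indicator_def)
  have "g x = indicat_real S x * g x" for x by (cases "x \<in> S") (auto simp: out)
  then have "(\<lambda>x. indicat_real S x * g x) = g" by (intro ext) metis
  then show ?thesis using sqint_mult[OF i g] by simp
qed

text \<open>One-variable factors of the mollifier rescaled by \<open>k + 1\<close> and placed with
  its corner at \<open>y\<close>. The normalising power of \<open>k + 1\<close> is left out, since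
  linear identities are tested; it enters only in the limit in
  \<open>weak_divergence_C1c\<close>.\<close>

abbreviation mollifier_factors :: "nat \<Rightarrow> 'a::euclidean_space \<Rightarrow> 'a \<Rightarrow> real \<Rightarrow> real" where
  "mollifier_factors k y \<equiv> (\<lambda>b x. bump (real (Suc k) * (x - y \<bullet> b)))"

lemma mollifier_factors_supp:
  "tensor_supp y (y + (1 / real (Suc k)) *\<^sub>R One) (mollifier_factors k y)"
  unfolding tensor_supp_def
proof (intro conjI allI ballI impI)
  fix b
  have "smooth_real (\<lambda>x. bump (real (Suc k) * x + (- (real (Suc k) * (y \<bullet> b)))))"
    by (intro smooth_real_affine bump_smooth)
  moreover have "real (Suc k) * (x - y \<bullet> b) = real (Suc k) * x + (- (real (Suc k) * (y \<bullet> b)))" for x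
    by (simp add: right_diff_distrib)
  ultimately show "smooth_real (\<lambda>x. bump (real (Suc k) * (x - y \<bullet> b)))" by (simp only:)
next
  fix b x assume b: "(b::'a) \<in> Basis" and x: "x \<notin> {y \<bullet> b..(y + (1 / real (Suc k)) *\<^sub>R One) \<bullet> b}"
  have "real (Suc k) * (x - y \<bullet> b) \<notin> {0..1}"
  proof
    assume *: "real (Suc k) * (x - y \<bullet> b) \<in> {0..1}"
    then have "0 \<le> x - y \<bullet> b" by (simp add: zero_le_mult_iff)
    moreover have "x - y \<bullet> b \<le> 1 / real (Suc k)" using * by (simp add: pos_le_divide_eq mult.commute)
    ultimately show False using x b by (simp add: inner_add_left)
  qed
  then show "bump (real (Suc k) * (x - y \<bullet> b)) = 0" by (rule bump_outside)
qed

lemma tensor_mollifier_factors: "tensor (mollifier_factors k y) x = mollifier (real (Suc k) *\<^sub>R (x - y))"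
  unfolding tensor_def by (intro prod.cong refl) (simp add: inner_diff_left)

lemma tensor_mollifier_factors':
  assumes b: "b \<in> Basis"
  shows "tensor ((mollifier_factors k y)(b := deriv (mollifier_factors k y b))) x =
    real (Suc k) * mollifier' b (real (Suc k) *\<^sub>R (x - y))"
proof -
  let ?g = "mollifier_factors k y"
  have "deriv (?g b) z = real (Suc k) * deriv bump (real (Suc k) * (z - y \<bullet> b))" for z
  proof -
    have "real (Suc k) * (x - y \<bullet> b) = real (Suc k) * x + (- (real (Suc k) * (y \<bullet> b)))" for x
      by (simp add: right_diff_distrib)
    then show ?thesis
      using deriv_affine[OF bump_smooth, of "real (Suc k)" "- (real (Suc k) * (y \<bullet> b))" z] by (simp only:)
  qed
  then have "tensor (?g(b := deriv (?g b))) x =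
    (\<Prod>c\<in>Basis. (if c = b then real (Suc k) else 1) * ((\<lambda>_. bump)(b := deriv bump)) c ((real (Suc k) *\<^sub>R (x - y)) \<bullet> c))"
    unfolding tensor_def by (intro prod.cong refl) (simp add: inner_diff_left del: of_nat_Suc)
  also have "\<dots> = real (Suc k) * mollifier' b (real (Suc k) *\<^sub>R (x - y))"
    unfolding prod.distrib tensor_def using b by (simp add: prod.delta del: of_nat_Suc)
  finally show ?thesis .
qed

text \<open>Continuity in the centre of the kernel, so that identities known for a dense set of
  centres extend to all centres.\<close>

lemma kernel_integral_continuous:
  fixes f k :: "'a::euclidean_space \<Rightarrow> real"
  assumes f: "integrable lborel f" and k: "continuous_on UNIV k" "\<And>z. \<bar>k z\<bar> \<le> M" and y: "Y \<longlonglongrightarrow> y"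
  shows "(\<lambda>m. LBINT x. f x * k (c *\<^sub>R (x - Y m))) \<longlonglongrightarrow> (LBINT x. f x * k (c *\<^sub>R (x - y)))"
proof (rule integral_dominated_convergence[where w="\<lambda>x. \<bar>f x\<bar> * M"])
  note [measurable] = borel_measurable_integrable[OF f] borel_measurable_continuous_onI[OF k(1)]
  show "AE x in lborel. (\<lambda>m. f x * k (c *\<^sub>R (x - Y m))) \<longlonglongrightarrow> f x * k (c *\<^sub>R (x - y))"
    by (intro AE_I2 tendsto_intros continuous_on_tendsto_compose[OF k(1)] y) auto
  show "AE x in lborel. norm (f x * k (c *\<^sub>R (x - Y m))) \<le> \<bar>f x\<bar> * M" for m
    using k(2) by (auto simp: abs_mult intro!: mult_left_mono)
  show "(\<lambda>x. f x * k (c *\<^sub>R (x - y))) \<in> borel_measurable lborel" by measurable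
  show "(\<lambda>x. f x * k (c *\<^sub>R (x - Y m))) \<in> borel_measurable lborel" for m by measurable
qed (use f in auto)

lemma Basis_axis: "b \<in> (Basis :: (real^'n) set) \<Longrightarrow> \<exists>i. b = axis i 1"
  by (auto simp: Basis_vec_def)

text \<open>The hypothesis \<open>lap\<close> pairs \<open>w\<close> with second derivatives;
  membership in \<open>H^1\<close> moves one derivative back and gives the divergence form with
  \<open>G\<close>. It is obtained first for centres in \<open>Q\<close>, then for all centres by
  continuity, and finally for every \<open>C1c\<close> function by integration over the
  centres.\<close>

lemma slice_data_from_H10:
  fixes a :: "real^'n"
  assumes H: "in_H10 (box (- a) a) w0 G0"
    and w: "w \<in> borel_measurable borel" "\<And>x. x \<notin> box (- a) a \<Longrightarrow> w x = 0" "AE x in lborel. x \<in> box (- a) a \<longrightarrow> w0 x = w x"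
    and f: "integrable lborel f"
    and dense: "\<And>S. open S \<Longrightarrow> S \<noteq> {} \<Longrightarrow> \<exists>y\<in>Q. y \<in> S"
    and lap: "\<And>k y. y \<in> Q \<Longrightarrow> cbox y (y + (1 / real (Suc k)) *\<^sub>R One) \<subseteq> box (- a) a \<Longrightarrow>
      (LBINT x. w x * (\<Sum>b\<in>Basis. tensor ((mollifier_factors k y)(b := deriv (deriv (mollifier_factors k y b)))) x)) =
      (LBINT x. f x * tensor (mollifier_factors k y) x)"
  shows "\<exists>G \<phi> D\<phi>. slice_data (- a) a f w G \<phi> D\<phi>"
proof -
  let ?\<Omega> = "box (- a) a"
  have \<Omega>: "?\<Omega> \<in> sets borel" by simp
  obtain \<phi> where H1: "in_H1 ?\<Omega> w0 G0" and test: "\<And>j. test_function ?\<Omega> (\<phi> j)"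
    and lim: "(\<lambda>k. H1_norm_sq ?\<Omega> (\<lambda>x. w0 x - \<phi> k x) (\<lambda>x. G0 x - (\<chi> i. partial_d (axis i 1) (\<phi> k) x))) \<longlonglongrightarrow> 0"
    using H unfolding in_H10_def by blast
  have C: "C1c ?\<Omega> (\<phi> j) (\<lambda>b. partial_d b (\<phi> j))" for j by (rule test_function_C1c[OF test])
  have "\<exists>g. g \<in> borel_measurable borel \<and> (\<forall>z. z \<notin> ?\<Omega> \<longrightarrow> g z = 0) \<and> (AE z in lborel. z \<in> ?\<Omega> \<longrightarrow> G0 z \<bullet> b = g z)"
    if b: "b \<in> Basis" for b
  proof -
    obtain i where i: "b = axis i 1" using Basis_axis[OF b] by blast
    have "(\<lambda>x. G0 x $ i) \<in> borel_measurable (lebesgue_on ?\<Omega>)"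
      using H1 unfolding in_H1_def in_L2_def by blast
    from borel_representative[OF \<Omega> this] show ?thesis by (simp add: i inner_axis)
  qed
  then obtain G where G: "\<And>b. b \<in> Basis \<Longrightarrow> G b \<in> borel_measurable borel"
    "\<And>b z. b \<in> Basis \<Longrightarrow> z \<notin> ?\<Omega> \<Longrightarrow> G b z = 0"
    "\<And>b. b \<in> Basis \<Longrightarrow> AE z in lborel. z \<in> ?\<Omega> \<longrightarrow> G0 z \<bullet> b = G b z"
    using bchoice[OF ballI, of Basis "\<lambda>b g. g \<in> borel_measurable borel \<and> (\<forall>z. z \<notin> ?\<Omega> \<longrightarrow> g z = 0) \<and>
      (AE z in lborel. z \<in> ?\<Omega> \<longrightarrow> G0 z \<bullet> b = g z)"] by blast
  have ws: "sqint w"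
    using H1 L2_norm_sq_transfer[OF \<Omega> w(2,3)] w(1) unfolding in_H1_def in_L2_def by (intro sqint_finite_nn) auto
  have Gs: "sqint (G b)" if b: "b \<in> Basis" for b
  proof -
    obtain i where i: "b = axis i 1" using Basis_axis[OF b] by blast
    have "L2_norm_sq ?\<Omega> (\<lambda>x. G0 x \<bullet> b) < \<infinity>"
      using H1 unfolding in_H1_def in_L2_def by (simp add: i inner_axis)
    then show ?thesis using L2_norm_sq_transfer[OF \<Omega> G(2)[OF b] G(3)[OF b]] G(1)[OF b] by (intro sqint_finite_nn) auto
  qed
  have \<phi>out: "\<phi> j x = 0" "b \<in> Basis \<Longrightarrow> partial_d b (\<phi> j) x = 0" if "x \<notin> ?\<Omega>" for j x b
    using C[of j] that unfolding C1c_def by blast+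
  have \<phi>s: "sqint (\<phi> j)" "b \<in> Basis \<Longrightarrow> sqint (partial_d b (\<phi> j))" for j b
    using C1c_sqint[OF C[of j]] by auto
  have lim_w: "(\<lambda>j. LBINT x. (w x - \<phi> j x)\<^sup>2) \<longlonglongrightarrow> 0"
  proof (rule sqint_tendsto_0[OF sqint_diff[OF ws \<phi>s(1)]])
    have "(\<integral>\<^sup>+x. ennreal ((w x - \<phi> j x)\<^sup>2) \<partial>lborel) = L2_norm_sq ?\<Omega> (\<lambda>x. w0 x - \<phi> j x)" for j
      by (rule L2_norm_sq_transfer[symmetric, OF \<Omega>]) (use w(2,3) \<phi>out in \<open>auto elim!: eventually_mono\<close>)
    moreover have "L2_norm_sq ?\<Omega> (\<lambda>x. w0 x - \<phi> j x) \<le>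
       H1_norm_sq ?\<Omega> (\<lambda>x. w0 x - \<phi> j x) (\<lambda>x. G0 x - (\<chi> i. partial_d (axis i 1) (\<phi> j) x))" for j
      unfolding H1_norm_sq_def by simp
    ultimately show "(\<lambda>j. \<integral>\<^sup>+x. ennreal ((w x - \<phi> j x)\<^sup>2) \<partial>lborel) \<longlonglongrightarrow> 0"
      by (intro tendsto_sandwich[OF _ _ tendsto_const lim]) auto
  qed
  have lim_G: "(\<lambda>j. LBINT x. (G b x - partial_d b (\<phi> j) x)\<^sup>2) \<longlonglongrightarrow> 0" if b: "b \<in> Basis" for b
  proof (rule sqint_tendsto_0[OF sqint_diff[OF Gs[OF b] \<phi>s(2)[OF b]]])
    obtain i where i: "b = axis i 1" using Basis_axis[OF b] by blast
    let ?N = "\<lambda>j i. L2_norm_sq ?\<Omega> (\<lambda>x. (G0 x - (\<chi> i. partial_d (axis i 1) (\<phi> j) x)) $ i)"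
    have "(\<integral>\<^sup>+x. ennreal ((G b x - partial_d b (\<phi> j) x)\<^sup>2) \<partial>lborel) = ?N j i" for j
      by (rule L2_norm_sq_transfer[symmetric, OF \<Omega>])
        (use G(2)[OF b] G(3)[OF b] \<phi>out(2)[OF _ b] in \<open>auto elim!: eventually_mono simp: i inner_axis\<close>)
    moreover have "?N j i \<le> H1_norm_sq ?\<Omega> (\<lambda>x. w0 x - \<phi> j x) (\<lambda>x. G0 x - (\<chi> i. partial_d (axis i 1) (\<phi> j) x))" for j
    proof -
      have "?N j i \<le> (\<Sum>i\<in>UNIV. ?N j i)" by (rule member_le_sum) auto
      then show ?thesis unfolding H1_norm_sq_def by (simp add: add_increasing)
    qed
    ultimately show "(\<lambda>j. \<integral>\<^sup>+x. ennreal ((G b x - partial_d b (\<phi> j) x)\<^sup>2) \<partial>lborel) \<longlonglongrightarrow> 0"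
      by (intro tendsto_sandwich[OF _ _ tendsto_const lim]) auto
  qed
  have Gi: "integrable lborel (G b)" if "b \<in> Basis" for b
    using sqint_integrable[OF Gs[OF that] bounded_box \<Omega>] G(2)[OF that] by blast
  have weak: "(LBINT x. w x * partial_d b \<zeta> x) = - (LBINT x. G b x * \<zeta> x)"
    if b: "b \<in> Basis" and \<zeta>: "test_function ?\<Omega> \<zeta>" for b \<zeta>
  proof -
    obtain i where i: "b = axis i 1" using Basis_axis[OF b] by blast
    have c: "continuous_on UNIV \<zeta>" "continuous_on UNIV (partial_d b \<zeta>)"
      using test_function_C1c[OF \<zeta>] b unfolding C1c_def by blast+
    note [measurable] = w(1) G(1)[OF b] borel_measurable_continuous_onI[OF c(1)] borel_measurable_continuous_onI[OF c(2)]
    have "(\<integral>x. w0 x * partial_d b \<zeta> x \<partial>lebesgue_on ?\<Omega>) = (LBINT x. w x * partial_d b \<zeta> x)"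
      by (rule lebesgue_on_transfer(3)[OF \<Omega>]) (use w in \<open>auto elim!: eventually_mono\<close>)
    moreover have "(\<integral>x. G0 x $ i * \<zeta> x \<partial>lebesgue_on ?\<Omega>) = (LBINT x. G b x * \<zeta> x)"
    proof (rule lebesgue_on_transfer(3)[OF \<Omega>])
      show "(\<lambda>x. G b x * \<zeta> x) \<in> borel_measurable borel" by measurable
    qed (use G(2)[OF b] G(3)[OF b] in \<open>auto elim!: eventually_mono simp: i inner_axis\<close>)
    moreover have "(\<integral>x. w0 x * partial_d b \<zeta> x \<partial>lebesgue_on ?\<Omega>) = - (\<integral>x. G0 x $ i * \<zeta> x \<partial>lebesgue_on ?\<Omega>)"
      using H1 \<zeta> unfolding in_H1_def has_weak_partial_def i by blast
    ultimately show ?thesis by simp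
  qed
  have kernelQ: "(LBINT x. f x * mollifier (real (Suc k) *\<^sub>R (x - y))) =
      - (\<Sum>b\<in>Basis. LBINT x. G b x * (real (Suc k) * mollifier' b (real (Suc k) *\<^sub>R (x - y))))"
    if y: "y \<in> Q" and sub: "cbox y (y + (1 / real (Suc k)) *\<^sub>R One) \<subseteq> ?\<Omega>" for k y
  proof -
    let ?g = "mollifier_factors k y"
    note supp = mollifier_factors_supp[of y k]
    \<comment> \<open>The weak gradient is tested with the first derivative of the mollifier, which
      turns \<open>w\<close> against a second derivative into \<open>- G b\<close> against a first
      one.\<close>
    have t: "test_function ?\<Omega> (tensor (?g(b := deriv (?g b))))" for b
      by (rule tensor_test_function[OF tensor_supp_upd[OF supp] sub])
    have pd: "partial_d b (tensor (?g(b := deriv (?g b)))) = tensor (?g(b := deriv (deriv (?g b))))" if "b \<in> Basis" for b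
      using partial_d_tensor[OF that, of "?g(b := deriv (?g b))" 1] tensor_supp_smooth[OF tensor_supp_upd[OF supp, of b]]
      by simp
    have i: "integrable lborel (\<lambda>x. w x * tensor (?g(b := deriv (deriv (?g b)))) x)" for b
    proof -
      have s: "tensor_supp y (y + (1 / real (Suc k)) *\<^sub>R One) (?g(b := deriv (deriv (?g b))))"
        using tensor_supp_upd[OF tensor_supp_upd[OF supp, of b], of b] by simp
      obtain M where M: "\<And>z. \<bar>tensor (?g(b := deriv (deriv (?g b)))) z\<bar> \<le> M" using tensor_bounded[OF s] by blast
      show ?thesis
        by (intro sqint_mult ws sqint_bounded_support[OF _ bounded_cbox tensor_eq_0[OF s] M]
            borel_measurable_continuous_onI tensor_supp_continuous[OF s])
    qed
    have "(LBINT x. f x * tensor ?g x) =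
       (\<Sum>b\<in>Basis. LBINT x. w x * tensor (?g(b := deriv (deriv (?g b)))) x)"
      unfolding lap[OF y sub, symmetric] sum_distrib_left by (intro Bochner_Integration.integral_sum i)
    also have "\<dots> = (\<Sum>b\<in>Basis. - (LBINT x. G b x * tensor (?g(b := deriv (?g b))) x))"
    proof (rule sum.cong[OF refl])
      fix b :: "real^'n" assume b: "b \<in> Basis"
      show "(LBINT x. w x * tensor (?g(b := deriv (deriv (?g b)))) x) = - (LBINT x. G b x * tensor (?g(b := deriv (?g b))) x)"
        using weak[OF b t[of b]] unfolding pd[OF b] .
    qed
    also have "\<dots> = - (\<Sum>b\<in>Basis. LBINT x. G b x * (real (Suc k) * mollifier' b (real (Suc k) *\<^sub>R (x - y))))"
      unfolding sum_negf
      by (intro arg_cong[where f=uminus] sum.cong refl Bochner_Integration.integral_cong) (simp only: tensor_mollifier_factors')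
    finally show ?thesis unfolding tensor_mollifier_factors .
  qed
  have kernel: "(LBINT x. f x * mollifier (real (Suc k) *\<^sub>R (x - y))) =
      - (\<Sum>b\<in>Basis. LBINT x. G b x * (real (Suc k) * mollifier' b (real (Suc k) *\<^sub>R (x - y))))"
    if sub: "cbox y (y + (1 / real (Suc k)) *\<^sub>R One) \<subseteq> ?\<Omega>" for k y
  proof -
    define e where "e = (1 / real (Suc k)) *\<^sub>R (One :: real^'n)"
    have e0: "0 \<le> e \<bullet> b" if "b \<in> Basis" for b using that by (simp add: e_def)
    \<comment> \<open>\<open>S\<close> is the set of corners whose cube of side
      \<open>1 / (k + 1)\<close> stays in \<open>\<Omega>\<close>. It is open, so the dense set
      \<open>Q\<close> meets each of its neighbourhoods of \<open>y\<close>.\<close>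
    define S where "S = box (- a) (a - e)"
    have y: "y \<in> S"
    proof -
      have "y \<in> cbox y (y + e)" "y + e \<in> cbox y (y + e)" using e0 by (auto simp: mem_box inner_add_left)
      then have "y \<in> ?\<Omega>" "y + e \<in> ?\<Omega>" using sub unfolding e_def by blast+
      then show ?thesis unfolding S_def mem_box by (auto simp: inner_add_left inner_diff_left)
    qed
    have subS: "cbox z (z + e) \<subseteq> ?\<Omega>" if "z \<in> S" for z
    proof
      fix x assume x: "x \<in> cbox z (z + e)"
      show "x \<in> ?\<Omega>"
        unfolding mem_box
      proof
        fix b :: "real^'n" assume b: "b \<in> Basis"
        have "z \<bullet> b \<le> x \<bullet> b" "x \<bullet> b \<le> z \<bullet> b + e \<bullet> b" "- a \<bullet> b < z \<bullet> b" "z \<bullet> b < a \<bullet> b - e \<bullet> b"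
          using x that b unfolding S_def mem_box by (auto simp: inner_add_left inner_diff_left)
        then show "- a \<bullet> b < x \<bullet> b \<and> x \<bullet> b < a \<bullet> b" by linarith
      qed
    qed
    have "\<exists>z\<in>Q. z \<in> S \<inter> ball y (1 / real (Suc m))" for m
      using y by (intro dense open_Int open_ball) (auto simp: S_def)
    then obtain Y where Y: "\<And>m. Y m \<in> Q" "\<And>m. Y m \<in> S" "\<And>m. dist y (Y m) < 1 / real (Suc m)"
      by (metis IntE mem_ball)
    have Yl: "Y \<longlonglongrightarrow> y"
    proof (rule metric_LIMSEQ_I)
      fix r :: real assume "0 < r"
      then obtain N where "1 / real (Suc N) < r" using nat_approx_posE by blast
      then have "dist (Y m) y < r" if "N \<le> m" for m
        using Y(3)[of m] that by (smt (verit) dist_commute frac_le of_nat_Suc of_nat_0_less_iff zero_less_Suc of_nat_le_iff Suc_le_mono)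
      then show "\<exists>N. \<forall>m\<ge>N. dist (Y m) y < r" by blast
    qed
    obtain M where M: "\<And>z::real^'n. \<bar>mollifier z\<bar> \<le> M" using tensor_bounded[OF mollifier_supp] by blast
    have l: "(\<lambda>m. LBINT x. f x * mollifier (real (Suc k) *\<^sub>R (x - Y m))) \<longlonglongrightarrow>
        (LBINT x. f x * mollifier (real (Suc k) *\<^sub>R (x - y)))"
      by (rule kernel_integral_continuous[OF f tensor_supp_continuous[OF mollifier_supp] M Yl])
    have r: "(\<lambda>m. - (\<Sum>b\<in>Basis. LBINT x. G b x * (real (Suc k) * mollifier' b (real (Suc k) *\<^sub>R (x - Y m))))) \<longlonglongrightarrow>
        - (\<Sum>b\<in>Basis. LBINT x. G b x * (real (Suc k) * mollifier' b (real (Suc k) *\<^sub>R (x - y))))"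
    proof (intro tendsto_minus tendsto_sum)
      fix b :: "real^'n" assume b: "b \<in> Basis"
      obtain M where M: "\<And>z::real^'n. \<bar>mollifier' b z\<bar> \<le> M" using tensor_bounded[OF mollifier'_supp] by blast
      show "(\<lambda>m. LBINT x. G b x * (real (Suc k) * mollifier' b (real (Suc k) *\<^sub>R (x - Y m)))) \<longlonglongrightarrow>
         (LBINT x. G b x * (real (Suc k) * mollifier' b (real (Suc k) *\<^sub>R (x - y))))"
        by (rule kernel_integral_continuous[OF Gi[OF b], where k="\<lambda>z. real (Suc k) * mollifier' b z" and M="real (Suc k) * M", OF _ _ Yl])
          (use M in \<open>auto simp: abs_mult intro!: mult_left_mono continuous_intros tensor_supp_continuous[OF mollifier'_supp] simp del: of_nat_Suc\<close>)
    qed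
    have eq: "(LBINT x. f x * mollifier (real (Suc k) *\<^sub>R (x - Y m))) =
        - (\<Sum>b\<in>Basis. LBINT x. G b x * (real (Suc k) * mollifier' b (real (Suc k) *\<^sub>R (x - Y m))))" for m
      using kernelQ[OF Y(1)] subS[OF Y(2)] unfolding e_def by blast
    show ?thesis using LIMSEQ_unique[OF l[unfolded eq] r] .
  qed
  have "slice_data (- a) a f w G \<phi> (\<lambda>j b. partial_d b (\<phi> j))"
    by unfold_locales (use f ws Gs C lim_w lim_G weak_divergence_C1c[OF f Gi kernel] in auto)
  then show ?thesis by blast
qed

section \<open>From space-time identities to almost every time slice\<close>

lemma lborel_Fubini:
  fixes H :: "real \<times> 'b::euclidean_space \<Rightarrow> real"
  assumes "integrable lborel H"
  shows "AE t in lborel. integrable lborel (\<lambda>x. H (t, x))" "integrable lborel (\<lambda>t. LBINT x. H (t, x))"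
    "(LBINT t. (LBINT x. H (t, x))) = (LBINT z. H z)"
    "AE x in lborel. integrable lborel (\<lambda>t. H (t, x))" "integrable lborel (\<lambda>x. LBINT t. H (t, x))"
    "(LBINT x. (LBINT t. H (t, x))) = (LBINT z. H z)"
proof -
  have i: "integrable (lborel \<Otimes>\<^sub>M lborel) H" using assms by (simp add: lborel_prod)
  then have i': "integrable (lborel \<Otimes>\<^sub>M lborel) (\<lambda>(t, x). H (t, x))" by simp
  show "AE t in lborel. integrable lborel (\<lambda>x. H (t, x))" by (rule lborel_pair.AE_integrable_fst'[OF i])
  show "integrable lborel (\<lambda>t. LBINT x. H (t, x))" by (rule lborel_pair.integrable_fst'[OF i])
  show "(LBINT t. (LBINT x. H (t, x))) = (LBINT z. H z)"
    using lborel_pair.integral_fst'[OF i] by (simp add: lborel_prod)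
  show "AE x in lborel. integrable lborel (\<lambda>t. H (t, x))" using lborel_pair.AE_integrable_snd[OF i'] by simp
  show "integrable lborel (\<lambda>x. LBINT t. H (t, x))" using lborel_pair.integrable_snd[OF i'] by simp
  show "(LBINT x. (LBINT t. H (t, x))) = (LBINT z. H z)"
    using lborel_pair.integral_snd[OF i'] by (simp add: lborel_prod)
qed

lemma integrable_times_bounded:
  fixes H k :: "'a::euclidean_space \<Rightarrow> real"
  assumes H: "integrable lborel H" and k: "k \<in> borel_measurable borel" "\<And>z. \<bar>k z\<bar> \<le> M"
  shows "integrable lborel (\<lambda>z. H z * k z)"
proof (rule Bochner_Integration.integrable_bound[where f="\<lambda>z. H z * M"])
  show "AE z in lborel. norm (H z * k z) \<le> norm (H z * M)"
  proof (rule AE_I2)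
    fix z have "\<bar>k z\<bar> \<le> \<bar>M\<bar>" using k(2)[of z] by linarith
    then show "norm (H z * k z) \<le> norm (H z * M)" by (simp add: abs_mult mult_left_mono)
  qed
  show "(\<lambda>z. H z * k z) \<in> borel_measurable lborel" using borel_measurable_integrable[OF H] k(1) by simp
qed (use H in simp)

lemma AE_lborel_pair:
  assumes "AE z in lborel. P (z :: real \<times> 'b::euclidean_space)"
  shows "AE t in lborel. AE x in lborel. P (t, x)"
  using assms unfolding lborel_prod[symmetric] by (rule lborel_pair.AE_pair)

context energy_solution
begin

abbreviation "\<Omega> \<equiv> box (- a) a"

lemma U_slice: "AE t in lborel. t \<in> {0<..<T} \<longrightarrow> (AE x in lborel. x \<in> \<Omega> \<longrightarrow> U (t, x) = u t x)"
proof -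
  have "AE t in lborel. AE x in lborel. (t, x) \<in> {0<..<T} \<times> \<Omega> \<longrightarrow> U (t, x) = u (fst (t, x)) (snd (t, x))"
    by (rule AE_lborel_pair[OF U_eq])
  then show ?thesis by eventually_elim auto
qed

lemma U_slice_meas: "(\<lambda>x. U (t, x)) \<in> borel_measurable borel"
  using U_meas by (auto intro!: measurable_compose[OF borel_measurable_continuous_onI] continuous_intros)

lemma F_cut:
  assumes "0 < s" "t < T"
  shows "integrable lborel (\<lambda>z. indicator {s..t} (fst z) * F z)"
proof (cases "s \<le> t")
  case True
  \<comment> \<open>Integrability of \<open>F\<close> is available on open intervals
    \<open>(\<tau>, T)\<close>; halving \<open>s\<close> gives one that contains the closed interval
    \<open>{s..t}\<close>.\<close>
  let ?\<tau> = "s / 2"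
  have \<tau>: "?\<tau> \<in> {0<..<T}" using assms True by auto
  have "indicator {s..t} (fst z) * F z = (indicator ({?\<tau><..<T} \<times> \<Omega>) z * F z) * indicator {s..t} (fst z)" for z :: "real \<times> (real^'n)"
    using assms F_out[of z] by (cases z) (auto simp: indicator_def)
  moreover have "integrable lborel (\<lambda>z. (indicator ({?\<tau><..<T} \<times> \<Omega>) z * F z) * indicator {s..t} (fst z))"
    by (rule integrable_times_bounded[OF F_int[OF \<tau>], where M=1]) (auto intro!: measurable_comp_fst simp: indicator_def)
  ultimately show ?thesis by (simp only:)
qed simp

text \<open>Testing with \<open>\<psi>(t) g(x)\<close> says that the difference \<open>h\<close> of
  the two slice integrals is orthogonal to every \<open>\<psi>\<close>, so the fundamental lemma in
  the time variable applies. The exceptional null set depends on \<open>g\<close>.\<close>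

lemma lap_slice_test:
  assumes g: "tensor_supp l r g" and sub: "cbox l r \<subseteq> \<Omega>"
  shows "AE t in lborel. t \<in> {0<..<T} \<longrightarrow>
    (LBINT x. (U (t, x))\<^sup>2 * (\<Sum>b\<in>Basis. tensor (g(b := deriv (deriv (g b)))) x)) =
    (LBINT x. 2 * F (t, x) * tensor g x)"
proof -
  define \<Delta> where "\<Delta> x = (\<Sum>b\<in>Basis. tensor (g(b := deriv (deriv (g b)))) x)" for x
  have gs: "tensor_supp l r (g(b := deriv (deriv (g b))))" for b
    using tensor_supp_upd[OF tensor_supp_upd[OF g, of b], of b] by simp
  have \<Delta>c: "continuous_on UNIV \<Delta>" unfolding \<Delta>_def by (intro continuous_intros tensor_supp_continuous[OF gs])
  have \<Delta>0: "\<And>x. x \<notin> cbox l r \<Longrightarrow> \<Delta> x = 0" unfolding \<Delta>_def by (intro sum.neutral ballI tensor_eq_0[OF gs])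
  obtain M where M: "\<And>x. \<bar>\<Delta> x\<bar> \<le> M"
    using continuous_compact_support_bounded(1)[OF \<Delta>c compact_cbox \<Delta>0] by blast
  obtain M' where M': "\<And>x. \<bar>tensor g x\<bar> \<le> M'" using tensor_bounded[OF g] by blast
  have [measurable]: "\<Delta> \<in> borel_measurable borel" "tensor g \<in> borel_measurable borel"
    by (intro borel_measurable_continuous_onI \<Delta>c tensor_supp_continuous[OF g])+
  note [measurable] = U_meas F_meas measurable_comp_snd[of \<Delta>] measurable_comp_snd[of "tensor g"]
  \<comment> \<open>On a compact time window inside \<open>(0, T)\<close> both \<open>U^2\<close> on
    the support of \<open>g\<close> and \<open>F\<close> are integrable; the open interval is
    exhausted by countably many windows afterwards.\<close>
  have part: "AE t in lborel. t \<in> box p q \<longrightarrow> (LBINT x. (U (t, x))\<^sup>2 * \<Delta> x) = (LBINT x. 2 * F (t, x) * tensor g x)"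
    if pq: "0 < p" "q < T" for p q
  proof -
    define K where "K = {p..q} \<times> cbox l r"
    have K: "compact K" "K \<subseteq> {0<..<T} \<times> \<Omega>" using pq sub by (auto simp: K_def intro: compact_Times)
    define H1 where "H1 z = indicator K z * (U z)\<^sup>2 * \<Delta> (snd z)" for z
    define H2 where "H2 z = indicator {p..q} (fst z) * F z * (2 * tensor g (snd z))" for z
    have H1: "integrable lborel H1"
      unfolding H1_def[abs_def]
      by (rule integrable_times_bounded[OF U2_int[OF K], where M=M]) (auto intro: measurable_comp_snd simp: M)
    have H2: "integrable lborel H2"
      unfolding H2_def[abs_def]
      by (rule integrable_times_bounded[OF F_cut[OF pq], where M="2 * M'"])
        (auto intro: measurable_comp_snd[of "\<lambda>x. 2 * tensor g x"] simp: abs_mult M')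
    define h where "h t = (LBINT x. H1 (t, x)) - (LBINT x. H2 (t, x))" for t
    have hi: "integrable lborel h"
      unfolding h_def[abs_def] using lborel_Fubini(2)[OF H1] lborel_Fubini(2)[OF H2] by simp
    have "AE t in lborel. t \<in> box p q \<longrightarrow> h t = 0"
    proof (rule AE_zero_of_tensor[OF hi])
      fix g' :: "real \<Rightarrow> real \<Rightarrow> real" and p' q' :: real
      assume g': "tensor_supp p' q' g'" and sub': "cbox p' q' \<subseteq> box p q"
      \<comment> \<open>The only basis vector of \<open>real\<close> is 1, so a tensor on the line
        has this single factor.\<close>
      define \<psi> where "\<psi> = g' 1"
      have \<psi>: "smooth_real \<psi>" "\<And>t. t \<notin> {p'..q'} \<Longrightarrow> \<psi> t = 0"
        using g' by (auto simp: tensor_supp_def \<psi>_def)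
      have \<psi>pq: "\<psi> t = 0" if "t \<notin> {p..q}" for t
      proof (rule \<psi>(2), rule notI)
        assume "t \<in> {p'..q'}"
        then have "t \<in> box p q" using sub' by auto
        then show False using that by auto
      qed
      have tg: "tensor g' t = \<psi> t" for t by (simp add: tensor_def \<psi>_def)
      obtain N where N: "\<And>t. \<bar>\<psi> t\<bar> \<le> N" using tensor_bounded[OF g'] tg by metis
      have [measurable]: "\<psi> \<in> borel_measurable borel" by (intro borel_measurable_continuous_onI smooth_real_cont \<psi>)
      have i1: "integrable lborel (\<lambda>z. H1 z * \<psi> (fst z))"
        by (rule integrable_times_bounded[OF H1, where M=N]) (auto intro: measurable_comp_fst simp: N)
      have i2: "integrable lborel (\<lambda>z. H2 z * \<psi> (fst z))"
        by (rule integrable_times_bounded[OF H2, where M=N]) (auto intro: measurable_comp_fst simp: N)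
      have "(LBINT t. h t * tensor g' t) =
        (LBINT t. (LBINT x. H1 (t, x) * \<psi> t) - (LBINT x. H2 (t, x) * \<psi> t))"
        unfolding tg h_def by (simp add: left_diff_distrib)
      also have "\<dots> = (LBINT t. (LBINT x. H1 (t, x) * \<psi> t)) - (LBINT t. (LBINT x. H2 (t, x) * \<psi> t))"
        using lborel_Fubini(2)[OF i1] lborel_Fubini(2)[OF i2] by (intro Bochner_Integration.integral_diff) simp_all
      also have "\<dots> = (LBINT z. H1 z * \<psi> (fst z)) - (LBINT z. H2 z * \<psi> (fst z))"
        using lborel_Fubini(3)[OF i1] lborel_Fubini(3)[OF i2] by simp
      also have "(LBINT z. H1 z * \<psi> (fst z)) = (LBINT z. (U z)\<^sup>2 * (\<psi> (fst z) * \<Delta> (snd z)))"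
      proof (rule Bochner_Integration.integral_cong[OF refl])
        fix z :: "real \<times> (real^'n)"
        show "H1 z * \<psi> (fst z) = (U z)\<^sup>2 * (\<psi> (fst z) * \<Delta> (snd z))"
        proof (cases "z \<in> K")
          case False
          then have "fst z \<notin> {p..q} \<or> snd z \<notin> cbox l r" by (auto simp: K_def mem_Times_iff)
          then have "\<psi> (fst z) = 0 \<or> \<Delta> (snd z) = 0" using \<psi>pq \<Delta>0 by blast
          then show ?thesis using False by (auto simp: H1_def)
        qed (simp add: H1_def)
      qed
      also have "(LBINT z. H2 z * \<psi> (fst z)) = (LBINT z. 2 * F z * (\<psi> (fst z) * tensor g (snd z)))"
      proof (rule Bochner_Integration.integral_cong[OF refl])
        fix z :: "real \<times> (real^'n)"
        show "H2 z * \<psi> (fst z) = 2 * F z * (\<psi> (fst z) * tensor g (snd z))"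
          using \<psi>pq[of "fst z"] by (cases "fst z \<in> {p..q}") (auto simp: H2_def)
      qed
      also have "(LBINT z. (U z)\<^sup>2 * (\<psi> (fst z) * \<Delta> (snd z))) = (LBINT z. 2 * F z * (\<psi> (fst z) * tensor g (snd z)))"
        unfolding \<Delta>_def
      proof (rule weak_lap[OF \<psi> g])
        show "{p'..q'} \<times> cbox l r \<subseteq> {0<..<T} \<times> \<Omega>" proof -
          have "{p'..q'} \<subseteq> {0<..<T}"
          proof
            fix t assume "t \<in> {p'..q'}"
            then have "t \<in> box p q" using sub' by auto
            then show "t \<in> {0<..<T}" using pq by auto
          qed
          then show ?thesis using sub by blast
        qed
      qed
      finally show "(LBINT t. h t * tensor g' t) = 0" by simp
    qed
    then show ?thesis
    proof eventually_elim
      case (elim t)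
      show ?case
      proof
        assume t: "t \<in> box p q"
        have "(LBINT x. H1 (t, x)) = (LBINT x. (U (t, x))\<^sup>2 * \<Delta> x)"
          using t \<Delta>0 by (intro Bochner_Integration.integral_cong) (auto simp: H1_def K_def indicator_def)
        moreover have "(LBINT x. H2 (t, x)) = (LBINT x. 2 * F (t, x) * tensor g x)"
          using t by (intro Bochner_Integration.integral_cong) (auto simp: H2_def indicator_def)
        ultimately show "(LBINT x. (U (t, x))\<^sup>2 * \<Delta> x) = (LBINT x. 2 * F (t, x) * tensor g x)"
          using elim t by (simp add: h_def)
      qed
    qed
  qed
  have "AE t in lborel. \<forall>n. t \<in> box (T / real (n + 2)) (T - T / real (n + 2)) \<longrightarrow>
     (LBINT x. (U (t, x))\<^sup>2 * \<Delta> x) = (LBINT x. 2 * F (t, x) * tensor g x)"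
    unfolding AE_all_countable using T_pos by (intro allI part) auto
  then show ?thesis unfolding \<Delta>_def[symmetric]
  proof eventually_elim
    case (elim t)
    show ?case
    proof
      assume t: "t \<in> {0<..<T}"
      obtain n where n: "T / real (n + 2) < t" using exhaust_time[of t T] t by auto
      obtain m where m: "T / real (m + 2) < T - t" using exhaust_time[of "T - t" T] t by auto
      have "T / real (max n m + 2) \<le> T / real (n + 2)" "T / real (max n m + 2) \<le> T / real (m + 2)"
        using T_pos by (intro divide_left_mono; simp)+
      then have "t \<in> box (T / real (max n m + 2)) (T - T / real (max n m + 2))" using n m by auto
      then show "(LBINT x. (U (t, x))\<^sup>2 * \<Delta> x) = (LBINT x. 2 * F (t, x) * tensor g x)"
        using elim by blast
    qed
  qed
qed

lemma F_slice_integrable: "AE t in lborel. t \<in> {0<..<T} \<longrightarrow> integrable lborel (\<lambda>x. F (t, x))"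
proof -
  have "AE t in lborel. \<forall>n. integrable lborel (\<lambda>x. indicator ({T / real (n + 2)<..<T} \<times> \<Omega>) (t, x) * F (t, x))"
    unfolding AE_all_countable
  proof
    fix n
    have "T / real (n + 2) \<in> {0<..<T}"
      using T_pos mult_pos_pos[of "1 + real n" T] by (auto simp: field_simps add_pos_nonneg)
    from lborel_Fubini(1)[OF F_int[OF this]]
    show "AE t in lborel. integrable lborel (\<lambda>x. indicator ({T / real (n + 2)<..<T} \<times> \<Omega>) (t, x) * F (t, x))" .
  qed
  then show ?thesis
  proof eventually_elim
    case (elim t)
    show ?case
    proof
      assume t: "t \<in> {0<..<T}"
      obtain n where n: "T / real (n + 2) < t" using exhaust_time[of t T] t by auto
      have "indicator ({T / real (n + 2)<..<T} \<times> \<Omega>) (t, x) * F (t, x) = F (t, x)" for x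
        using n t F_out[of "(t, x)"] by (auto simp: indicator_def)
      then show "integrable lborel (\<lambda>x. F (t, x))" using elim[rule_format, of n] by (simp only:)
    qed
  qed
qed

text \<open>Centres in a countable dense set and integer scales give countably many test functions,
  so the union of the null sets from \<open>lap_slice_test\<close> is still null.\<close>

lemma AE_slice_data:
  "AE t in lborel. t \<in> {0<..<T} \<longrightarrow>
    (\<exists>G \<phi> D\<phi>. slice_data (- a) a (\<lambda>x. 2 * F (t, x)) (\<lambda>x. (U (t, x))\<^sup>2) G \<phi> D\<phi>)"
proof -
  obtain Q :: "(real^'n) set" where Q: "countable Q" "\<And>S. open S \<Longrightarrow> S \<noteq> {} \<Longrightarrow> \<exists>y\<in>Q. y \<in> S"
    by (rule countable_dense_setE) blast
  have "AE t in lborel. \<forall>y\<in>Q. \<forall>k. cbox y (y + (1 / real (Suc k)) *\<^sub>R One) \<subseteq> \<Omega> \<longrightarrow> t \<in> {0<..<T} \<longrightarrow>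
      (LBINT x. (U (t, x))\<^sup>2 * (\<Sum>b\<in>Basis. tensor ((mollifier_factors k y)(b := deriv (deriv (mollifier_factors k y b)))) x)) =
      (LBINT x. 2 * F (t, x) * tensor (mollifier_factors k y) x)"
    unfolding AE_ball_countable[OF Q(1)] AE_all_countable
  proof (intro ballI allI)
    fix y k
    show "AE t in lborel. cbox y (y + (1 / real (Suc k)) *\<^sub>R One) \<subseteq> \<Omega> \<longrightarrow> t \<in> {0<..<T} \<longrightarrow>
      (LBINT x. (U (t, x))\<^sup>2 * (\<Sum>b\<in>Basis. tensor ((mollifier_factors k y)(b := deriv (deriv (mollifier_factors k y b)))) x)) =
      (LBINT x. 2 * F (t, x) * tensor (mollifier_factors k y) x)"
    proof (cases "cbox y (y + (1 / real (Suc k)) *\<^sub>R One) \<subseteq> \<Omega>")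
      case True
      from lap_slice_test[OF mollifier_factors_supp True] show ?thesis by eventually_elim blast
    qed simp
  qed
  then show ?thesis
    using F_slice_integrable H10 U_slice
  proof eventually_elim
    case (elim t)
    show ?case
    proof
      assume t: "t \<in> {0<..<T}"
      obtain G0 where G0: "in_H10 \<Omega> (\<lambda>x. (u t x)\<^sup>2) G0" using elim t by blast
      show "\<exists>G \<phi> D\<phi>. slice_data (- a) a (\<lambda>x. 2 * F (t, x)) (\<lambda>x. (U (t, x))\<^sup>2) G \<phi> D\<phi>"
      proof (rule slice_data_from_H10[OF G0 _ _ _ _ Q(2)])
        show "(\<lambda>x. (U (t, x))\<^sup>2) \<in> borel_measurable borel" using U_slice_meas[of t] by simp
        have "AE x in lborel. x \<in> \<Omega> \<longrightarrow> U (t, x) = u t x" using elim t by blast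
        then show "AE x in lborel. x \<in> \<Omega> \<longrightarrow> (u t x)\<^sup>2 = (U (t, x))\<^sup>2" by eventually_elim simp
      qed (use elim t U_out in auto)
    qed
  qed
qed

section \<open>Time increments of the solution\<close>

lemma u_integrable: "t \<in> {0..T} \<Longrightarrow> integrable (lebesgue_on (cbox (- a) a)) (u t)"
  using cont unfolding in_C_L1_def by blast

lemma u_representative:
  assumes "t \<in> {0..T}"
  shows "\<exists>w. integrable lborel w \<and> (\<forall>x. x \<notin> cbox (- a) a \<longrightarrow> w x = 0) \<and> (AE x in lborel. x \<in> cbox (- a) a \<longrightarrow> u t x = w x)"
proof -
  have m: "u t \<in> borel_measurable (lebesgue_on (cbox (- a) a))" using u_integrable[OF assms] by auto
  obtain w where w: "w \<in> borel_measurable borel" "\<And>x. x \<notin> cbox (- a) a \<Longrightarrow> w x = 0"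
    "AE x in lborel. x \<in> cbox (- a) a \<longrightarrow> u t x = w x"
    using borel_representative[OF _ m] by auto
  from lebesgue_on_transfer(2)[OF _ w] u_integrable[OF assms] have "integrable lborel w" by auto
  with w show ?thesis by blast
qed

text \<open>The test function is bounded by some \<open>M\<close>, so the pairings at two times
  differ by at most \<open>M\<close> times the \<open>L^1\<close> distance of the slices.\<close>

lemma pairing_continuous:
  assumes g: "tensor_supp l r g" and st: "{s..t} \<subseteq> {0..T}"
  shows "continuous_on {s..t} (\<lambda>r. \<integral>x. u r x * tensor g x \<partial>lebesgue_on (cbox (- a) a))"
  unfolding continuous_on_def
proof
  let ?L = "lebesgue_on (cbox (- a) a)" and ?V = "\<lambda>r. \<integral>x. u r x * tensor g x \<partial>lebesgue_on (cbox (- a) a)"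
  fix r0 assume r0: "r0 \<in> {s..t}"
  obtain M where M: "\<And>x. \<bar>tensor g x\<bar> \<le> M" using tensor_bounded[OF g] by blast
  have gm: "tensor g \<in> borel_measurable ?L"
    using borel_measurable_continuous_onI[OF tensor_supp_continuous[OF g]]
    by (intro measurable_restrict_space1 measurable_completion) simp
  have i: "integrable ?L (\<lambda>x. u r x * tensor g x)" if "r \<in> {0..T}" for r
  proof (rule Bochner_Integration.integrable_bound[where f="\<lambda>x. u r x * M"])
    show "AE x in ?L. norm (u r x * tensor g x) \<le> norm (u r x * M)"
    proof (rule AE_I2)
      fix x have "\<bar>tensor g x\<bar> \<le> \<bar>M\<bar>" using M[of x] by linarith
      then show "norm (u r x * tensor g x) \<le> norm (u r x * M)" by (simp add: abs_mult mult_left_mono)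
    qed
  qed (use u_integrable[OF that] gm in auto)
  have le: "norm (?V r - ?V r0) \<le> M * enn2real (L1_norm (cbox (- a) a) (\<lambda>x. u r x - u r0 x))" if r: "r \<in> {s..t}" for r
  proof -
    have rT: "r \<in> {0..T}" "r0 \<in> {0..T}" using r r0 st by auto
    have d: "integrable ?L (\<lambda>x. u r x - u r0 x)" using u_integrable rT by simp
    have "?V r - ?V r0 = (\<integral>x. (u r x - u r0 x) * tensor g x \<partial>?L)"
      using i rT by (simp add: left_diff_distrib)
    also have "\<bar>\<dots>\<bar> \<le> (\<integral>x. \<bar>u r x - u r0 x\<bar> * M \<partial>?L)"
      using d M by (intro abs_integral_le) (auto simp: abs_mult intro!: mult_left_mono)
    also have "\<dots> = M * (\<integral>x. \<bar>u r x - u r0 x\<bar> \<partial>?L)" by simp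
    also have "(\<integral>x. \<bar>u r x - u r0 x\<bar> \<partial>?L) = enn2real (L1_norm (cbox (- a) a) (\<lambda>x. u r x - u r0 x))"
      unfolding L1_norm_def using d by (subst nn_integral_eq_integral) auto
    finally show ?thesis by simp
  qed
  have "((\<lambda>r. L1_norm (cbox (- a) a) (\<lambda>x. u r x - u r0 x)) \<longlongrightarrow> 0) (at r0 within {s..t})"
    using cont r0 st unfolding in_C_L1_def by (meson subsetD tendsto_within_subset)
  then have "((\<lambda>r. enn2real (L1_norm (cbox (- a) a) (\<lambda>x. u r x - u r0 x))) \<longlongrightarrow> enn2real 0) (at r0 within {s..t})"
    by (intro tendsto_enn2real) auto
  then have "((\<lambda>r. M * enn2real (L1_norm (cbox (- a) a) (\<lambda>x. u r x - u r0 x))) \<longlongrightarrow> M * 0) (at r0 within {s..t})"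
    by (intro tendsto_mult tendsto_const) simp
  then have "((\<lambda>r. M * enn2real (L1_norm (cbox (- a) a) (\<lambda>x. u r x - u r0 x))) \<longlongrightarrow> 0) (at r0 within {s..t})"
    by (simp only: mult_zero_right)
  moreover have "\<forall>\<^sub>F r in at r0 within {s..t}. norm (?V r - ?V r0) \<le> M * enn2real (L1_norm (cbox (- a) a) (\<lambda>x. u r x - u r0 x))"
    unfolding eventually_at_filter by (intro always_eventually allI impI le)
  ultimately have "((\<lambda>r. ?V r - ?V r0) \<longlongrightarrow> 0) (at r0 within {s..t})"
    by (rule Lim_null_comparison[rotated])
  then show "(?V \<longlongrightarrow> ?V r0) (at r0 within {s..t})" by (rule LIM_zero_cancel)
qed

text \<open>For a fixed test function \<open>g\<close> the pairing \<open>V\<close> is continuous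
  with weak derivative \<open>A\<close>, so its increment is the integral of \<open>A\<close>;
  letting \<open>g\<close> vary gives the pointwise identity. Continuity of \<open>V\<close> is what
  makes this valid for every pair of interior times and not just for almost every pair.\<close>

lemma time_increment:
  assumes s: "0 < s" and st: "s < t" and t: "t < T"
  shows "AE x in lborel. x \<in> \<Omega> \<longrightarrow> u t x - u s x = (LBINT r. indicator {s..t} r * F (r, x))"
proof -
  let ?L = "lebesgue_on (cbox (- a) a)"
  define Fc where "Fc z = indicator {s..t} (fst z) * F z" for z
  have Fc: "integrable lborel Fc" unfolding Fc_def[abs_def] by (rule F_cut[OF s t])
  obtain wt where wt: "integrable lborel wt" "\<And>x. x \<notin> cbox (- a) a \<Longrightarrow> wt x = 0" "AE x in lborel. x \<in> cbox (- a) a \<longrightarrow> u t x = wt x"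
    using u_representative[of t] s st t by auto
  obtain ws where ws: "integrable lborel ws" "\<And>x. x \<notin> cbox (- a) a \<Longrightarrow> ws x = 0" "AE x in lborel. x \<in> cbox (- a) a \<longrightarrow> u s x = ws x"
    using u_representative[of s] s st t by auto
  \<comment> \<open>The defect of the claimed identity, written with integrable representatives so
    that the fundamental lemma can be applied to it in space.\<close>
  define f where "f x = wt x - ws x - (LBINT r. Fc (r, x))" for x
  have fi: "integrable lborel f" unfolding f_def[abs_def] using wt(1) ws(1) lborel_Fubini(5)[OF Fc] by simp
  have "AE x in lborel. x \<in> \<Omega> \<longrightarrow> f x = 0"
  proof (rule AE_zero_of_tensor[OF fi])
    fix g l r assume g: "tensor_supp l r g" and sub: "cbox l r \<subseteq> \<Omega>"
    obtain M where M: "\<And>x. \<bar>tensor g x\<bar> \<le> M" using tensor_bounded[OF g] by blast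
    have gm[measurable]: "tensor g \<in> borel_measurable borel" by (intro borel_measurable_continuous_onI tensor_supp_continuous[OF g])
    note gm2[measurable] = measurable_comp_snd[OF gm]
    define V where "V r = (\<integral>x. u r x * tensor g x \<partial>?L)" for r
    define A where "A r = (LBINT x. F (r, x) * tensor g x)" for r
    have Fg: "integrable lborel (\<lambda>z. Fc z * tensor g (snd z))"
      by (rule integrable_times_bounded[OF Fc, where M=M]) (auto simp: M gm2)
    have Ai: "indicator {s..t} r *\<^sub>R A r = (LBINT x. Fc (r, x) * tensor g x)" for r
      by (simp add: A_def Fc_def mult.assoc)
    have A: "set_integrable lborel {s..t} A"
      unfolding set_integrable_def Ai using lborel_Fubini(2)[OF Fg] by simp
    have "V t - V s = (LINT r:{s..t}|lborel. A r)"
    proof (rule weak_deriv_imp_integral[OF _ st A])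
      show Vc: "continuous_on {s..t} V"
        unfolding V_def using s t by (intro pairing_continuous[OF g]) auto
      fix \<psi> assume \<psi>: "smooth_real \<psi>" "\<And>r. r \<notin> {s..t} \<Longrightarrow> \<psi> r = 0"
      have d0: "deriv \<psi> r = 0" if "r \<notin> {s..t}" for r using deriv_eq_0_outside[OF \<psi>(2) that] .
      have "continuous_on UNIV (deriv \<psi>)" by (intro smooth_real_cont smooth_real_deriv \<psi>)
      then obtain N where N: "\<And>r. \<bar>deriv \<psi> r\<bar> \<le> N"
        using continuous_compact_support_bounded(1)[of "deriv \<psi>" "{s..t}"] d0 by auto
      obtain N0 where N0: "\<And>r. \<bar>\<psi> r\<bar> \<le> N0"
        using continuous_compact_support_bounded(1)[of \<psi> "{s..t}"] smooth_real_cont[OF \<psi>(1)] \<psi>(2) by auto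
      have pm: "\<psi> \<in> borel_measurable borel" and dm: "deriv \<psi> \<in> borel_measurable borel"
        by (intro borel_measurable_continuous_onI smooth_real_cont smooth_real_deriv \<psi>)+
      define K where "K = {s..t} \<times> cbox l r"
      have K: "compact K" "K \<subseteq> {0<..<T} \<times> \<Omega>" using s t sub by (auto simp: K_def intro: compact_Times)
      have iU: "integrable lborel (\<lambda>z. (indicator K z * U z) * (deriv \<psi> (fst z) * tensor g (snd z)))"
        by (rule integrable_times_bounded[OF U_int[OF K], where M="N * M"])
          (auto simp: abs_mult intro!: mult_mono N M borel_measurable_times measurable_comp_fst[OF dm] gm2 intro: order_trans[OF abs_ge_zero N])
      have Ueq: "(indicator K z * U z) * (deriv \<psi> (fst z) * tensor g (snd z)) = U z * (deriv \<psi> (fst z) * tensor g (snd z))" for z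
      proof (cases "z \<in> K")
        case False
        then have "fst z \<notin> {s..t} \<or> snd z \<notin> cbox l r" by (auto simp: K_def mem_Times_iff)
        then show ?thesis using d0[of "fst z"] tensor_eq_0[OF g, of "snd z"] False by auto
      qed simp
      have iU': "integrable lborel (\<lambda>z. U z * (deriv \<psi> (fst z) * tensor g (snd z)))" using iU unfolding Ueq .
      have "(LBINT r. V r * deriv \<psi> r) = (LBINT r. (LBINT x. U (r, x) * (deriv \<psi> r * tensor g x)))"
      proof (rule integral_cong_AE)
        have "(\<lambda>r. indicator {s..t} r *\<^sub>R V r) \<in> borel_measurable borel"
          by (intro borel_measurable_continuous_on_indicator Vc) simp
        then have "(\<lambda>r. (indicator {s..t} r *\<^sub>R V r) * deriv \<psi> r) \<in> borel_measurable lborel" using dm by simp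
        moreover have "(indicator {s..t} r *\<^sub>R V r) * deriv \<psi> r = V r * deriv \<psi> r" for r
          using d0[of r] by (cases "r \<in> {s..t}") auto
        ultimately show "(\<lambda>r. V r * deriv \<psi> r) \<in> borel_measurable lborel" by (simp only:)
        show "(\<lambda>r. LBINT x. U (r, x) * (deriv \<psi> r * tensor g x)) \<in> borel_measurable lborel"
          using borel_measurable_integrable[OF lborel_Fubini(2)[OF iU']] by simp
        show "AE r in lborel. V r * deriv \<psi> r = (LBINT x. U (r, x) * (deriv \<psi> r * tensor g x))"
          using U_slice
        proof eventually_elim
          case (elim r)
          show ?case
          proof (cases "r \<in> {s..t}")
            case True
            then have "AE x in lborel. x \<in> \<Omega> \<longrightarrow> U (r, x) = u r x" using elim s t by auto
            then have "AE x in lborel. x \<in> cbox (- a) a \<longrightarrow> u r x * tensor g x = U (r, x) * tensor g x"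
              using AE_cbox_box[of "- a" a] by eventually_elim auto
            moreover have "(\<lambda>x. U (r, x) * tensor g x) \<in> borel_measurable borel" using U_slice_meas[of r] by simp
            moreover have "U (r, x) * tensor g x = 0" if "x \<notin> cbox (- a) a" for x
              using that U_out[of "(r, x)"] box_subset_cbox[of "- a" a] by auto
            ultimately have "V r = (LBINT x. U (r, x) * tensor g x)"
              unfolding V_def by (intro lebesgue_on_transfer(3)) auto
            then show ?thesis by (simp add: mult_ac)
          next
            case False
            then show ?thesis by (simp add: d0)
          qed
        qed
      qed
      also have "\<dots> = (LBINT z. U z * (deriv \<psi> (fst z) * tensor g (snd z)))"
        using lborel_Fubini(3)[OF iU'] by simp
      also have "\<dots> = - (LBINT z. F z * (\<psi> (fst z) * tensor g (snd z)))"
        using K(2) unfolding K_def by (intro weak_time[OF \<psi> g]) auto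
      also have "(LBINT z. F z * (\<psi> (fst z) * tensor g (snd z))) = (LBINT z. (Fc z * tensor g (snd z)) * \<psi> (fst z))"
      proof (rule Bochner_Integration.integral_cong[OF refl])
        fix z :: "real \<times> (real^'n)"
        show "F z * (\<psi> (fst z) * tensor g (snd z)) = (Fc z * tensor g (snd z)) * \<psi> (fst z)"
          using \<psi>(2)[of "fst z"] by (cases "fst z \<in> {s..t}") (auto simp: Fc_def)
      qed
      also have "\<dots> = (LBINT r. (LBINT x. (Fc (r, x) * tensor g x) * \<psi> r))"
      proof -
        have "integrable lborel (\<lambda>z. (Fc z * tensor g (snd z)) * \<psi> (fst z))"
          by (rule integrable_times_bounded[OF Fg measurable_comp_fst[OF pm] N0])
        from lborel_Fubini(3)[OF this] show ?thesis by simp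
      qed
      also have "\<dots> = (LBINT r. A r * \<psi> r)"
      proof (rule Bochner_Integration.integral_cong[OF refl])
        fix r
        show "(LBINT x. (Fc (r, x) * tensor g x) * \<psi> r) = A r * \<psi> r"
          using Ai[of r] \<psi>(2)[of r] by (cases "r \<in> {s..t}") auto
      qed
      finally show "(LBINT r. V r * deriv \<psi> r) = - (LBINT r. A r * \<psi> r)" .
    qed
    moreover have "(LINT r:{s..t}|lborel. A r) = (LBINT x. (LBINT r. Fc (r, x)) * tensor g x)"
    proof -
      have "(LINT r:{s..t}|lborel. A r) = (LBINT z. Fc z * tensor g (snd z))"
        unfolding set_lebesgue_integral_def Ai using lborel_Fubini(3)[OF Fg] by simp
      also have "\<dots> = (LBINT x. (LBINT r. Fc (r, x) * tensor g x))"
        using lborel_Fubini(6)[OF Fg] by simp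
      finally show ?thesis by simp
    qed
    moreover have "V t = (LBINT x. wt x * tensor g x)"
      unfolding V_def using wt borel_measurable_integrable[OF wt(1)]
      by (intro lebesgue_on_transfer(3)) (auto elim!: eventually_mono)
    moreover have "V s = (LBINT x. ws x * tensor g x)"
      unfolding V_def using ws borel_measurable_integrable[OF ws(1)]
      by (intro lebesgue_on_transfer(3)) (auto elim!: eventually_mono)
    moreover have "(LBINT x. f x * tensor g x) = (LBINT x. wt x * tensor g x) - (LBINT x. ws x * tensor g x)
        - (LBINT x. (LBINT r. Fc (r, x)) * tensor g x)"
      unfolding f_def left_diff_distrib
      using integrable_times_bounded[OF wt(1) gm M] integrable_times_bounded[OF ws(1) gm M]
        integrable_times_bounded[OF lborel_Fubini(5)[OF Fc] gm M]
      by simp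
    ultimately show "(LBINT x. f x * tensor g x) = 0" by simp
  qed
  then show ?thesis using wt(3) ws(3)
  proof eventually_elim
    case (elim x)
    then show ?case using box_subset_cbox[of "- a" a] by (auto simp: f_def Fc_def subset_eq)
  qed
qed

end

section \<open>Smooth competitors\<close>

lemma measurable_zero_ext_open:
  fixes g :: "'a::euclidean_space \<Rightarrow> real"
  assumes "open S" "continuous_on S g"
  shows "(\<lambda>z. if z \<in> S then g z else 0) \<in> borel_measurable borel"
proof -
  have "(\<lambda>z. indicator S z *\<^sub>R g z) \<in> borel_measurable borel"
    by (intro borel_measurable_continuous_on_indicator assms) (use assms in simp)
  moreover have "(\<lambda>z. indicator S z *\<^sub>R g z) = (\<lambda>z. if z \<in> S then g z else 0)"
    by (auto simp: indicator_def)
  ultimately show ?thesis by simp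
qed

locale smooth_candidate =
  fixes a :: "real^'n" and T :: real and v :: "real \<Rightarrow> real^'n \<Rightarrow> real"
  assumes smooth: "smooth_up_to_boundary ({0..T} \<times> cbox (- a) a) (\<lambda>(t, x). v t x)"
    and boundary: "\<And>t x. t \<in> {0..T} \<Longrightarrow> x \<in> frontier (cbox (- a) a) \<Longrightarrow> v t x = 0"
begin

abbreviation "W \<equiv> {0<..<T} \<times> box (- a) a"
abbreviation "V \<equiv> (\<lambda>(t, x). v t x)"

lemma W_open: "open W" by (intro open_Times open_box) auto

lemma W_interior: "interior ({0..T} \<times> cbox (- a) a) = W"
  by (simp add: interior_Times interior_cbox)

lemma W_subset: "W \<subseteq> {0..T} \<times> cbox (- a) a"
  using box_subset_cbox[of "- a" a] by auto

lemma V_continuous: "continuous_on ({0..T} \<times> cbox (- a) a) V"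
  using smooth unfolding smooth_up_to_boundary_def by blast

lemma iter_differentiable: "set bs \<subseteq> Basis \<Longrightarrow> z \<in> W \<Longrightarrow> iter_partial bs V differentiable (at z)"
  using smooth unfolding smooth_up_to_boundary_def smooth_on_def W_interior by blast

lemma iter_continuous: "set bs \<subseteq> Basis \<Longrightarrow> continuous_on W (iter_partial bs V)"
  by (intro continuous_at_imp_continuous_on ballI differentiable_imp_continuous_within iter_differentiable)

text \<open>The uniform bound comes from the continuous extension to the compact closed cylinder; at
  boundary points the iterated partial derivatives themselves depend on arbitrary outside values of
  \<open>v\<close>.\<close>

lemma iter_bounded: "set bs \<subseteq> Basis \<Longrightarrow> \<exists>M. \<forall>z\<in>W. \<bar>iter_partial bs V z\<bar> \<le> M"
proof -
  assume "set bs \<subseteq> Basis"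
  then obtain g where g: "continuous_on ({0..T} \<times> cbox (- a) a) g" "\<And>z. z \<in> W \<Longrightarrow> g z = iter_partial bs V z"
    using smooth unfolding smooth_up_to_boundary_def W_interior by blast
  have "compact ({0..T} \<times> cbox (- a) a)" by (intro compact_Times) auto
  then obtain M where M: "\<And>z. z \<in> {0..T} \<times> cbox (- a) a \<Longrightarrow> \<bar>g z\<bar> \<le> M"
    using continuous_on_compact_abs_bound[OF g(1)] by blast
  have "\<bar>iter_partial bs V z\<bar> \<le> M" if "z \<in> W" for z
    using M[OF subsetD[OF W_subset that]] unfolding g(2)[OF that] .
  then show ?thesis by blast
qed

lemma iter_DERIV:
  assumes "set bs \<subseteq> Basis" "z \<in> W"
  shows "((\<lambda>h. iter_partial bs V (z + h *\<^sub>R c)) has_real_derivative iter_partial (c # bs) V z) (at 0)"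
proof -
  have "(\<lambda>h. iter_partial bs V (z + h *\<^sub>R c)) differentiable (at 0)"
    by (rule differentiable_compose[where f="iter_partial bs V" and g="\<lambda>h. z + h *\<^sub>R c"])
      (use iter_differentiable[OF assms] in \<open>auto intro!: derivative_intros\<close>)
  then obtain d where "((\<lambda>h. iter_partial bs V (z + h *\<^sub>R c)) has_real_derivative d) (at 0)"
    using real_differentiable_def by blast
  then show ?thesis by (simp add: partial_d_def DERIV_imp_deriv)
qed

text \<open>The derivatives are cut off to zero outside the open cylinder, where \<open>partial_d\<close> depends on the arbitrary values of \<open>v\<close>.\<close>

definition vt :: "real \<times> (real^'n) \<Rightarrow> real" where
  "vt z = (if z \<in> W then iter_partial [(1, 0)] V z else 0)"

definition v0 :: "real \<times> (real^'n) \<Rightarrow> real" where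
  "v0 z = (if z \<in> W then V z else 0)"

definition Dv :: "real^'n \<Rightarrow> real \<times> (real^'n) \<Rightarrow> real" where
  "Dv b z = (if b \<in> Basis \<and> z \<in> W then iter_partial [(0, b)] V z else 0)"

definition DDv :: "real^'n \<Rightarrow> real \<times> (real^'n) \<Rightarrow> real" where
  "DDv b z = (if b \<in> Basis \<and> z \<in> W then iter_partial [(0, b), (0, b)] V z else 0)"

definition Lap :: "real \<times> (real^'n) \<Rightarrow> real" where
  "Lap z = (\<Sum>b\<in>Basis. 2 * (Dv b z)\<^sup>2 + 2 * v0 z * DDv b z)"

text \<open>The Borel version of \<open>residual\<close>: equal to it on the open cylinder and 0
  elsewhere, which alters the integrals in question on a null set only.\<close>

definition R :: "real \<times> (real^'n) \<Rightarrow> real" where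
  "R z = vt z - 1 / 2 * Lap z"

lemma Basis_time: "((1::real), (0::real^'n)) \<in> Basis"
  and Basis_space: "b \<in> Basis \<Longrightarrow> ((0::real), b::real^'n) \<in> Basis"
  by (auto simp: Basis_prod_def)

lemma derivs_bounded: "\<exists>M. (\<forall>z. \<bar>vt z\<bar> \<le> M) \<and> (\<forall>b z. \<bar>Dv b z\<bar> \<le> M) \<and> (\<forall>b z. \<bar>DDv b z\<bar> \<le> M) \<and> (\<forall>z. \<bar>v0 z\<bar> \<le> M)"
proof -
  obtain M1 where M1: "\<And>z. z \<in> W \<Longrightarrow> \<bar>iter_partial [(1, 0)] V z\<bar> \<le> M1"
    using iter_bounded[of "[(1, 0)]"] Basis_time by auto
  obtain M0 where M0: "\<And>z. z \<in> W \<Longrightarrow> \<bar>V z\<bar> \<le> M0"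
    using iter_bounded[of "[]"] by auto
  have "\<forall>b\<in>Basis. \<exists>M. \<forall>z\<in>W. \<bar>iter_partial [(0, b)] V z\<bar> \<le> M"
    using iter_bounded[of "[(0, b)]" for b] Basis_space by auto
  from bchoice[OF this] obtain M2 where M2: "\<And>b z. b \<in> Basis \<Longrightarrow> z \<in> W \<Longrightarrow> \<bar>iter_partial [(0, b)] V z\<bar> \<le> M2 b" by blast
  have "\<forall>b\<in>Basis. \<exists>M. \<forall>z\<in>W. \<bar>iter_partial [(0, b), (0, b)] V z\<bar> \<le> M"
    using iter_bounded[of "[(0, b), (0, b)]" for b] Basis_space by auto
  from bchoice[OF this] obtain M3 where M3: "\<And>b z. b \<in> Basis \<Longrightarrow> z \<in> W \<Longrightarrow> \<bar>iter_partial [(0, b), (0, b)] V z\<bar> \<le> M3 b" by blast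
  define M where "M = \<bar>M0\<bar> + \<bar>M1\<bar> + (\<Sum>b\<in>Basis. \<bar>M2 b\<bar>) + (\<Sum>b\<in>Basis. \<bar>M3 b\<bar>)"
  have s: "\<bar>M2 b\<bar> \<le> (\<Sum>b\<in>Basis. \<bar>M2 b\<bar>)" "\<bar>M3 b\<bar> \<le> (\<Sum>b\<in>Basis. \<bar>M3 b\<bar>)" if "b \<in> Basis" for b
    using that by (intro member_le_sum; simp)+
  have p: "0 \<le> (\<Sum>b\<in>(Basis::(real^'n) set). \<bar>M2 b\<bar>)" "0 \<le> (\<Sum>b\<in>(Basis::(real^'n) set). \<bar>M3 b\<bar>)" by (intro sum_nonneg; simp)+
  have "0 \<le> M" using p by (simp add: M_def)
  show ?thesis
  proof (intro exI[of _ M] conjI allI)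
    show "\<bar>vt z\<bar> \<le> M" for z
    proof (cases "z \<in> W")
      case True
      then have "\<bar>vt z\<bar> \<le> M1" using M1[of z] unfolding vt_def by (simp only: if_True simp_thms)
      then show ?thesis using p unfolding M_def by linarith
    next
      case False
      then have "vt z = 0" unfolding vt_def by (rule if_not_P)
      then show ?thesis using \<open>0 \<le> M\<close> by simp
    qed
    show "\<bar>v0 z\<bar> \<le> M" for z
    proof (cases "z \<in> W")
      case True
      then have "\<bar>v0 z\<bar> \<le> M0" using M0[of z] unfolding v0_def by (simp only: if_True simp_thms)
      then show ?thesis using p unfolding M_def by linarith
    next
      case False
      then have "v0 z = 0" unfolding v0_def by (rule if_not_P)
      then show ?thesis using \<open>0 \<le> M\<close> by simp
    qed
    show "\<bar>Dv b z\<bar> \<le> M" for b z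
    proof (cases "b \<in> Basis \<and> z \<in> W")
      case True
      then have "\<bar>Dv b z\<bar> \<le> M2 b" using M2[of b z] by (simp only: Dv_def if_True simp_thms)
      then show ?thesis using s(1)[of b] True p unfolding M_def by linarith
    next
      case False
      then have "Dv b z = 0" unfolding Dv_def by (rule if_not_P)
      then show ?thesis using \<open>0 \<le> M\<close> by simp
    qed
    show "\<bar>DDv b z\<bar> \<le> M" for b z
    proof (cases "b \<in> Basis \<and> z \<in> W")
      case True
      then have "\<bar>DDv b z\<bar> \<le> M3 b" using M3[of b z] by (simp only: DDv_def if_True simp_thms)
      then show ?thesis using s(2)[of b] True p unfolding M_def by linarith
    next
      case False
      then have "DDv b z = 0" unfolding DDv_def by (rule if_not_P)
      then show ?thesis using \<open>0 \<le> M\<close> by simp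
    qed
  qed
qed

lemma vt_meas: "vt \<in> borel_measurable borel"
  unfolding vt_def[abs_def] using Basis_time by (intro measurable_zero_ext_open W_open iter_continuous) auto

lemma v0_meas: "v0 \<in> borel_measurable borel"
  unfolding v0_def[abs_def] by (intro measurable_zero_ext_open W_open continuous_on_subset[OF V_continuous W_subset])

lemma Dv_meas: "b \<in> Basis \<Longrightarrow> Dv b \<in> borel_measurable borel"
  unfolding Dv_def[abs_def] using measurable_zero_ext_open[OF W_open iter_continuous[of "[(0, b)]"]] Basis_space by simp

lemma DDv_meas: "b \<in> Basis \<Longrightarrow> DDv b \<in> borel_measurable borel"
  unfolding DDv_def[abs_def] using measurable_zero_ext_open[OF W_open iter_continuous[of "[(0, b), (0, b)]"]] Basis_space by simp

lemma Lap_meas: "Lap \<in> borel_measurable borel"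
  unfolding Lap_def[abs_def]
  by (intro borel_measurable_sum borel_measurable_add borel_measurable_times borel_measurable_power
      borel_measurable_const Dv_meas DDv_meas v0_meas)

lemma R_meas: "R \<in> borel_measurable borel"
  unfolding R_def[abs_def] using vt_meas Lap_meas by simp

lemma out_zero: "z \<notin> W \<Longrightarrow> vt z = 0" "z \<notin> W \<Longrightarrow> v0 z = 0" "z \<notin> W \<Longrightarrow> Lap z = 0" "z \<notin> W \<Longrightarrow> R z = 0"
proof -
  assume z: "z \<notin> W"
  show 1: "vt z = 0" and 2: "v0 z = 0" unfolding vt_def v0_def by (rule if_not_P[OF z])+
  have "Dv b z = 0" for b unfolding Dv_def using z by (intro if_not_P) blast
  then show 3: "Lap z = 0" unfolding Lap_def by (simp add: 2)
  show "R z = 0" unfolding R_def by (simp add: 1 3)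
qed

lemma R_bounded: "\<exists>M. \<forall>z. \<bar>R z\<bar> \<le> M"
proof -
  obtain M where M: "\<And>z. \<bar>vt z\<bar> \<le> M" "\<And>b z. \<bar>Dv b z\<bar> \<le> M" "\<And>b z. \<bar>DDv b z\<bar> \<le> M" "\<And>z. \<bar>v0 z\<bar> \<le> M"
    using derivs_bounded by blast
  have M0: "0 \<le> M" using M(1)[of undefined] by linarith
  have "\<bar>R z\<bar> \<le> M + (\<Sum>b\<in>(Basis::(real^'n) set). 2 * M\<^sup>2)" for z
  proof -
    have "\<bar>2 * (Dv b z)\<^sup>2 + 2 * v0 z * DDv b z\<bar> \<le> 4 * M\<^sup>2" for b
    proof -
      have "(Dv b z)\<^sup>2 \<le> M\<^sup>2" using power_mono[OF M(2)[of b z] abs_ge_zero, of 2] by simp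
      moreover have "\<bar>v0 z * DDv b z\<bar> \<le> M\<^sup>2"
        unfolding abs_mult power2_eq_square using M M0 by (intro mult_mono) auto
      moreover have "2 * v0 z * DDv b z = 2 * (v0 z * DDv b z)" by simp
      ultimately show ?thesis using zero_le_power2[of "Dv b z"] unfolding abs_le_iff by linarith
    qed
    then have "\<bar>Lap z\<bar> \<le> (\<Sum>b\<in>(Basis::(real^'n) set). 4 * M\<^sup>2)"
      unfolding Lap_def by (intro order_trans[OF sum_abs] sum_mono)
    then show ?thesis using M(1)[of z] unfolding R_def by (simp add: abs_le_iff)
  qed
  then show ?thesis by blast
qed

lemma slice_continuous:
  assumes t: "t \<in> {0..T}"
  shows "continuous_on (cbox (- a) a) (v t)"
proof -
  have "continuous_on (cbox (- a) a) (\<lambda>x. V (t, x))"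
    by (intro continuous_on_compose2[OF V_continuous] continuous_intros) (use t in auto)
  then show ?thesis by simp
qed

lemma smooth_slice:
  assumes t: "t \<in> {0<..<T}"
  shows "\<exists>M. smooth_slice (- a) a (\<lambda>x. v0 (t, x)) (\<lambda>b x. Dv b (t, x)) (\<lambda>b x. DDv b (t, x)) M"
proof -
  obtain M where M: "\<And>b z. \<bar>Dv b z\<bar> \<le> M" "\<And>b z. \<bar>DDv b z\<bar> \<le> M" using derivs_bounded by blast
  have W: "(t, x) \<in> W \<longleftrightarrow> x \<in> box (- a) a" for x using t by auto
  have line: "(t, x + h *\<^sub>R b) = (t, x) + h *\<^sub>R (0, b)" for x b and h :: real by simp
  have ev: "\<forall>\<^sub>F h in nhds 0. (t, x + h *\<^sub>R b) \<in> W" if "x \<in> box (- a) a" for x b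
    using eventually_line_in_open[OF open_box that] by eventually_elim (use W in auto)
  have "smooth_slice (- a) a (\<lambda>x. v0 (t, x)) (\<lambda>b x. Dv b (t, x)) (\<lambda>b x. DDv b (t, x)) M"
  proof
    have "continuous_on (cbox (- a) a \<union> - box (- a) a) (\<lambda>x. v0 (t, x))"
    proof (rule continuous_on_closed_Un)
      \<comment> \<open>The boundary condition makes the slice agree with its zero extension on the
        closed box, so the two closed pieces glue to a continuous function.\<close>
      have eq: "v t x = v0 (t, x)" if "x \<in> cbox (- a) a" for x
        using that boundary[of t x] t W[of x] by (cases "x \<in> box (- a) a") (auto simp: v0_def frontier_cbox)
      have "continuous_on (cbox (- a) a) (v t)" using t by (intro slice_continuous) auto
      then show "continuous_on (cbox (- a) a) (\<lambda>x. v0 (t, x))" by (rule continuous_on_eq) (rule eq)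
      show "continuous_on (- box (- a) a) (\<lambda>x. v0 (t, x))"
        by (rule continuous_on_eq[OF continuous_on_const[of _ 0]]) (use W in \<open>auto simp: v0_def\<close>)
    qed auto
    moreover have "cbox (- a) a \<union> - box (- a) a = UNIV" using box_subset_cbox[of "- a" a] by auto
    ultimately show "continuous_on UNIV (\<lambda>x. v0 (t, x))" by simp
    show "v0 (t, x) = 0" if "x \<notin> box (- a) a" for x using that W out_zero(2) by blast
    show "Dv b (t, x) = 0" if "x \<notin> box (- a) a" for b x using that W by (simp add: Dv_def)
    show "DDv b (t, x) = 0" if "x \<notin> box (- a) a" for b x using that W by (simp add: DDv_def)
    fix b :: "real^'n" assume b: "b \<in> Basis"
    have bs: "set [(0, b)] \<subseteq> (Basis :: (real \<times> (real^'n)) set)" "set [(0, b), (0, b)] \<subseteq> (Basis :: (real \<times> (real^'n)) set)"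
      using b Basis_space by auto
    have "continuous_on (box (- a) a) (\<lambda>x. iter_partial [(0, b)] V (t, x))"
      by (intro continuous_on_compose2[OF iter_continuous[OF bs(1)]] continuous_intros) (use t in auto)
    then show "continuous_on (box (- a) a) (\<lambda>x. Dv b (t, x))"
      by (rule continuous_on_eq) (use t b in \<open>simp add: Dv_def\<close>)
    have "continuous_on (box (- a) a) (\<lambda>x. iter_partial [(0, b), (0, b)] V (t, x))"
      by (intro continuous_on_compose2[OF iter_continuous[OF bs(2)]] continuous_intros) (use t in auto)
    then show "continuous_on (box (- a) a) (\<lambda>x. DDv b (t, x))"
      by (rule continuous_on_eq) (use t b in \<open>simp add: DDv_def\<close>)
    fix x assume x: "x \<in> box (- a) a"
    then have xW: "(t, x) \<in> W" using W by blast
    show "((\<lambda>h. v0 (t, x + h *\<^sub>R b)) has_real_derivative Dv b (t, x)) (at 0)"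
    proof -
      have "((\<lambda>h. V (t, x + h *\<^sub>R b)) has_real_derivative Dv b (t, x)) (at 0)"
        using iter_DERIV[of "[]" "(t, x)" "(0, b)", OF _ xW] xW b unfolding line by (simp add: Dv_def)
      moreover have "\<forall>\<^sub>F h in nhds 0. v0 (t, x + h *\<^sub>R b) = V (t, x + h *\<^sub>R b)"
        using ev[OF x, of b] by eventually_elim (simp only: v0_def if_True)
      ultimately show ?thesis by (subst DERIV_cong_ev[OF refl _ refl, where g="\<lambda>h. V (t, x + h *\<^sub>R b)"])
    qed
    show "((\<lambda>h. Dv b (t, x + h *\<^sub>R b)) has_real_derivative DDv b (t, x)) (at 0)"
    proof -
      have "((\<lambda>h. iter_partial [(0, b)] V (t, x + h *\<^sub>R b)) has_real_derivative DDv b (t, x)) (at 0)"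
        using iter_DERIV[of "[(0, b)]" "(t, x)" "(0, b)", OF bs(1) xW] xW b unfolding line by (simp add: DDv_def)
      moreover have "\<forall>\<^sub>F h in nhds 0. Dv b (t, x + h *\<^sub>R b) = iter_partial [(0, b)] V (t, x + h *\<^sub>R b)"
        using ev[OF x, of b] by eventually_elim (use b in \<open>simp only: Dv_def if_True simp_thms\<close>)
      ultimately show ?thesis by (subst DERIV_cong_ev[OF refl _ refl, where g="\<lambda>h. iter_partial [(0, b)] V (t, x + h *\<^sub>R b)"])
    qed
  qed (use M in auto)
  then show ?thesis by blast
qed

lemma Lap_slice:
  assumes "smooth_slice (- a) a (\<lambda>x. v0 (t, x)) (\<lambda>b x. Dv b (t, x)) (\<lambda>b x. DDv b (t, x)) M"
  shows "smooth_slice.L (\<lambda>x. v0 (t, x)) (\<lambda>b x. Dv b (t, x)) (\<lambda>b x. DDv b (t, x)) = (\<lambda>x. Lap (t, x))"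
  using smooth_slice.L_def[OF assms] by (auto simp: Lap_def)

lemma residual_eq_R:
  assumes z: "(t, x) \<in> W"
  shows "residual v t x = R (t, x)"
proof -
  have t: "t \<in> {0<..<T}" and x: "x \<in> box (- a) a" using z by auto
  obtain M where "smooth_slice (- a) a (\<lambda>x. v0 (t, x)) (\<lambda>b x. Dv b (t, x)) (\<lambda>b x. DDv b (t, x)) M"
    using smooth_slice[OF t] by blast
  then interpret s: smooth_slice "- a" a "\<lambda>x. v0 (t, x)" "\<lambda>b x. Dv b (t, x)" "\<lambda>b x. DDv b (t, x)" M .
  have "((\<lambda>h. v (h + t) x) has_real_derivative vt (t, x)) (at 0)"
    using iter_DERIV[of "[]" "(t, x)" "(1, 0)", OF _ z] z by (simp add: vt_def add.commute)
  then have "((\<lambda>s. v s x) has_real_derivative vt (t, x)) (at (0 + t))"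
    by (subst DERIV_shift)
  then have dt: "deriv (\<lambda>s. v s x) t = vt (t, x)" by (simp add: DERIV_imp_deriv)
  have ev: "\<forall>\<^sub>F h in nhds 0. y + h *\<^sub>R b \<in> box (- a) a" if "y \<in> box (- a) a" for y b
    by (rule eventually_line_in_open[OF open_box that])
  have v0: "v0 (t, y) = v t y" if "y \<in> box (- a) a" for y using that t by (simp add: v0_def)
  \<comment> \<open>Established at every \<open>y\<close> in the open box, because the second
    derivative at \<open>x\<close> requires the formula for the first one in a
    neighbourhood.\<close>
  have d1: "partial_d b (\<lambda>y. (v t y)\<^sup>2) y = 2 * v0 (t, y) * Dv b (t, y)" if b: "b \<in> Basis" and y: "y \<in> box (- a) a" for b y
  proof -
    have "((\<lambda>h. (v0 (t, y + h *\<^sub>R b))\<^sup>2) has_real_derivative 2 * v0 (t, y) * Dv b (t, y)) (at 0)"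
      using DERIV_power[OF s.Dv(4)[OF b y], of 2] by (simp add: mult_ac)
    moreover have "\<forall>\<^sub>F h in nhds 0. (v t (y + h *\<^sub>R b))\<^sup>2 = (v0 (t, y + h *\<^sub>R b))\<^sup>2"
      using ev[OF y, of b] by eventually_elim (simp only: v0)
    ultimately have "((\<lambda>h. (v t (y + h *\<^sub>R b))\<^sup>2) has_real_derivative 2 * v0 (t, y) * Dv b (t, y)) (at 0)"
      by (subst DERIV_cong_ev[OF refl _ refl, where g="\<lambda>h. (v0 (t, y + h *\<^sub>R b))\<^sup>2"])
    then show ?thesis unfolding partial_d_def by (rule DERIV_imp_deriv)
  qed
  have d2: "partial_d b (partial_d b (\<lambda>y. (v t y)\<^sup>2)) x = 2 * (Dv b (t, x))\<^sup>2 + 2 * v0 (t, x) * DDv b (t, x)" if b: "b \<in> Basis" for b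
  proof -
    have "\<forall>\<^sub>F h in nhds 0. partial_d b (\<lambda>y. (v t y)\<^sup>2) (x + h *\<^sub>R b) = 2 * v0 (t, x + h *\<^sub>R b) * Dv b (t, x + h *\<^sub>R b)"
      using ev[OF x, of b] by eventually_elim (rule d1[OF b])
    with s.flux_deriv[OF b x]
    have "((\<lambda>h. partial_d b (\<lambda>y. (v t y)\<^sup>2) (x + h *\<^sub>R b)) has_real_derivative 2 * (Dv b (t, x))\<^sup>2 + 2 * v0 (t, x) * DDv b (t, x)) (at 0)"
      by (subst DERIV_cong_ev[OF refl _ refl, where g="\<lambda>h. 2 * v0 (t, x + h *\<^sub>R b) * Dv b (t, x + h *\<^sub>R b)"])
    then show ?thesis unfolding partial_d_def[of b "partial_d b _"] by (rule DERIV_imp_deriv)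
  qed
  show ?thesis unfolding residual_def laplacian_def R_def Lap_def dt using d2 by simp
qed

lemma time_FTC:
  assumes "0 < s" "s \<le> t" "t < T" and x: "x \<in> box (- a) a"
  shows "v0 (t, x) - v0 (s, x) = (LBINT r. indicator {s..t} r * vt (r, x))"
proof -
  have D: "((\<lambda>r. v r x) has_real_derivative vt (r, x)) (at r)" if "r \<in> {s..t}" for r
  proof -
    have z: "(r, x) \<in> W" using that assms by auto
    have "((\<lambda>h. v (h + r) x) has_real_derivative vt (r, x)) (at 0)"
      using iter_DERIV[of "[]" "(r, x)" "(1, 0)", OF _ z] z by (simp add: vt_def add.commute)
    then have "((\<lambda>s. v s x) has_real_derivative vt (r, x)) (at (0 + r))" by (subst DERIV_shift)
    then show ?thesis by simp
  qed
  have "continuous_on {s..t} (\<lambda>r. iter_partial [(1, 0)] V (r, x))"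
    by (intro continuous_on_compose2[OF iter_continuous[of "[(1, 0)]"]] continuous_intros) (use assms Basis_time in auto)
  then have c: "continuous_on {s..t} (\<lambda>r. vt (r, x))"
    by (rule continuous_on_eq) (use assms in \<open>simp add: vt_def\<close>)
  have "(LBINT r. indicator {s..t} r *\<^sub>R vt (r, x)) = v t x - v s x"
    by (rule integral_FTC_atLeastAtMost[OF assms(2) _ c])
      (use D in \<open>auto simp: has_real_derivative_iff_has_vector_derivative intro: has_vector_derivative_at_within\<close>)
  moreover have "v0 (t, x) = v t x" "v0 (s, x) = v s x" using assms by (auto simp: v0_def)
  ultimately show ?thesis by simp
qed

end

section \<open>The contraction estimate\<close>

text \<open>\<open>u r x\<close> agrees with such a primitive only off a null set depending on
  \<open>r\<close>, whereas the one-dimensional chain rule needs a whole time interval at the same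
  \<open>x\<close>. The primitive itself satisfies the integral formula at every
  \<open>r\<close>.\<close>

definition primitive :: "real \<Rightarrow> ('b \<Rightarrow> real) \<Rightarrow> (real \<times> 'b \<Rightarrow> real) \<Rightarrow> real \<Rightarrow> 'b \<Rightarrow> real" where
  "primitive s y0 D r x = y0 x + (LINT q:{s..r}|lborel. D (q, x))"

lemma primitive_measurable:
  fixes D :: "real \<times> 'b::euclidean_space \<Rightarrow> real"
  assumes y0: "y0 \<in> borel_measurable borel" and D: "D \<in> borel_measurable borel"
  shows "(\<lambda>z. primitive s y0 D (fst z) (snd z)) \<in> borel_measurable borel"
proof -
  have [measurable]: "(fst :: real \<times> 'b \<Rightarrow> real) \<in> borel_measurable borel" "(snd :: real \<times> 'b \<Rightarrow> 'b) \<in> borel_measurable borel"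
    by (intro borel_measurable_continuous_onI continuous_intros)+
  note [measurable] = D y0
  have c: "(\<lambda>p :: (real \<times> 'b) \<times> real. (snd p, snd (fst p))) \<in> borel \<Otimes>\<^sub>M lborel \<rightarrow>\<^sub>M borel" by measurable
  have [measurable]: "(\<lambda>p :: (real \<times> 'b) \<times> real. D (snd p, snd (fst p))) \<in> borel_measurable (borel \<Otimes>\<^sub>M lborel)"
    by (rule measurable_compose[OF c D])
  \<comment> \<open>The moving upper limit is written into the integrand, so that joint
    measurability follows from that of a parameter integral over a fixed domain.\<close>
  have "(\<lambda>(z, q). if s \<le> q \<and> q \<le> fst z then D (q, snd z) else 0) \<in> borel_measurable (borel \<Otimes>\<^sub>M lborel)"
    unfolding split_beta' by measurable
  then have "(\<lambda>z. LBINT q. (if s \<le> q \<and> q \<le> fst z then D (q, snd z) else 0)) \<in> borel_measurable borel"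
    by (rule lborel.borel_measurable_lebesgue_integral)
  moreover have "(LBINT q. (if s \<le> q \<and> q \<le> fst z then D (q, snd z) else 0)) = (LINT q:{s..fst z}|lborel. D (q, snd z))" for z
    unfolding set_lebesgue_integral_def by (intro Bochner_Integration.integral_cong) (auto simp: indicator_def)
  ultimately have "(\<lambda>z. (LINT q:{s..fst z}|lborel. D (q, snd z))) \<in> borel_measurable borel" by (simp only:)
  then show ?thesis unfolding primitive_def by simp
qed

lemma integrable_indicator_times:
  fixes D :: "'a::euclidean_space \<Rightarrow> real"
  assumes "integrable lborel D" "k \<in> borel_measurable borel" "\<And>z. \<bar>k z\<bar> \<le> 1"
  shows "integrable lborel (\<lambda>z. k z * D z)"
  using integrable_times_bounded[OF assms] by (simp add: mult.commute)

lemma primitive_integrable: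
  fixes D :: "real \<times> 'b::euclidean_space \<Rightarrow> real"
  assumes y0: "integrable lborel y0" and D: "integrable lborel D"
  shows "integrable lborel (primitive s y0 D r)"
proof -
  have "integrable lborel (\<lambda>z. indicator {s..r} (fst z) * D z)"
    by (rule integrable_indicator_times[OF D]) (auto intro!: measurable_comp_fst simp: indicator_def)
  from lborel_Fubini(5)[OF this] show ?thesis
    unfolding primitive_def[abs_def] set_lebesgue_integral_def using y0 by simp
qed

text \<open>\<open>pos_part_chain\<close> holds for almost every \<open>x\<close>, namely where
  \<open>D\<close> is integrable in time; integrating over \<open>x\<close> and exchanging the order
  of integration gives the claim.\<close>

lemma primitive_pos_part:
  fixes D :: "real \<times> 'b::euclidean_space \<Rightarrow> real"
  assumes y0: "integrable lborel y0" and D: "integrable lborel D" and st: "s < t"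
  defines "J \<equiv> \<lambda>z. indicator {s<..t} (fst z) * (indicator {0<..} (primitive s y0 D (fst z) (snd z)) * D z)"
  shows "integrable lborel J"
    "(LBINT x. max (primitive s y0 D t x) 0) - (LBINT x. max (primitive s y0 D s x) 0)
      \<le> (LBINT r. (LBINT x. J (r, x)))"
proof -
  have pm: "(\<lambda>z. primitive s y0 D (fst z) (snd z)) \<in> borel_measurable borel"
    using y0 D by (intro primitive_measurable) auto
  have m: "(\<lambda>z. indicator {s<..t} (fst z) * indicator {0<..} (primitive s y0 D (fst z) (snd z)) :: real) \<in> borel_measurable (borel :: (real \<times> 'b) measure)"
    by (intro borel_measurable_times measurable_comp_fst measurable_compose[OF pm]) auto
  have "integrable lborel (\<lambda>z. (indicator {s<..t} (fst z) * indicator {0<..} (primitive s y0 D (fst z) (snd z))) * D z)"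
    by (rule integrable_indicator_times[OF D m]) (auto simp: indicator_def)
  then show J: "integrable lborel J" by (simp add: J_def mult.assoc)
  have i: "integrable lborel (\<lambda>x. max (primitive s y0 D r x) 0)" for r
    using primitive_integrable[OF y0 D] by (intro integrable_max) auto
  have "(LBINT x. max (primitive s y0 D t x) 0) - (LBINT x. max (primitive s y0 D s x) 0)
    = (LBINT x. max (primitive s y0 D t x) 0 - max (primitive s y0 D s x) 0)"
    using i by simp
  also have "\<dots> \<le> (LBINT x. (LBINT r. J (r, x)))"
  proof (rule integral_mono_AE)
    show "AE x in lborel. max (primitive s y0 D t x) 0 - max (primitive s y0 D s x) 0 \<le> (LBINT r. J (r, x))"
      using lborel_Fubini(4)[OF D]
    proof eventually_elim
      case (elim x)
      show ?case
        using pos_part_chain[OF elim st, of "\<lambda>r. primitive s y0 D r x" "y0 x"]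
        by (simp add: primitive_def J_def set_lebesgue_integral_def)
    qed
  qed (use i lborel_Fubini(5)[OF J] in auto)
  also have "\<dots> = (LBINT r. (LBINT x. J (r, x)))"
    using lborel_Fubini(3,6)[OF J] by simp
  finally show "(LBINT x. max (primitive s y0 D t x) 0) - (LBINT x. max (primitive s y0 D s x) 0)
      \<le> (LBINT r. (LBINT x. J (r, x)))" .
qed

section \<open>The \<open>L^1\<close> increment between two interior times\<close>

locale pinn_comparison = energy_solution a T u U F + smooth_candidate a T v
  for a :: "real^'n" and T :: real and u :: "real \<Rightarrow> real^'n \<Rightarrow> real"
    and U F :: "real \<times> (real^'n) \<Rightarrow> real" and v :: "real \<Rightarrow> real^'n \<Rightarrow> real"
begin

lemma slice_integrable:
  fixes g :: "real \<times> (real^'n) \<Rightarrow> real" and M t :: real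
  assumes g: "g \<in> borel_measurable borel" and out: "\<And>z. z \<notin> W \<Longrightarrow> g z = 0" and M: "\<And>z. \<bar>g z\<bar> \<le> M"
  shows "integrable lborel (\<lambda>x. g (t, x))" "integrable lborel g"
proof -
  show "integrable lborel (\<lambda>x. g (t, x))"
  proof (rule integrable_bounded_support[where S="\<Omega>" and M=M])
    show "(\<lambda>x. g (t, x)) \<in> borel_measurable borel"
      using g by (auto intro!: measurable_compose[OF borel_measurable_continuous_onI] continuous_intros)
  qed (use out M in \<open>auto simp: bounded_box\<close>)
  show "integrable lborel g"
    by (rule integrable_bounded_support[where S="W" and M=M]) (use g out M in \<open>auto intro!: bounded_Times bounded_box\<close>)
qed

lemma v0_integrable: "integrable lborel (\<lambda>x. v0 (t, x))"
  and vt_integrable: "integrable lborel (\<lambda>x. vt (t, x))" "integrable lborel vt"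
  and R_integrable: "integrable lborel (\<lambda>x. R (t, x))" "integrable lborel R"
  using derivs_bounded R_bounded slice_integrable[OF v0_meas out_zero(2)] slice_integrable[OF vt_meas out_zero(1)]
    slice_integrable[OF R_meas out_zero(4)] by blast+

text \<open>The time derivatives \<open>D1\<close>, \<open>D2\<close>, \<open>D3\<close> belong to
  \<open>v - u\<close>, \<open>u\<close> and \<open>v\<close>; the primitives \<open>?Y\<close> and
  \<open>?Z\<close> represent \<open>v - u\<close> and \<open>u\<close>. The inequality between the
  spatial integrals at almost every time is isolated as \<open>slice\<close> and then integrated
  over \<open>{s..t}\<close>.\<close>

lemma L1_increment:
  assumes s: "0 < s" and st: "s < t" and t: "t < T"
    and ws: "integrable lborel ws" "\<And>x. x \<notin> \<Omega> \<Longrightarrow> ws x = 0" "AE x in lborel. x \<in> \<Omega> \<longrightarrow> u s x = ws x"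
    and wt: "integrable lborel wt" "\<And>x. x \<notin> \<Omega> \<Longrightarrow> wt x = 0" "AE x in lborel. x \<in> \<Omega> \<longrightarrow> u t x = wt x"
  shows "(LBINT x. \<bar>wt x - v0 (t, x)\<bar>) \<le> (LBINT x. \<bar>ws x - v0 (s, x)\<bar>) +
    (LBINT r. indicator {s..t} r * (LBINT x. \<bar>R (r, x)\<bar>))"
proof -
  define D2 where "D2 z = indicator {s..t} (fst z) * F z" for z
  define D3 where "D3 z = indicator {s..t} (fst z) * vt z" for z
  define D1 where "D1 z = D3 z - D2 z" for z
  have D2: "integrable lborel D2" unfolding D2_def[abs_def] by (rule F_cut[OF s t])
  have D3: "integrable lborel D3"
    unfolding D3_def[abs_def]
    by (rule integrable_indicator_times[OF vt_integrable(2)]) (auto intro!: measurable_comp_fst simp: indicator_def)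
  have D1: "integrable lborel D1" unfolding D1_def[abs_def] using D2 D3 by simp
  define y0 where "y0 x = v0 (s, x) - ws x" for x
  have y0: "integrable lborel y0" unfolding y0_def[abs_def] using v0_integrable ws(1) by simp
  let ?Y = "primitive s y0 D1" and ?Z = "primitive s ws D2"
  have Z_eq: "AE x in lborel. (x \<in> \<Omega> \<longrightarrow> ?Z r x = u r x) \<and> (x \<notin> \<Omega> \<longrightarrow> ?Z r x = 0)" if r: "r \<in> {s..t}" for r
  proof -
    have "AE x in lborel. x \<in> \<Omega> \<longrightarrow> u r x - u s x = (LBINT q. indicator {s..r} q * F (q, x))"
    proof (cases "s < r")
      case True
      then show ?thesis using time_increment[OF s] r t by auto
    next
      case False
      then have [simp]: "r = s" using r by simp
      have "(LBINT q. indicator {s..s} q * F (q, x)) = 0" for x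
        by (rule integral_eq_zero_AE) (use AE_lborel_singleton[of s] in eventually_elim, auto)
      then show ?thesis by simp
    qed
    then show ?thesis using ws(3)
    proof eventually_elim
      case (elim x)
      have "(LINT q:{s..r}|lborel. D2 (q, x)) = (LBINT q. indicator {s..r} q * F (q, x))"
        unfolding set_lebesgue_integral_def D2_def using r
        by (intro Bochner_Integration.integral_cong) (auto simp: indicator_def)
      moreover have "F (q, x) = 0" if "x \<notin> \<Omega>" for q using that by (intro F_out) auto
      ultimately show ?case using elim ws(2)[of x] by (auto simp: primitive_def)
    qed
  qed
  have Y_eq: "AE x in lborel. ?Y r x = v0 (r, x) - ?Z r x" if r: "r \<in> {s..t}" for r
    using lborel_Fubini(4)[OF D2] lborel_Fubini(4)[OF D3]
  proof eventually_elim
    case (elim x)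
    have si: "set_integrable lborel {s..r} (\<lambda>q. D2 (q, x))" "set_integrable lborel {s..r} (\<lambda>q. D3 (q, x))"
      unfolding set_integrable_def by (rule integrable_mult_indicator; use elim in simp)+
    have "(LINT q:{s..r}|lborel. D3 (q, x)) = v0 (r, x) - v0 (s, x)"
    proof (cases "x \<in> \<Omega>")
      case True
      have "(LINT q:{s..r}|lborel. D3 (q, x)) = (LBINT q. indicator {s..r} q * vt (q, x))"
        unfolding set_lebesgue_integral_def D3_def using r
        by (intro Bochner_Integration.integral_cong) (auto simp: indicator_def)
      then show ?thesis using time_FTC[OF s _ _ True, of r] r t by simp
    next
      case False
      then have "v0 (q, x) = 0" "vt (q, x) = 0" for q using out_zero by auto
      then show ?thesis by (simp add: D3_def set_lebesgue_integral_def)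
    qed
    then show ?case
      unfolding primitive_def D1_def y0_def using set_integral_diff(2)[OF si(2,1)] by simp
  qed
  have Z_nonneg: "AE x in lborel. 0 \<le> ?Z r x" if r: "r \<in> {s..t}" for r
  proof -
    have "AE x in lborel. x \<in> cbox (- a) a \<longrightarrow> 0 \<le> u r x" using nonneg[of r] r s t by auto
    then show ?thesis using Z_eq[OF r]
    proof eventually_elim
      case (elim x)
      then show ?case using box_subset_cbox[of "- a" a] by (cases "x \<in> \<Omega>") auto
    qed
  qed
  define J1 where "J1 z = indicator {s<..t} (fst z) * (indicator {0<..} (?Y (fst z) (snd z)) * D1 z)" for z
  define J2 where "J2 z = indicator {s<..t} (fst z) * (indicator {0<..} (?Z (fst z) (snd z)) * D2 z)" for z
  note P1 = primitive_pos_part[OF y0 D1 st, folded J1_def]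
  note P2 = primitive_pos_part[OF ws(1) D2 st, folded J2_def]
  \<comment> \<open>The time \<open>s\<close> is discarded because \<open>J1\<close> and
    \<open>J2\<close> live on \<open>{s<..t}\<close> while \<open>D3\<close> lives on
    \<open>{s..t}\<close>.\<close>
  have slice: "AE r in lborel. 2 * (LBINT x. J1 (r, x)) + (LBINT x. J2 (r, x)) - (LBINT x. D3 (r, x))
      \<le> indicator {s..t} r * (LBINT x. \<bar>R (r, x)\<bar>)"
    using AE_slice_data U_slice AE_lborel_singleton[of s]
  proof eventually_elim
    case (elim r)
    show ?case
    proof (cases "r \<in> {s..t}")
      case False
      then show ?thesis by (simp add: J1_def J2_def D3_def)
    next
      case True
      then have r: "r \<in> {s<..t}" "r \<in> {0<..<T}" using elim s t by auto
      obtain G \<phi> D\<phi> where sd: "slice_data (- a) a (\<lambda>x. 2 * F (r, x)) (\<lambda>x. (U (r, x))\<^sup>2) G \<phi> D\<phi>"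
        using elim r by blast
      obtain M where ss: "smooth_slice (- a) a (\<lambda>x. v0 (r, x)) (\<lambda>b x. Dv b (r, x)) (\<lambda>b x. DDv b (r, x)) M"
        using smooth_slice[OF r(2)] by blast
      interpret sd: slice_data "- a" a "\<lambda>x. 2 * F (r, x)" "\<lambda>x. (U (r, x))\<^sup>2" G \<phi> D\<phi> by (rule sd)
      interpret ss: smooth_slice "- a" a "\<lambda>x. v0 (r, x)" "\<lambda>b x. Dv b (r, x)" "\<lambda>b x. DDv b (r, x)" M by (rule ss)
      interpret sc: slice_comparison "- a" a "\<lambda>x. 2 * F (r, x)" "\<lambda>x. (U (r, x))\<^sup>2" G \<phi> D\<phi>
        "\<lambda>x. v0 (r, x)" "\<lambda>b x. Dv b (r, x)" "\<lambda>b x. DDv b (r, x)" M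
        by unfold_locales simp
      have Lp: "ss.L = (\<lambda>x. Lap (r, x))" by (rule Lap_slice[OF ss])
      have Fi: "integrable lborel (\<lambda>x. F (r, x))" using sd.f by simp
      have Li: "integrable lborel (\<lambda>x. Lap (r, x))" using ss.L_integral(1) unfolding Lp .
      have L0: "(LBINT x. Lap (r, x)) = 0" using ss.L_integral(2) unfolding Lp .
      define A where "A x = indicat_real {0<..} (?Y r x)" for x
      define B where "B x = indicat_real {0<..} (?Z r x)" for x
      have Ym: "?Y r \<in> borel_measurable borel" using primitive_integrable[OF y0 D1, of s r] by auto
      have Zm: "?Z r \<in> borel_measurable borel" using primitive_integrable[OF ws(1) D2, of s r] by auto
      have A: "A \<in> borel_measurable borel" "\<And>x. \<bar>A x\<bar> \<le> 1"
        unfolding A_def using Ym by (auto simp: indicator_def)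
      have B: "B \<in> borel_measurable borel" "\<And>x. \<bar>B x\<bar> \<le> 1"
        unfolding B_def using Zm by (auto simp: indicator_def)
      \<comment> \<open>The indicators are formed with the primitive, while the slice inequalities
        concern the representative \<open>U\<close>; the two coincide almost everywhere at this
        time.\<close>
      have ZU: "AE x in lborel. ?Z r x = U (r, x)"
        using Z_eq[OF True] elim(2)[rule_format, OF r(2)]
      proof eventually_elim
        case (elim x)
        then show ?case using U_out[of "(r, x)"] by (cases "x \<in> \<Omega>") auto
      qed
      have J1s: "J1 (r, x) = A x * (vt (r, x) - F (r, x))" for x
        using r by (simp add: J1_def D1_def D2_def D3_def A_def)
      have J2s: "J2 (r, x) = B x * F (r, x)" for x using r by (simp add: J2_def D2_def B_def)
      \<comment> \<open>Since \<open>U\<close> is nonnegative almost everywhere,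
        \<open>v0 > U\<close> is equivalent to \<open>(max v0 0)^2 > U^2\<close>, the set in the
        comparison inequality.\<close>
      have "(LBINT x. A x * (Lap (r, x) - 2 * F (r, x))) =
        (LBINT x. (Lap (r, x) - 2 * F (r, x)) * indicator {0<..} ((max (v0 (r, x)) 0)\<^sup>2 - (U (r, x))\<^sup>2))"
      proof (rule integral_cong_AE)
        show "(\<lambda>x. A x * (Lap (r, x) - 2 * F (r, x))) \<in> borel_measurable lborel"
          using A(1) Li Fi by simp
        have "(\<lambda>x. (max (v0 (r, x)) 0)\<^sup>2 - (U (r, x))\<^sup>2) \<in> borel_measurable borel"
          using borel_measurable_integrable[OF v0_integrable[of r]] U_slice_meas[of r] by simp
        then have "(\<lambda>x. indicat_real {0<..} ((max (v0 (r, x)) 0)\<^sup>2 - (U (r, x))\<^sup>2)) \<in> borel_measurable borel"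
          by (rule measurable_compose) simp
        then show "(\<lambda>x. (Lap (r, x) - 2 * F (r, x)) * indicator {0<..} ((max (v0 (r, x)) 0)\<^sup>2 - (U (r, x))\<^sup>2)) \<in> borel_measurable lborel"
          using Li Fi by simp
        show "AE x in lborel. A x * (Lap (r, x) - 2 * F (r, x)) =
          (Lap (r, x) - 2 * F (r, x)) * indicator {0<..} ((max (v0 (r, x)) 0)\<^sup>2 - (U (r, x))\<^sup>2)"
          using Y_eq[OF True] ZU Z_nonneg[OF True]
        proof eventually_elim
          case (elim x)
          have "0 < v0 (r, x) - U (r, x) \<longleftrightarrow> 0 < (max (v0 (r, x)) 0)\<^sup>2 - (U (r, x))\<^sup>2"
          proof -
            have U0: "0 \<le> U (r, x)" using elim by simp
            have "0 < (max (v0 (r, x)) 0)\<^sup>2 - (U (r, x))\<^sup>2 \<longleftrightarrow> U (r, x) < max (v0 (r, x)) 0"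
              using power2_less_imp_less[of "U (r, x)" "max (v0 (r, x)) 0"]
                power_strict_mono[of "U (r, x)" "max (v0 (r, x)) 0" 2] U0 by auto
            then show ?thesis using U0 by auto
          qed
          then show ?case using elim by (simp add: A_def indicator_def)
        qed
      qed
      also have "\<dots> \<le> 0" using sc.comparison unfolding Lp .
      finally have le1: "(LBINT x. A x * (Lap (r, x) - 2 * F (r, x))) \<le> 0" .
      have AR: "integrable lborel (\<lambda>x. A x * R (r, x))" by (rule integrable_indicator_times[OF R_integrable(1) A])
      have AL: "integrable lborel (\<lambda>x. A x * (Lap (r, x) - 2 * F (r, x)))"
        using Li Fi by (intro integrable_indicator_times[OF _ A]) simp
      have "(LBINT x. J1 (r, x)) = (LBINT x. A x * R (r, x) + 1 / 2 * (A x * (Lap (r, x) - 2 * F (r, x))))"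
        unfolding J1s by (intro Bochner_Integration.integral_cong) (auto simp: R_def algebra_simps)
      then have J1le: "(LBINT x. J1 (r, x)) \<le> (LBINT x. A x * R (r, x))"
        using AR AL le1 by simp
      have J2le: "(LBINT x. J2 (r, x)) \<le> 0"
      proof -
        have "(LBINT x. B x * F (r, x)) = (LBINT x. 1 / 2 * (2 * F (r, x) * indicator {0<..} ((U (r, x))\<^sup>2)))"
        proof (rule integral_cong_AE)
          show "(\<lambda>x. B x * F (r, x)) \<in> borel_measurable lborel" using B(1) Fi by simp
          have "(\<lambda>x. indicat_real {0<..} ((U (r, x))\<^sup>2)) \<in> borel_measurable borel"
            by (rule measurable_compose[OF borel_measurable_power[OF U_slice_meas]]) simp
          then show "(\<lambda>x. 1 / 2 * (2 * F (r, x) * indicator {0<..} ((U (r, x))\<^sup>2))) \<in> borel_measurable lborel" using Fi by simp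
          show "AE x in lborel. B x * F (r, x) = 1 / 2 * (2 * F (r, x) * indicator {0<..} ((U (r, x))\<^sup>2))"
            using ZU Z_nonneg[OF True]
            by eventually_elim (auto simp: B_def indicator_def)
        qed
        also have "\<dots> = 1 / 2 * (LBINT x. 2 * F (r, x) * indicator {0<..} ((U (r, x))\<^sup>2))"
          by (rule integral_mult_right_zero)
        finally show ?thesis unfolding J2s using sd.integral_laplacian_pos_set by linarith
      qed
      have D3s: "(LBINT x. D3 (r, x)) = (LBINT x. R (r, x))"
      proof -
        have "(LBINT x. D3 (r, x)) = (LBINT x. R (r, x) + 1 / 2 * Lap (r, x))"
          using True by (simp add: D3_def R_def)
        also have "\<dots> = (LBINT x. R (r, x)) + 1 / 2 * (LBINT x. Lap (r, x))"
          using R_integrable(1)[of r] Li by simp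
        finally show ?thesis using L0 by simp
      qed
      \<comment> \<open>The coefficient \<open>2 * A x - 1\<close> takes only the values 1 and -1,
        which is why no factor 2 is left in front of the residual.\<close>
      have "2 * (LBINT x. A x * R (r, x)) - (LBINT x. R (r, x)) = (LBINT x. 2 * (A x * R (r, x)) - R (r, x))"
        using AR R_integrable(1)[of r] by simp
      also have "\<dots> \<le> (LBINT x. \<bar>R (r, x)\<bar>)"
        using AR R_integrable(1)[of r] by (intro integral_mono) (auto simp: A_def indicator_def)
      finally show ?thesis using J1le J2le D3s True by simp
    qed
  qed
  have v_inc: "(LBINT x. v0 (t, x)) - (LBINT x. v0 (s, x)) = (LBINT r. (LBINT x. D3 (r, x)))"
  proof -
    have "(LBINT x. v0 (t, x)) - (LBINT x. v0 (s, x)) = (LBINT x. v0 (t, x) - v0 (s, x))"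
      using v0_integrable by simp
    also have "\<dots> = (LBINT x. (LBINT r. D3 (r, x)))"
    proof (rule Bochner_Integration.integral_cong[OF refl])
      fix x
      show "v0 (t, x) - v0 (s, x) = (LBINT r. D3 (r, x))"
      proof (cases "x \<in> \<Omega>")
        case True
        then show ?thesis using time_FTC[OF s _ t True] st by (simp add: D3_def)
      next
        case False
        then have "v0 (q, x) = 0" "vt (q, x) = 0" for q using out_zero by auto
        then show ?thesis by (simp add: D3_def)
      qed
    qed
    also have "\<dots> = (LBINT r. (LBINT x. D3 (r, x)))" using lborel_Fubini(3,6)[OF D3] by simp
    finally show ?thesis .
  qed
  \<comment> \<open>\<open>?Z\<close> equals its positive part almost everywhere. The positive part
    is kept so that its increment involves \<open>F\<close> only on \<open>{?Z > 0}\<close>, where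
    the integral of the Laplacian has a sign.\<close>
  have decomp: "(LBINT x. \<bar>w x - v0 (r, x)\<bar>) =
      2 * (LBINT x. max (?Y r x) 0) + (LBINT x. max (?Z r x) 0) - (LBINT x. v0 (r, x))"
    if r: "r \<in> {s..t}" and w: "integrable lborel w" "\<And>x. x \<notin> \<Omega> \<Longrightarrow> w x = 0" "AE x in lborel. x \<in> \<Omega> \<longrightarrow> u r x = w x" for r w
  proof -
    have iY: "integrable lborel (\<lambda>x. max (?Y r x) 0)" using primitive_integrable[OF y0 D1] by (intro integrable_max) auto
    have iZ: "integrable lborel (\<lambda>x. max (?Z r x) 0)" using primitive_integrable[OF ws(1) D2] by (intro integrable_max) auto
    have "(LBINT x. \<bar>w x - v0 (r, x)\<bar>) = (LBINT x. 2 * max (?Y r x) 0 + max (?Z r x) 0 - v0 (r, x))"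
    proof (rule integral_cong_AE)
      show "AE x in lborel. \<bar>w x - v0 (r, x)\<bar> = 2 * max (?Y r x) 0 + max (?Z r x) 0 - v0 (r, x)"
        using Y_eq[OF r] Z_eq[OF r] Z_nonneg[OF r] w(3)
      proof eventually_elim
        case (elim x)
        then have "?Z r x = w x" using w(2)[of x] by (cases "x \<in> \<Omega>") auto
        then show ?case using elim by (auto simp: max_def abs_if)
      qed
    qed (use w(1) v0_integrable[of r] iY iZ in auto)
    then show ?thesis using iY iZ v0_integrable[of r] by simp
  qed
  have "(LBINT x. \<bar>wt x - v0 (t, x)\<bar>) - (LBINT x. \<bar>ws x - v0 (s, x)\<bar>) \<le>
     2 * (LBINT r. (LBINT x. J1 (r, x))) + (LBINT r. (LBINT x. J2 (r, x))) - (LBINT r. (LBINT x. D3 (r, x)))"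
    using decomp[OF _ wt] decomp[OF _ ws] P1(2) P2(2) v_inc st by simp
  also have "\<dots> = (LBINT r. 2 * (LBINT x. J1 (r, x)) + (LBINT x. J2 (r, x)) - (LBINT x. D3 (r, x)))"
    using lborel_Fubini(2)[OF P1(1)] lborel_Fubini(2)[OF P2(1)] lborel_Fubini(2)[OF D3] by simp
  also have "\<dots> \<le> (LBINT r. indicator {s..t} r * (LBINT x. \<bar>R (r, x)\<bar>))"
  proof (rule integral_mono_AE[OF _ _ slice])
    have "integrable lborel (\<lambda>z. \<bar>R z\<bar>)" using R_integrable(2) by simp
    from lborel_Fubini(2)[OF this]
    show "integrable lborel (\<lambda>r. indicator {s..t} r * (LBINT x. \<bar>R (r, x)\<bar>))"
      by (intro integrable_indicator_times) (auto simp: indicator_def)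
  qed (use lborel_Fubini(2)[OF P1(1)] lborel_Fubini(2)[OF P2(1)] lborel_Fubini(2)[OF D3] in simp)
  finally show ?thesis by simp
qed

end

section \<open>The error bounds\<close>

lemma ennreal_sum_square_le: "(x + y)\<^sup>2 \<le> 2 * x\<^sup>2 + 2 * (y::ennreal)\<^sup>2"
proof (cases "x = top \<or> y = top")
  case True
  then show ?thesis by (auto simp: power2_eq_square ennreal_mult_top ennreal_top_mult)
next
  case False
  then obtain p q where pq: "x = ennreal p" "0 \<le> p" "y = ennreal q" "0 \<le> q"
    by (metis ennreal_cases infinity_ennreal_def)
  have "2 * p * q \<le> p\<^sup>2 + q\<^sup>2" using sum_squares_bound[of p q] by simp
  then have "(p + q)\<^sup>2 \<le> 2 * p\<^sup>2 + 2 * q\<^sup>2" by (simp add: power2_sum)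
  then have "ennreal ((p + q)\<^sup>2) \<le> ennreal (2 * p\<^sup>2 + 2 * q\<^sup>2)" by (rule ennreal_leI)
  then show ?thesis using pq
    by (simp add: ennreal_power[symmetric] ennreal_plus ennreal_mult)
qed

lemma nn_Cauchy_Schwarz_set:
  fixes f :: "'a \<Rightarrow> real"
  assumes S: "S \<in> sets M" and f: "f \<in> borel_measurable M"
  shows "(\<integral>\<^sup>+z. ennreal \<bar>f z\<bar> * indicator S z \<partial>M)\<^sup>2 \<le> emeasure M S * (\<integral>\<^sup>+z. ennreal ((f z)\<^sup>2) * indicator S z \<partial>M)"
proof -
  have sq: "(\<lambda>z. (ennreal \<bar>f z\<bar> * indicator S z)\<^sup>2) = (\<lambda>z. ennreal ((f z)\<^sup>2) * indicator S z)"
    "(\<lambda>z. (indicator S z :: ennreal)\<^sup>2) = indicator S"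
    by (auto simp: indicator_def ennreal_power)
  have "(\<integral>\<^sup>+z. (ennreal \<bar>f z\<bar> * indicator S z) * indicator S z \<partial>M)\<^sup>2 \<le>
     (\<integral>\<^sup>+z. (ennreal \<bar>f z\<bar> * indicator S z)\<^sup>2 \<partial>M) * (\<integral>\<^sup>+z. (indicator S z)\<^sup>2 \<partial>M)"
    using S f by (intro Cauchy_Schwarz_nn_integral) auto
  moreover have "(ennreal \<bar>f z\<bar> * indicator S z) * indicator S z = ennreal \<bar>f z\<bar> * indicator S z" for z
    by (simp add: indicator_def)
  ultimately show ?thesis using S unfolding sq by (simp add: mult.commute)
qed

context smooth_candidate
begin

text \<open>The times 0 and \<open>T\<close> and the lateral boundary are null sets, so
  \<open>residual\<close> may be replaced by \<open>R\<close>; then Tonelli identifies the iterated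
  integral with the space-time integral. The function \<open>\<phi>\<close> stands for the absolute
  value and for the square.\<close>

lemma residual_nn_integral:
  fixes \<phi> :: "real \<Rightarrow> ennreal"
  assumes \<phi>: "\<phi> \<in> borel_measurable borel" and t: "t \<in> {0..T}"
  shows "(\<integral>\<^sup>+s. (\<integral>\<^sup>+x. \<phi> (residual v s x) \<partial>lebesgue_on (cbox (- a) a)) \<partial>lebesgue_on {0..t}) =
      (\<integral>\<^sup>+z. \<phi> (R z) * indicator ({0..t} \<times> cbox (- a) a) z \<partial>lborel)"
    "(\<integral>\<^sup>+(s, x). \<phi> (residual v s x) \<partial>lebesgue_on ({0..t} \<times> cbox (- a) a)) =
      (\<integral>\<^sup>+z. \<phi> (R z) * indicator ({0..t} \<times> cbox (- a) a) z \<partial>lborel)"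
proof -
  have S: "{0..t} \<times> cbox (- a) a \<in> sets borel" by (intro borel_closed closed_Times) auto
  have m: "(\<lambda>z. \<phi> (R z) * indicator ({0..t} \<times> cbox (- a) a) z) \<in> borel_measurable borel"
    using measurable_compose[OF R_meas \<phi>] S by simp
  then have m': "(\<lambda>z. \<phi> (R z) * indicator ({0..t} \<times> cbox (- a) a) z) \<in> borel_measurable (lborel \<Otimes>\<^sub>M lborel)"
    by (simp add: lborel_prod)
  have "AE s in lborel. s \<in> {0..t} \<longrightarrow> (\<integral>\<^sup>+x. \<phi> (residual v s x) \<partial>lebesgue_on (cbox (- a) a)) =
      (\<integral>\<^sup>+x. \<phi> (R (s, x)) * indicator (cbox (- a) a) x \<partial>lborel)"
    using AE_lborel_singleton[of 0] AE_lborel_singleton[of T]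
  proof eventually_elim
    case (elim s)
    show ?case
    proof
      assume "s \<in> {0..t}"
      then have s: "s \<in> {0<..<T}" using elim t by auto
      show "(\<integral>\<^sup>+x. \<phi> (residual v s x) \<partial>lebesgue_on (cbox (- a) a)) = (\<integral>\<^sup>+x. \<phi> (R (s, x)) * indicator (cbox (- a) a) x \<partial>lborel)"
      proof (rule nn_integral_lebesgue_on)
        show "AE x in lborel. x \<in> cbox (- a) a \<longrightarrow> \<phi> (residual v s x) = \<phi> (R (s, x))"
          using AE_cbox_box[of "- a" a] by eventually_elim (use s residual_eq_R in auto)
      qed simp
    qed
  qed
  then have "(\<integral>\<^sup>+s. (\<integral>\<^sup>+x. \<phi> (residual v s x) \<partial>lebesgue_on (cbox (- a) a)) \<partial>lebesgue_on {0..t}) =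
     (\<integral>\<^sup>+s. (\<integral>\<^sup>+x. \<phi> (R (s, x)) * indicator (cbox (- a) a) x \<partial>lborel) * indicator {0..t} s \<partial>lborel)"
    by (intro nn_integral_lebesgue_on) auto
  also have "\<dots> = (\<integral>\<^sup>+s. (\<integral>\<^sup>+x. \<phi> (R (s, x)) * indicator ({0..t} \<times> cbox (- a) a) (s, x) \<partial>lborel) \<partial>lborel)"
    by (intro nn_integral_cong) (auto simp: indicator_def)
  also have "\<dots> = (\<integral>\<^sup>+z. \<phi> (R z) * indicator ({0..t} \<times> cbox (- a) a) z \<partial>(lborel \<Otimes>\<^sub>M lborel))"
    by (rule lborel.nn_integral_fst[OF m'])
  finally show "(\<integral>\<^sup>+s. (\<integral>\<^sup>+x. \<phi> (residual v s x) \<partial>lebesgue_on (cbox (- a) a)) \<partial>lebesgue_on {0..t}) =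
      (\<integral>\<^sup>+z. \<phi> (R z) * indicator ({0..t} \<times> cbox (- a) a) z \<partial>lborel)" by (simp add: lborel_prod)
  have "AE z in lborel. z \<in> {0..T} \<times> cbox (- a) a \<longrightarrow> z \<in> W"
    using AE_not_frontier_box[of "(0, - a)" "(T, a)"]
  proof eventually_elim
    case (elim z)
    moreover have "z \<in> box (0, - a) (T, a) \<Longrightarrow> z \<in> W"
      by (cases z) (auto simp: mem_box Basis_prod_def)
    ultimately show ?case by (auto simp: cbox_Pair_eq)
  qed
  then have "AE z in lborel. z \<in> {0..t} \<times> cbox (- a) a \<longrightarrow> (case z of (s, x) \<Rightarrow> \<phi> (residual v s x)) = \<phi> (R z)"
    by eventually_elim (use t residual_eq_R in auto)
  then show "(\<integral>\<^sup>+(s, x). \<phi> (residual v s x) \<partial>lebesgue_on ({0..t} \<times> cbox (- a) a)) =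
      (\<integral>\<^sup>+z. \<phi> (R z) * indicator ({0..t} \<times> cbox (- a) a) z \<partial>lborel)"
    by (rule nn_integral_lebesgue_on[OF S])
qed

lemma v_slice_lebesgue:
  assumes t: "t \<in> {0..T}"
  shows "integrable (lebesgue_on (cbox (- a) a)) (v t)"
    "\<exists>w. w \<in> borel_measurable borel \<and> (\<forall>x\<in>cbox (- a) a. v t x = w x)"
proof -
  let ?w = "\<lambda>x. indicator (cbox (- a) a) x *\<^sub>R v t x"
  have wm: "?w \<in> borel_measurable borel"
    by (intro borel_measurable_continuous_on_indicator slice_continuous t) simp
  obtain M where M: "\<And>x. x \<in> cbox (- a) a \<Longrightarrow> \<bar>v t x\<bar> \<le> M"
    using continuous_on_compact_abs_bound[OF slice_continuous[OF t] compact_cbox] by blast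
  have Mw: "\<bar>?w x\<bar> \<le> \<bar>M\<bar>" for x
  proof (cases "x \<in> cbox (- a) a")
    case True
    then show ?thesis using M[of x] by simp
  qed simp
  have "integrable lborel ?w"
    by (rule integrable_bounded_support[OF wm bounded_cbox[of "- a" a] _ Mw]) simp
  then show "integrable (lebesgue_on (cbox (- a) a)) (v t)"
    by (subst lebesgue_on_transfer(2)[OF _ wm]) auto
  show "\<exists>w. w \<in> borel_measurable borel \<and> (\<forall>x\<in>cbox (- a) a. v t x = w x)"
    using wm by (intro exI[of _ ?w]) auto
qed

end

context pinn_comparison
begin

section \<open>Extension of the estimate to the closed time interval\<close>

definition err :: "real \<Rightarrow> real" where
  "err t = (\<integral>x. \<bar>u t x - v t x\<bar> \<partial>lebesgue_on (cbox (- a) a))"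

lemma diff_integrable: "t \<in> {0..T} \<Longrightarrow> integrable (lebesgue_on (cbox (- a) a)) (\<lambda>x. u t x - v t x)"
  using u_integrable v_slice_lebesgue by simp

lemma L1_norm_err: "t \<in> {0..T} \<Longrightarrow> L1_norm (cbox (- a) a) (\<lambda>x. u t x - v t x) = ennreal (err t)"
  unfolding L1_norm_def err_def using diff_integrable[of t] by (intro nn_integral_eq_integral) auto

lemma u_representative_interior:
  assumes "t \<in> {0..T}"
  shows "\<exists>w. integrable lborel w \<and> (\<forall>x. x \<notin> \<Omega> \<longrightarrow> w x = 0) \<and> (AE x in lborel. x \<in> \<Omega> \<longrightarrow> u t x = w x)"
proof -
  obtain w where w: "integrable lborel w" "AE x in lborel. x \<in> cbox (- a) a \<longrightarrow> u t x = w x"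
    using u_representative[OF assms] by blast
  show ?thesis
  proof (intro exI[of _ "\<lambda>x. indicator \<Omega> x * w x"] conjI allI impI)
    show "integrable lborel (\<lambda>x. indicator \<Omega> x * w x)"
      by (rule integrable_indicator_times[OF w(1)]) (auto simp: indicator_def)
    show "AE x in lborel. x \<in> \<Omega> \<longrightarrow> u t x = indicator \<Omega> x * w x"
      using w(2) by eventually_elim (use box_subset_cbox[of "- a" a] in auto)
  qed simp
qed

lemma err_lborel:
  assumes t: "t \<in> {0<..<T}"
    and w: "integrable lborel w" "\<And>x. x \<notin> \<Omega> \<Longrightarrow> w x = 0" "AE x in lborel. x \<in> \<Omega> \<longrightarrow> u t x = w x"
  shows "err t = (LBINT x. \<bar>w x - v0 (t, x)\<bar>)"
  unfolding err_def
proof (rule lebesgue_on_transfer(3))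
  show "(\<lambda>x. \<bar>w x - v0 (t, x)\<bar>) \<in> borel_measurable borel"
    using borel_measurable_integrable[OF w(1)] borel_measurable_integrable[OF v0_integrable[of t]] by simp
  show "AE x in lborel. x \<in> cbox (- a) a \<longrightarrow> \<bar>u t x - v t x\<bar> = \<bar>w x - v0 (t, x)\<bar>"
    using w(3) AE_cbox_box[of "- a" a]
  proof eventually_elim
    case (elim x)
    then show ?case using t by (auto simp: v0_def)
  qed
  fix x assume "x \<notin> cbox (- a) a"
  then have "x \<notin> \<Omega>" using box_subset_cbox[of "- a" a] by blast
  then show "\<bar>w x - v0 (t, x)\<bar> = 0" using w(2) out_zero(2)[of "(t, x)"] by simp
qed simp

lemma err_increment:
  assumes "0 < s" "s < t" "t < T"
  shows "err t \<le> err s + (LBINT r. indicator {s..t} r * (LBINT x. \<bar>R (r, x)\<bar>))"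
proof -
  obtain ws where ws: "integrable lborel ws" "\<And>x. x \<notin> \<Omega> \<Longrightarrow> ws x = 0" "AE x in lborel. x \<in> \<Omega> \<longrightarrow> u s x = ws x"
    using u_representative_interior[of s] assms by auto
  obtain wt where wt: "integrable lborel wt" "\<And>x. x \<notin> \<Omega> \<Longrightarrow> wt x = 0" "AE x in lborel. x \<in> \<Omega> \<longrightarrow> u t x = wt x"
    using u_representative_interior[of t] assms by auto
  show ?thesis
    using L1_increment[OF assms ws wt] err_lborel[OF _ ws] err_lborel[OF _ wt] assms by simp
qed

text \<open>The reverse triangle inequality bounds the change of \<open>err\<close> by the
  \<open>L^1\<close> changes of \<open>u\<close> and of \<open>v\<close>. The first tends to 0 by
  assumption, the second by bounded convergence on the box.\<close>

lemma err_tendsto: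
  assumes r: "\<And>n. r n \<in> {0..T}" and r0: "r0 \<in> {0..T}" and lim: "r \<longlonglongrightarrow> r0"
  shows "(\<lambda>n. err (r n)) \<longlonglongrightarrow> err r0"
proof -
  let ?L = "lebesgue_on (cbox (- a) a)"
  have u_lim: "(\<lambda>n. \<integral>x. \<bar>u (r n) x - u r0 x\<bar> \<partial>?L) \<longlonglongrightarrow> 0"
  proof -
    have "((\<lambda>s. L1_norm (cbox (- a) a) (\<lambda>x. u s x - u r0 x)) \<longlongrightarrow> 0) (at r0 within {0..T})"
      using cont r0 unfolding in_C_L1_def by blast
    \<comment> \<open>The assumed limit at \<open>r0\<close> ignores the value at \<open>r0\<close>
      itself. As this value is 0, the limit becomes continuity, which covers sequences that hit
      \<open>r0\<close>.\<close>
    moreover have "L1_norm (cbox (- a) a) (\<lambda>x. u r0 x - u r0 x) = 0" by (simp add: L1_norm_def)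
    ultimately have "continuous (at r0 within {0..T}) (\<lambda>s. L1_norm (cbox (- a) a) (\<lambda>x. u s x - u r0 x))"
      by (simp add: continuous_within)
    then have "((\<lambda>s. L1_norm (cbox (- a) a) (\<lambda>x. u s x - u r0 x)) \<circ> r) \<longlonglongrightarrow> L1_norm (cbox (- a) a) (\<lambda>x. u r0 x - u r0 x)"
      using r lim unfolding continuous_within_sequentially by blast
    then have "(\<lambda>n. L1_norm (cbox (- a) a) (\<lambda>x. u (r n) x - u r0 x)) \<longlonglongrightarrow> 0"
      by (simp add: o_def L1_norm_def)
    then have "(\<lambda>n. enn2real (L1_norm (cbox (- a) a) (\<lambda>x. u (r n) x - u r0 x))) \<longlonglongrightarrow> enn2real 0"
      by (intro tendsto_enn2real) auto
    moreover have "enn2real (L1_norm (cbox (- a) a) (\<lambda>x. u (r n) x - u r0 x)) = (\<integral>x. \<bar>u (r n) x - u r0 x\<bar> \<partial>?L)" for n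
    proof -
      have "integrable ?L (\<lambda>x. u (r n) x - u r0 x)" using u_integrable r r0 by simp
      then show ?thesis unfolding L1_norm_def by (subst nn_integral_eq_integral) auto
    qed
    ultimately show ?thesis by simp
  qed
  have v_lim: "(\<lambda>n. \<integral>x. \<bar>v (r n) x - v r0 x\<bar> \<partial>?L) \<longlonglongrightarrow> (\<integral>x. 0 \<partial>?L)"
  proof -
    have "compact ({0..T} \<times> cbox (- a) a)" by (intro compact_Times) auto
    then obtain B where B: "\<And>z. z \<in> {0..T} \<times> cbox (- a) a \<Longrightarrow> \<bar>V z\<bar> \<le> B"
      using continuous_on_compact_abs_bound[OF V_continuous] by blast
    have Bv: "\<bar>v s x\<bar> \<le> B" if "s \<in> {0..T}" "x \<in> cbox (- a) a" for s x using B[of "(s, x)"] that by simp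
    show ?thesis
    proof (rule integral_dominated_convergence[where w="\<lambda>_. 2 * B"])
      show "(\<lambda>x. \<bar>v (r n) x - v r0 x\<bar>) \<in> borel_measurable ?L" for n
        using v_slice_lebesgue(1)[OF r] v_slice_lebesgue(1)[OF r0] by auto
      have "emeasure ?L (space ?L) = emeasure lborel (cbox (- a) a)"
        by (subst emeasure_restrict_space) (auto simp: space_restrict_space)
      then have "finite_measure ?L" using emeasure_lborel_cbox_finite[of "- a" a]
        by (intro finite_measureI) auto
      then show "integrable ?L (\<lambda>_. 2 * B)" by (intro finite_measure.integrable_const)
      show "AE x in ?L. (\<lambda>n. \<bar>v (r n) x - v r0 x\<bar>) \<longlonglongrightarrow> 0"
      proof (rule AE_I2)
        fix x assume "x \<in> space ?L"
        then have x: "x \<in> cbox (- a) a" by simp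
        have "(\<lambda>n. (r n, x)) \<longlonglongrightarrow> (r0, x)" by (intro tendsto_intros lim)
        then have "(\<lambda>n. V (r n, x)) \<longlonglongrightarrow> V (r0, x)"
          by (rule continuous_on_tendsto_compose[OF V_continuous]) (use r r0 x in auto)
        then have "(\<lambda>n. \<bar>V (r n, x) - V (r0, x)\<bar>) \<longlonglongrightarrow> \<bar>V (r0, x) - V (r0, x)\<bar>" by (intro tendsto_intros)
        then show "(\<lambda>n. \<bar>v (r n) x - v r0 x\<bar>) \<longlonglongrightarrow> 0" by simp
      qed
      show "AE x in ?L. norm \<bar>v (r n) x - v r0 x\<bar> \<le> 2 * B" for n
      proof (rule AE_I2)
        fix x assume "x \<in> space ?L"
        then have x: "x \<in> cbox (- a) a" by simp
        show "norm \<bar>v (r n) x - v r0 x\<bar> \<le> 2 * B"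
          using Bv[OF r x, of n] Bv[OF r0 x] unfolding real_norm_def by linarith
      qed
    qed simp
  qed
  have le: "norm (err (r n) - err r0) \<le> (\<integral>x. \<bar>u (r n) x - u r0 x\<bar> \<partial>?L) + (\<integral>x. \<bar>v (r n) x - v r0 x\<bar> \<partial>?L)" for n
  proof -
    note i = diff_integrable[OF r[of n]] diff_integrable[OF r0] u_integrable[OF r[of n]] u_integrable[OF r0]
      v_slice_lebesgue(1)[OF r[of n]] v_slice_lebesgue(1)[OF r0]
    have "err (r n) - err r0 = (\<integral>x. \<bar>u (r n) x - v (r n) x\<bar> - \<bar>u r0 x - v r0 x\<bar> \<partial>?L)"
      unfolding err_def using i by simp
    also have "\<bar>\<dots>\<bar> \<le> (\<integral>x. \<bar>u (r n) x - u r0 x\<bar> + \<bar>v (r n) x - v r0 x\<bar> \<partial>?L)"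
      by (rule abs_integral_le) (use i in auto)
    also have "\<dots> = (\<integral>x. \<bar>u (r n) x - u r0 x\<bar> \<partial>?L) + (\<integral>x. \<bar>v (r n) x - v r0 x\<bar> \<partial>?L)"
      using i by simp
    finally show ?thesis by simp
  qed
  have "(\<lambda>n. (\<integral>x. \<bar>u (r n) x - u r0 x\<bar> \<partial>?L) + (\<integral>x. \<bar>v (r n) x - v r0 x\<bar> \<partial>?L)) \<longlonglongrightarrow> 0"
    using tendsto_add[OF u_lim v_lim] by simp
  then have "(\<lambda>n. err (r n) - err r0) \<longlonglongrightarrow> 0"
    by (rule Lim_null_comparison[OF always_eventually[OF allI[OF le]]])
  then show ?thesis by (rule LIM_zero_cancel)
qed

lemma residual_slice_norm_integrable: "integrable lborel (\<lambda>r. indicator {s..t} r * (LBINT x. \<bar>R (r, x)\<bar>))"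
proof -
  have "integrable lborel (\<lambda>z. \<bar>R z\<bar>)" using R_integrable(2) by simp
  from lborel_Fubini(2)[OF this] show ?thesis
    by (intro integrable_indicator_times) (auto simp: indicator_def)
qed

text \<open>\<open>err_increment\<close> is available for \<open>0 < s < t < T\<close> only;
  shrinking the interval from both sides and letting it fill \<open>{0..t}\<close> reaches
  \<open>t = T\<close> and the initial time as well.\<close>

lemma err_bound:
  assumes t: "t \<in> {0..T}"
  shows "err t \<le> err 0 + (LBINT r. indicator {0..t} r * (LBINT x. \<bar>R (r, x)\<bar>))"
proof (cases "t = 0")
  case True
  have "0 \<le> (LBINT r. indicator {0..t} r * (LBINT x. \<bar>R (r, x)\<bar>))"
    by (intro integral_nonneg_AE AE_I2) simp
  then show ?thesis using True by simp
next
  case False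
  then have t0: "0 < t" using t by simp
  \<comment> \<open>This is \<open>t / (n + 3)\<close>, at most a third of \<open>t\<close>. Hence
    \<open>s n < t - s n\<close> for every \<open>n\<close>, and \<open>t - s n < T\<close> even
    when \<open>t = T\<close>.\<close>
  define s where "s n = t / real (Suc n + 2)" for n :: nat
  define t' where "t' n = t - s n" for n
  have s: "0 < s n" "3 * s n \<le> t" for n
  proof -
    show "0 < s n" using t0 by (simp add: s_def)
    have "s n \<le> t / 3" unfolding s_def using t0 by (intro divide_left_mono) auto
    then show "3 * s n \<le> t" by simp
  qed
  have st: "s n < t' n" "t' n < T" for n
    using s[of n] t unfolding t'_def by auto
  have s_lim: "s \<longlonglongrightarrow> 0"
  proof -
    have "(\<lambda>n. t / real n) \<longlonglongrightarrow> 0" by (rule lim_const_over_n)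
    then have "(\<lambda>n. t / real (n + 3)) \<longlonglongrightarrow> 0" by (rule LIMSEQ_ignore_initial_segment)
    then show ?thesis by (simp add: s_def[abs_def] add.commute add.left_commute)
  qed
  have t'_lim: "t' \<longlonglongrightarrow> t" using tendsto_diff[OF tendsto_const s_lim, of t] by (simp add: t'_def[abs_def])
  have "s n \<in> {0..T}" "t' n \<in> {0..T}" for n using s[of n] st[of n] by auto
  then have "(\<lambda>n. err (t' n)) \<longlonglongrightarrow> err t" "(\<lambda>n. err (s n)) \<longlonglongrightarrow> err 0"
    using t s_lim t'_lim by (auto intro!: err_tendsto)
  moreover have "err (t' n) \<le> err (s n) + (LBINT r. indicator {0..t} r * (LBINT x. \<bar>R (r, x)\<bar>))" for n
  proof -
    have "(LBINT r. indicator {s n..t' n} r * (LBINT x. \<bar>R (r, x)\<bar>)) \<le>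
        (LBINT r. indicator {0..t} r * (LBINT x. \<bar>R (r, x)\<bar>))"
      using s[of n] by (intro integral_mono residual_slice_norm_integrable mult_right_mono) (auto simp: indicator_def t'_def)
    then show ?thesis using err_increment[OF s(1) st, of n] by linarith
  qed
  ultimately show ?thesis
    using LIMSEQ_le[OF _ tendsto_add[OF _ tendsto_const]] by blast
qed

lemma L1_estimate:
  assumes t: "t \<in> {0..T}"
  shows "L1_norm (cbox (- a) a) (\<lambda>x. u t x - v t x) \<le> L1_norm (cbox (- a) a) (\<lambda>x. u 0 x - v 0 x) +
    (\<integral>\<^sup>+s. L1_norm (cbox (- a) a) (residual v s) \<partial>lebesgue_on {0..t})"
proof -
  let ?N = "LBINT r. indicator {0..t} r * (LBINT x. \<bar>R (r, x)\<bar>)"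
  have S: "{0..t} \<times> cbox (- a) a \<in> sets borel" by (intro borel_closed closed_Times) auto
  have abs_m: "(\<lambda>r::real. ennreal \<bar>r\<bar>) \<in> borel_measurable borel" by simp
  have int: "integrable lborel (\<lambda>z. indicator {0..t} (fst z) * \<bar>R z\<bar>)"
    using R_integrable(2) by (intro integrable_indicator_times) (auto intro!: measurable_comp_fst simp: indicator_def)
  have "(\<integral>\<^sup>+s. L1_norm (cbox (- a) a) (residual v s) \<partial>lebesgue_on {0..t}) =
      (\<integral>\<^sup>+z. ennreal \<bar>R z\<bar> * indicator ({0..t} \<times> cbox (- a) a) z \<partial>lborel)"
    unfolding L1_norm_def by (rule residual_nn_integral(1)[OF abs_m t])
  also have "\<dots> = (\<integral>\<^sup>+z. ennreal (indicator {0..t} (fst z) * \<bar>R z\<bar>) \<partial>lborel)"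
  proof (rule nn_integral_cong)
    fix z :: "real \<times> (real^'n)"
    show "ennreal \<bar>R z\<bar> * indicator ({0..t} \<times> cbox (- a) a) z = ennreal (indicator {0..t} (fst z) * \<bar>R z\<bar>)"
    proof (cases "z \<in> W")
      case True
      then show ?thesis using box_subset_cbox[of "- a" a] by (cases z) (auto simp: indicator_def)
    next
      case False
      then show ?thesis by (simp add: out_zero(4))
    qed
  qed
  also have "\<dots> = ennreal (LBINT z. indicator {0..t} (fst z) * \<bar>R z\<bar>)"
    by (rule nn_integral_eq_integral[OF int]) auto
  also have "(LBINT z. indicator {0..t} (fst z) * \<bar>R z\<bar>) = ?N"
    using lborel_Fubini(3)[OF int] by simp
  finally have N: "(\<integral>\<^sup>+s. L1_norm (cbox (- a) a) (residual v s) \<partial>lebesgue_on {0..t}) = ennreal ?N" .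
  have "0 \<le> ?N" by (intro integral_nonneg_AE AE_I2) simp
  moreover have "0 \<le> err 0" unfolding err_def by simp
  ultimately show ?thesis
    unfolding N using err_bound[OF t] t L1_norm_err[OF t] L1_norm_err[of 0]
    by (simp add: ennreal_leI flip: ennreal_plus)
qed

end

text \<open>The factor \<open>1 / \<kappa> + 1 / \<nu>\<close> is at least 1 when multiplied by
  either weight, so each weighted term dominates its counterpart on the left; \<open>X\<close>, the
  boundary part of the loss, can only enlarge the right side.\<close>

lemma ennreal_weighted_le:
  fixes A B B' X :: ennreal
  assumes "0 < \<kappa>" "0 < \<nu>" "B \<le> B'" "0 \<le> C"
  shows "ennreal C * (A + B) \<le> ennreal (C * (1 / \<kappa> + 1 / \<nu>)) * (ennreal \<kappa> * B' + X + ennreal \<nu> * A)"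
proof -
  have 1: "ennreal C \<le> ennreal (C * (1 / \<kappa> + 1 / \<nu>)) * ennreal \<nu>"
    and 2: "ennreal C \<le> ennreal (C * (1 / \<kappa> + 1 / \<nu>)) * ennreal \<kappa>"
    using assms by (auto simp: ennreal_mult[symmetric] intro!: ennreal_leI simp: field_simps)
  have "ennreal C * (A + B) \<le> ennreal C * A + ennreal C * B'"
    using assms by (simp add: distrib_left mult_left_mono)
  also have "\<dots> \<le> ennreal (C * (1 / \<kappa> + 1 / \<nu>)) * ennreal \<nu> * A + ennreal (C * (1 / \<kappa> + 1 / \<nu>)) * ennreal \<kappa> * B'"
    by (intro add_mono mult_right_mono 1 2) auto
  also have "\<dots> \<le> ennreal (C * (1 / \<kappa> + 1 / \<nu>)) * (ennreal \<kappa> * B' + X + ennreal \<nu> * A)"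
    by (simp add: distrib_left mult.assoc add.commute add.left_commute add_increasing)
  finally show ?thesis .
qed

theorem mainTheorem1:
  fixes a :: "real^'n" and T \<kappa> \<mu> \<nu> :: real
    and u0 :: "real^'n \<Rightarrow> real" and u :: "real \<Rightarrow> real^'n \<Rightarrow> real"
  assumes a_pos: "\<forall>i. 0 < a $ i"
    and T_pos: "0 < T"
    and weights_pos: "0 < \<kappa>" "0 < \<mu>" "0 < \<nu>"
    and sol: "strong_solution a T u0 u"
    and u_nonneg: "\<forall>t\<in>{0..T}. AE x in lebesgue_on (cbox (- a) a). 0 \<le> u t x"
  shows "\<exists>C1>0. \<exists>C>0. \<exists>C2>0. \<forall>v :: real \<Rightarrow> real^'n \<Rightarrow> real.
    smooth_up_to_boundary ({0..T} \<times> cbox (- a) a) (\<lambda>(t, x). v t x) \<and>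
    (\<forall>t\<in>{0..T}. \<forall>x\<in>frontier (cbox (- a) a). v t x = 0) \<longrightarrow>
    (\<forall>t\<in>{0..T}.
       L1_norm (cbox (- a) a) (\<lambda>x. u t x - v t x)
         \<le> L1_norm (cbox (- a) a) (\<lambda>x. u0 x - v 0 x) +
           (\<integral>\<^sup>+s. L1_norm (cbox (- a) a) (residual v s) \<partial>lebesgue_on {0..t}) \<and>
       L1_norm (cbox (- a) a) (\<lambda>x. u0 x - v 0 x) +
           (\<integral>\<^sup>+s. L1_norm (cbox (- a) a) (residual v s) \<partial>lebesgue_on {0..t})
         \<le> ennreal C1 * PINN_L1 a T \<kappa> \<mu> \<nu> u0 v \<and>
       (L1_norm (cbox (- a) a) (\<lambda>x. u t x - v t x))\<^sup>2
         \<le> ennreal C * (L2_norm_sq (cbox (- a) a) (\<lambda>x. u0 x - v 0 x) +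
             (\<integral>\<^sup>+s. L2_norm_sq (cbox (- a) a) (residual v s) \<partial>lebesgue_on {0..t})) \<and>
       ennreal C * (L2_norm_sq (cbox (- a) a) (\<lambda>x. u0 x - v 0 x) +
             (\<integral>\<^sup>+s. L2_norm_sq (cbox (- a) a) (residual v s) \<partial>lebesgue_on {0..t}))
         \<le> ennreal C2 * PINN_L2 a T \<kappa> \<mu> \<nu> u0 v)"
proof -
  \<comment> \<open>An upper bound for the volume of \<open>\<Omega>\<close> that is at least 1, so
    the positivity of the constants below is immediate.\<close>
  define m where "m = measure lborel (cbox (- a) a) + 1"
  have m: "1 \<le> m" by (simp add: m_def)
  have em: "emeasure lborel (cbox (- a) a) \<le> ennreal m"
    using emeasure_lborel_cbox_finite[of "- a" a]
    by (subst emeasure_eq_ennreal_measure) (auto simp: m_def intro!: ennreal_leI)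
  \<comment> \<open>Cauchy-Schwarz costs \<open>m\<close> for the initial term and
    \<open>T * m\<close> for the space-time term, and squaring the sum costs a factor 2;
    \<open>C\<close> is the sum of \<open>2 * m\<close> and \<open>2 * T * m\<close>. Together with
    \<open>w\<close> it is fixed before \<open>v\<close> and \<open>t\<close> are
    introduced.\<close>
  define C where "C = 2 * m * (1 + T)"
  have C: "0 < C" using m T_pos by (simp add: C_def)
  define w where "w = 1 / \<kappa> + 1 / \<nu>"
  have w: "0 < w" using weights_pos by (simp add: w_def add_pos_pos)
  obtain U F where "energy_solution a T u U F" using strong_solution_energy[OF a_pos T_pos sol u_nonneg] by blast
  then interpret energy_solution a T u U F .
  show ?thesis
  proof (rule exI[of _ w], rule conjI[OF w], rule exI[of _ C], rule conjI[OF C], rule exI[of _ "C * w"],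
      intro conjI allI impI ballI mult_pos_pos[OF C w])
    fix v :: "real \<Rightarrow> real^'n \<Rightarrow> real" and t
    assume v: "smooth_up_to_boundary ({0..T} \<times> cbox (- a) a) (\<lambda>(t, x). v t x) \<and>
      (\<forall>t\<in>{0..T}. \<forall>x\<in>frontier (cbox (- a) a). v t x = 0)" and t: "t \<in> {0..T}"
    interpret pinn_comparison a T u U F v by unfold_locales (use v in auto)
    let ?B = "cbox (- a) a"
    have u0: "AE x in lborel. x \<in> ?B \<longrightarrow> u 0 x = u0 x"
      using sol unfolding strong_solution_def by (simp add: AE_lebesgue_on_iff)
    have T0: "0 \<in> {0..T}" using T_pos by simp
    obtain d1 where d1: "integrable lborel d1" "AE x in lborel. x \<in> ?B \<longrightarrow> u 0 x = d1 x"
      using u_representative[OF T0] by blast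
    obtain d2 where d2: "d2 \<in> borel_measurable borel" "\<forall>x\<in>?B. v 0 x = d2 x"
      using v_slice_lebesgue(2)[OF T0] by blast
    define d where "d x = d1 x - d2 x" for x
    have dm: "d \<in> borel_measurable borel" unfolding d_def[abs_def] using borel_measurable_integrable[OF d1(1)] d2(1) by simp
    have d0: "AE x in lborel. x \<in> ?B \<longrightarrow> u0 x - v 0 x = d x"
      using u0 d1(2) by eventually_elim (use d2(2) in \<open>auto simp: d_def\<close>)
    have L1d: "L1_norm ?B (\<lambda>x. u0 x - v 0 x) = (\<integral>\<^sup>+x. ennreal \<bar>d x\<bar> * indicator ?B x \<partial>lborel)"
      unfolding L1_norm_def by (rule nn_integral_lebesgue_on) (use d0 in \<open>auto elim!: eventually_mono\<close>)
    have L2d: "L2_norm_sq ?B (\<lambda>x. u0 x - v 0 x) = (\<integral>\<^sup>+x. ennreal ((d x)\<^sup>2) * indicator ?B x \<partial>lborel)"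
      unfolding L2_norm_sq_def by (rule nn_integral_lebesgue_on) (use d0 in \<open>auto elim!: eventually_mono\<close>)
    have L1u: "L1_norm ?B (\<lambda>x. u 0 x - v 0 x) = L1_norm ?B (\<lambda>x. u0 x - v 0 x)"
    proof -
      have "L1_norm ?B (\<lambda>x. u 0 x - v 0 x) = (\<integral>\<^sup>+x. ennreal \<bar>d x\<bar> * indicator ?B x \<partial>lborel)"
        unfolding L1_norm_def
      proof (rule nn_integral_lebesgue_on)
        show "AE x in lborel. x \<in> ?B \<longrightarrow> ennreal \<bar>u 0 x - v 0 x\<bar> = ennreal \<bar>d x\<bar>"
          using u0 d0 by eventually_elim auto
      qed simp
      then show ?thesis unfolding L1d .
    qed
    have abs_m: "(\<lambda>r::real. ennreal \<bar>r\<bar>) \<in> borel_measurable borel" by simp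
    have sq_m: "(\<lambda>r::real. ennreal (r\<^sup>2)) \<in> borel_measurable borel" by simp
    have TT: "T \<in> {0..T}" using T_pos by simp
    define B1 where "B1 t = (\<integral>\<^sup>+z. ennreal \<bar>R z\<bar> * indicator ({0..t} \<times> ?B) z \<partial>lborel)" for t
    define B2 where "B2 t = (\<integral>\<^sup>+z. ennreal ((R z)\<^sup>2) * indicator ({0..t} \<times> ?B) z \<partial>lborel)" for t
    have R1: "(\<integral>\<^sup>+s. L1_norm ?B (residual v s) \<partial>lebesgue_on {0..t}) = B1 t"
      unfolding L1_norm_def B1_def by (rule residual_nn_integral(1)[OF abs_m t])
    have R2: "(\<integral>\<^sup>+s. L2_norm_sq ?B (residual v s) \<partial>lebesgue_on {0..t}) = B2 t"
      unfolding L2_norm_sq_def B2_def by (rule residual_nn_integral(1)[OF sq_m t])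
    have P1: "(\<integral>\<^sup>+(t, x). ennreal \<bar>residual v t x\<bar> \<partial>lebesgue_on ({0..T} \<times> ?B)) = B1 T"
      unfolding B1_def by (rule residual_nn_integral(2)[OF abs_m TT])
    have P2: "(\<integral>\<^sup>+(t, x). ennreal ((residual v t x)\<^sup>2) \<partial>lebesgue_on ({0..T} \<times> ?B)) = B2 T"
      unfolding B2_def by (rule residual_nn_integral(2)[OF sq_m TT])
    \<comment> \<open>The loss integrates the residual up to \<open>T\<close>, the estimate only up
      to \<open>t\<close>.\<close>
    have mono: "B1 t \<le> B1 T" "B2 t \<le> B2 T"
      unfolding B1_def B2_def using t by (auto intro!: nn_integral_mono mult_left_mono simp: indicator_def)
    show e1: "L1_norm ?B (\<lambda>x. u t x - v t x) \<le> L1_norm ?B (\<lambda>x. u0 x - v 0 x) +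
        (\<integral>\<^sup>+s. L1_norm ?B (residual v s) \<partial>lebesgue_on {0..t})"
      using L1_estimate[OF t] unfolding L1u .
    have i1: "(\<integral>\<^sup>+x. ennreal \<bar>v 0 x - u0 x\<bar> \<partial>lebesgue_on ?B) = L1_norm ?B (\<lambda>x. u0 x - v 0 x)"
      unfolding L1_norm_def by (simp add: abs_minus_commute)
    have i2: "(\<integral>\<^sup>+x. ennreal ((v 0 x - u0 x)\<^sup>2) \<partial>lebesgue_on ?B) = L2_norm_sq ?B (\<lambda>x. u0 x - v 0 x)"
      unfolding L2_norm_sq_def by (simp add: power2_commute)
    show "L1_norm ?B (\<lambda>x. u0 x - v 0 x) + (\<integral>\<^sup>+s. L1_norm ?B (residual v s) \<partial>lebesgue_on {0..t})
         \<le> ennreal w * PINN_L1 a T \<kappa> \<mu> \<nu> u0 v"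
      unfolding R1 PINN_L1_def P1 i1 w_def
      using ennreal_weighted_le[OF weights_pos(1,3) mono(1), of 1 "L1_norm ?B (\<lambda>x. u0 x - v 0 x)"] by simp
    show "ennreal C * (L2_norm_sq ?B (\<lambda>x. u0 x - v 0 x) + (\<integral>\<^sup>+s. L2_norm_sq ?B (residual v s) \<partial>lebesgue_on {0..t}))
         \<le> ennreal (C * w) * PINN_L2 a T \<kappa> \<mu> \<nu> u0 v"
      unfolding R2 PINN_L2_def P2 i2 w_def
      using C by (intro ennreal_weighted_le weights_pos mono) auto
    show "(L1_norm ?B (\<lambda>x. u t x - v t x))\<^sup>2 \<le> ennreal C * (L2_norm_sq ?B (\<lambda>x. u0 x - v 0 x) +
             (\<integral>\<^sup>+s. L2_norm_sq ?B (residual v s) \<partial>lebesgue_on {0..t}))"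
    proof -
      let ?A = "L1_norm ?B (\<lambda>x. u0 x - v 0 x)" and ?A2 = "L2_norm_sq ?B (\<lambda>x. u0 x - v 0 x)"
      have S: "{0..t} \<times> ?B \<in> sets borel" by (intro borel_closed closed_Times) auto
      have "?A\<^sup>2 \<le> emeasure lborel ?B * ?A2"
        unfolding L1d L2d using dm by (intro nn_Cauchy_Schwarz_set) auto
      also have "\<dots> \<le> ennreal m * ?A2" by (intro mult_right_mono em) simp
      finally have a: "?A\<^sup>2 \<le> ennreal m * ?A2" .
      have "(B1 t)\<^sup>2 \<le> emeasure lborel ({0..t} \<times> ?B) * B2 t"
        unfolding B1_def B2_def using R_meas S by (intro nn_Cauchy_Schwarz_set) auto
      also have "emeasure lborel ({0..t} \<times> ?B) = emeasure (lborel \<Otimes>\<^sub>M lborel) ({0..t} \<times> ?B)"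
        by (simp add: lborel_prod)
      also have "\<dots> = ennreal t * emeasure lborel ?B"
        using t by (subst lborel.emeasure_pair_measure_Times) auto
      also have "\<dots> * B2 t \<le> ennreal T * ennreal m * B2 t"
        using t by (intro mult_right_mono mult_mono em ennreal_leI) auto
      finally have b: "(B1 t)\<^sup>2 \<le> ennreal T * ennreal m * B2 t" .
      have "(L1_norm ?B (\<lambda>x. u t x - v t x))\<^sup>2 \<le> (?A + B1 t)\<^sup>2"
        using e1 unfolding R1 by (intro power_mono) auto
      also have "\<dots> \<le> 2 * ?A\<^sup>2 + 2 * (B1 t)\<^sup>2" by (rule ennreal_sum_square_le)
      also have "\<dots> \<le> 2 * (ennreal m * ?A2) + 2 * (ennreal T * ennreal m * B2 t)"
        by (intro add_mono mult_left_mono a b) auto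
      also have "2 * (ennreal m * ?A2) = ennreal (2 * m) * ?A2"
        using m by (simp add: ennreal_mult mult.assoc)
      also have "2 * (ennreal T * ennreal m * B2 t) = ennreal (2 * T * m) * B2 t"
        using m T_pos by (simp add: ennreal_mult mult.assoc)
      also have "ennreal (2 * m) * ?A2 + ennreal (2 * T * m) * B2 t \<le> ennreal C * ?A2 + ennreal C * B2 t"
        using m T_pos by (intro add_mono mult_right_mono ennreal_leI) (auto simp: C_def algebra_simps)
      finally show ?thesis unfolding R2 by (simp add: distrib_left)
    qed
  qed
qed

end
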